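(* Let $X$ be an asymptotic $\ell_1$ space. Let $\gamma\in\Delta(X)$, let $(y_i)\prec X$ $\Delta$-stabilize $\gamma$, and let $Y=[y_i]$. If there exists $\alpha<\omega_1$ such that $\gamma_\alpha>0$ and $$\lim_{n\to\infty}\gamma_{\alpha\cdot n}\,\widehat\gamma_\alpha(Y)^{-n}=0,\qquad\text{where }\widehat\gamma_\alpha(Y)=\lim_{k\to\infty}(\gamma_{\alpha\cdot k})^{1/k},$$ then $Y$ contains an arbitrarily distortable subspace.
   Context: Spaces and subspaces are (closed) separable infinite-dimensional Banach spaces; ordinal arithmetic is the usual one. For a basic sequence $(x_i)$, $(y_i)\prec(x_i)$ means that $(y_i)$ is a (finite or infinite) block basis of $(x_i)$; for $X$ with a given basis, $(y_i)\prec X$ means that $(y_i)$ is a block basis of that basis; $[y_i]$ is the closed linear span. Supports are w.r.t. the indicated basic sequence, and $x<y$ means $\max\operatorname{supp}x<\min\operatorname{supp}y$. A space $X$ with a basis $(e_i)$ is asymptotic $\ell_1$ (w.r.t. $(e_i)$) if there is $C$ such that for all $n$ and all finitely supported $e_n\le x_1<\dots<x_n$ (i.e. $n\le\min\operatorname{supp}x_1$), $\|\sum_1^nx_i\|\ge(1/C)\sum_1^n\|x_i\|$. For an equivalent norm $|\cdot|$ on $(Z,\|\cdot\|)$, $d(Z,|\cdot|)=\inf_W\sup\{|x|/|y|:x,y\in W,\ \|x\|=\|y\|=1\}$, the infimum over all infinite-dimensional subspaces $W$ of $Z$. For $\lambda>1$, $Z$ is $\lambda$-distortable if there is an equivalent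 norm $|\cdot|$ on $Z$ with $d(Z,|\cdot|)\ge\lambda$; $Z$ is arbitrarily distortable if it is $\lambda$-distortable for all $\lambda>1$. For finite $F,G\subseteq\mathbb N$, $F<G$ means $\max F<\min G$ (or one is empty); $F\ge n$ means $\min F\ge n$. Schreier classes: for sets $\mathcal F,\mathcal G$ of finite subsets of $\mathbb N$, $\mathcal F[\mathcal G]=\{\bigcup_1^nG_i: n\in\mathbb N, G_1<\dots<G_n, G_i\in\mathcal G, (\min G_i)_1^n\in\mathcal F\}$. $\mathcal S_0=\{\{n\}:n\in\mathbb N\}\cup\{\emptyset\}$, $\mathcal S_1=\{F:\min F\ge|F|\}\cup\{\emptyset\}$, $\mathcal S_{\alpha+1}=\mathcal S_1[\mathcal S_\alpha]$, and for a limit ordinal $\alpha<\omega_1$ one fixes $\alpha_n\uparrow\alpha$ and sets $\mathcal S_\alpha=\{F:\text{for some }n,\ F\in\mathcal S_{\alpha_n}\text{ and }F\ge n\}$. A finite block sequence $(y_i)_1^k\prec(x_i)$ is $\alpha$-admissible w.r.t. $(x_i)$ if $(\min\operatorname{supp}(y_i))_{i=1}^k\in\mathcal S_\alpha$. $\delta_\alpha(x_i)$ is the supremum of $\delta\ge0$ such that $\|\sum_1^ky_i\|\ge\delta\sum_1^k\|y_i\|$ for all $(y_i)_1^k\prec(x_i)$ $\alpha$-admissible w.r.t. $(x_i)$. A basic sequence $(x_i)$ $\Delta$-stabilizes $\gamma=(\gamma_\alpha)_{\alpha<\omega_1}\subseteq\mathbb R$ if there exist $\varepsilon_n\downarrow0$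 so that for every $\alpha<\omega_1$ there is $m\in\mathbb N$ such that for all $n\ge m$, if $(y_i)\prec(x_i)_n^\infty$ then $|\delta_\alpha(y_i)-\gamma_\alpha|<\varepsilon_n$. $\Delta(X)$ is the set of all $\gamma$ that are $\Delta$-stabilized by some block basis of the basis of $X$. For $\gamma\in\Delta(X)$ one has $\gamma_\alpha\gamma_\beta\le\gamma_{\beta+\alpha}$, so the limit defining $\widehat\gamma_\alpha(Y)$ exists. *)

theory Defs
  imports "HOL-Analysis.Analysis" "HOL-Library.Countable_Set_Type"
begin

section \<open>The countable ordinals\<close>

text \<open>
  \<open>cardSuc natLeq\<close> is a well-order of minimal order type among the uncountable ones, so the elements
  of its field, ordered by it, are the ordinals below \<open>\<omega>\<^sub>1\<close>.
\<close>

typedef omega1 = "Field (cardSuc natLeq)"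
proof -
  have "\<not> finite (Field (cardSuc natLeq))"
    using cardSuc_finite[OF natLeq_Card_order] by (simp add: Field_natLeq)
  then show ?thesis
    by (metis all_not_in_conv finite.emptyI)
qed

lemma Well_order_cardSuc_natLeq: "Well_order (cardSuc natLeq)"
  by (rule cardSuc_Well_order[OF natLeq_Card_order])

instantiation omega1 :: wellorder
begin

definition less_eq_omega1 :: "omega1 \<Rightarrow> omega1 \<Rightarrow> bool" where
  "\<alpha> \<le> \<beta> \<longleftrightarrow> (Rep_omega1 \<alpha>, Rep_omega1 \<beta>) \<in> cardSuc natLeq"

definition less_omega1 :: "omega1 \<Rightarrow> omega1 \<Rightarrow> bool" where
  "\<alpha> < \<beta> \<longleftrightarrow> \<alpha> \<le> \<beta> \<and> \<not> \<beta> \<le> (\<alpha>::omega1)"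

instance
proof
  note wo = Well_order_cardSuc_natLeq[unfolded order_on_defs]
  fix x y z :: omega1
  show "x < y \<longleftrightarrow> x \<le> y \<and> \<not> y \<le> x"
    by (simp add: less_omega1_def)
  show "x \<le> x"
    using wo Rep_omega1[of x] by (auto simp: less_eq_omega1_def refl_on_def)
  show "x \<le> y \<Longrightarrow> y \<le> z \<Longrightarrow> x \<le> z"
    using wo unfolding less_eq_omega1_def by (meson transE)
  show anti: "x \<le> y \<Longrightarrow> y \<le> x \<Longrightarrow> x = y" for x y :: omega1
    using wo unfolding less_eq_omega1_def by (metis antisymD Rep_omega1_inject)
  show tot: "x \<le> y \<or> y \<le> x" for x y :: omega1
    using wo_rel.TOTALS[OF wo_rel.intro[OF Well_order_cardSuc_natLeq]] Rep_omega1[of x] Rep_omega1[of y]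
    unfolding less_eq_omega1_def by blast
  fix P :: "omega1 \<Rightarrow> bool" and a :: omega1
  assume step: "\<And>x. (\<And>y. y < x \<Longrightarrow> P y) \<Longrightarrow> P x"
  have "wf (inv_image (cardSuc natLeq - Id) Rep_omega1)"
    using wo by (intro wf_inv_image) auto
  moreover have "{(x, y). x < y} \<subseteq> inv_image (cardSuc natLeq - Id) Rep_omega1"
    by (auto simp: less_omega1_def less_eq_omega1_def inv_image_def)
  ultimately have "wf {(x::omega1, y). x < y}"
    by (rule wf_subset)
  then show "P a"
    by (rule wf_induct_rule) (use step in auto)
qed

end

lemma countable_lessThan_omega1:
  includes cardinal_syntax
  shows "countable {..<\<alpha>::omega1}"
proof -
  let ?r = "cardSuc natLeq"
  have "|underS ?r (Rep_omega1 \<alpha>)| <o ?r"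
    by (rule card_of_underS[OF cardSuc_Card_order[OF natLeq_Card_order] Rep_omega1])
  then have "|underS ?r (Rep_omega1 \<alpha>)| \<le>o natLeq"
    using cardSuc_ordLeq_ordLess[OF natLeq_Card_order card_of_Card_order] by blast
  then have "countable (underS ?r (Rep_omega1 \<alpha>))"
    by (simp add: countable_card_le_natLeq)
  moreover have "Rep_omega1 ` {..<\<alpha>} \<subseteq> underS ?r (Rep_omega1 \<alpha>)"
    by (auto simp: underS_def less_omega1_def less_eq_omega1_def)
  ultimately show ?thesis
    by (metis Rep_omega1_inject countable_image_inj_on countable_subset inj_onI)
qed

lemma uncountable_UNIV_omega1:
  includes cardinal_syntax
  shows "uncountable (UNIV :: omega1 set)"
proof
  assume "countable (UNIV :: omega1 set)"
  then have "countable (Field (cardSuc natLeq))"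
    by (metis countable_image type_definition.Rep_range type_definition_omega1)
  then have "|Field (cardSuc natLeq)| \<le>o natLeq"
    by (simp add: countable_card_le_natLeq)
  then have "cardSuc natLeq \<le>o natLeq"
    using card_of_Field_ordIso[OF cardSuc_Card_order[OF natLeq_Card_order]]
      ordIso_ordLeq_trans ordIso_symmetric by blast
  then show False
    using cardSuc_greater[OF natLeq_Card_order] not_ordLess_ordLeq by blast
qed

lemma omega1_countable_bounded:
  fixes A :: "omega1 set"
  assumes "countable A"
  shows "\<exists>\<beta>. \<forall>\<alpha>\<in>A. \<alpha> < \<beta>"
proof (rule ccontr)
  assume "\<not> ?thesis"
  then have "UNIV \<subseteq> (\<Union>\<alpha>\<in>A. insert \<alpha> {..<\<alpha>})"
    by (force simp: not_less order_le_less)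
  moreover have "countable (\<Union>\<alpha>\<in>A. insert \<alpha> {..<\<alpha>})"
    using assms by (intro countable_UN) (auto simp: countable_lessThan_omega1)
  ultimately show False
    using uncountable_UNIV_omega1 countable_subset by blast
qed

definition osuc :: "omega1 \<Rightarrow> omega1" where
  "osuc \<alpha> = (LEAST \<beta>. \<alpha> < \<beta>)"

lemma less_osuc: "\<alpha> < osuc \<alpha>"
  unfolding osuc_def using omega1_countable_bounded[of "{\<alpha>}"] by (auto intro: LeastI_ex)

lemma osuc_le_iff: "osuc \<alpha> \<le> \<beta> \<longleftrightarrow> \<alpha> < \<beta>"
  using less_osuc[of \<alpha>] by (auto simp: osuc_def intro: Least_le order_less_le_trans)

lemma less_osuc_iff: "\<alpha> < osuc \<beta> \<longleftrightarrow> \<alpha> \<le> \<beta>"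
  by (metis linorder_not_less osuc_le_iff)

lemma osuc_inject: "osuc \<alpha> = osuc \<beta> \<longleftrightarrow> \<alpha> = \<beta>"
  by (metis antisym less_osuc less_osuc_iff)

text \<open>
  Ordinal addition, in the form \<open>\<alpha> + \<beta> = sup ({\<alpha>} \<union> {\<alpha> + \<beta>' + 1 | \<beta>' < \<beta>})\<close>; the usual three recursion
  equations are the lemmas \<open>omega1_add_0\<close>, \<open>omega1_add_osuc\<close> and \<open>omega1_add_limit\<close>.
\<close>

instantiation omega1 :: "{zero, plus}"
begin

definition zero_omega1 :: omega1 where
  "0 = (LEAST \<alpha>::omega1. True)"

function plus_omega1 :: "omega1 \<Rightarrow> omega1 \<Rightarrow> omega1" where
  "plus_omega1 \<alpha> \<beta> = (LEAST \<gamma>. \<alpha> \<le> \<gamma> \<and> (\<forall>\<beta>'\<in>{..<\<beta>}. plus_omega1 \<alpha> \<beta>' < \<gamma>))"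
  by auto
termination
  by (relation "inv_image {(x, y). x < y} snd") (auto intro: wf_inv_image wf)

instance ..

end

declare plus_omega1.simps [simp del]

definition is_limit :: "omega1 \<Rightarrow> bool" where
  "is_limit \<alpha> \<longleftrightarrow> \<alpha> \<noteq> 0 \<and> (\<forall>\<beta>. \<alpha> \<noteq> osuc \<beta>)"

lemma zero_le_omega1 [simp]: "0 \<le> (\<alpha>::omega1)"
  by (simp add: zero_omega1_def Least_le)

lemma is_limit_osuc_less: "is_limit \<alpha> \<Longrightarrow> \<beta> < \<alpha> \<Longrightarrow> osuc \<beta> < \<alpha>"
  by (metis is_limit_def osuc_le_iff order_le_less)

lemma omega1_add_le_iff:
  "\<alpha> + \<beta> \<le> \<gamma> \<longleftrightarrow> \<alpha> \<le> \<gamma> \<and> (\<forall>\<beta>'<\<beta>. \<alpha> + \<beta>' < (\<gamma>::omega1))"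
proof -
  let ?P = "\<lambda>\<gamma>. \<alpha> \<le> \<gamma> \<and> (\<forall>\<beta>'\<in>{..<\<beta>}. \<alpha> + \<beta>' < \<gamma>)"
  have "countable (insert \<alpha> ((+) \<alpha> ` {..<\<beta>}))"
    by (simp add: countable_lessThan_omega1)
  then obtain \<gamma>' where "\<forall>x\<in>insert \<alpha> ((+) \<alpha> ` {..<\<beta>}). x < \<gamma>'"
    using omega1_countable_bounded by blast
  then have "?P \<gamma>'"
    by auto
  then have "?P (LEAST \<gamma>. ?P \<gamma>)"
    by (rule LeastI)
  moreover have eq: "(LEAST \<gamma>. ?P \<gamma>) = \<alpha> + \<beta>"
    by (rule plus_omega1.simps[symmetric])
  ultimately have "?P (\<alpha> + \<beta>)"
    by auto
  moreover have "\<alpha> + \<beta> \<le> \<gamma>" if "?P \<gamma>"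
    unfolding eq[symmetric] using that by (rule Least_le)
  ultimately show ?thesis
    by (auto intro: order_trans order_less_le_trans)
qed

lemma omega1_add_0: "\<alpha> + 0 = (\<alpha>::omega1)"
proof -
  have "\<alpha> + 0 \<le> \<gamma> \<longleftrightarrow> \<alpha> \<le> \<gamma>" for \<gamma>
    using omega1_add_le_iff[of \<alpha> 0 \<gamma>] leD[OF zero_le_omega1] by blast
  then show ?thesis
    by (blast intro: antisym)
qed

lemma omega1_add_less: "\<beta>' < \<beta> \<Longrightarrow> \<alpha> + \<beta>' < \<alpha> + (\<beta>::omega1)"
  using omega1_add_le_iff[of \<alpha> \<beta> "\<alpha> + \<beta>"] by blast

lemma omega1_add_osuc: "\<alpha> + osuc \<beta> = osuc (\<alpha> + \<beta>)"
proof (rule antisym)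
  have "\<alpha> + \<beta>' \<le> \<alpha> + \<beta>" if "\<beta>' \<le> \<beta>" for \<beta>'
    using that omega1_add_less[of \<beta>' \<beta> \<alpha>] by (auto simp: order_le_less)
  moreover have "\<alpha> \<le> \<alpha> + \<beta>"
    using omega1_add_le_iff by blast
  ultimately show "\<alpha> + osuc \<beta> \<le> osuc (\<alpha> + \<beta>)"
    by (subst omega1_add_le_iff) (auto simp: less_osuc_iff less_osuc order_less_imp_le order_le_less_trans)
  show "osuc (\<alpha> + \<beta>) \<le> \<alpha> + osuc \<beta>"
    by (simp add: osuc_le_iff omega1_add_less less_osuc)
qed

lemma omega1_add_limit:
  assumes "is_limit \<beta>"
  shows "\<alpha> + \<beta> \<le> \<gamma> \<longleftrightarrow> (\<forall>\<beta>'<\<beta>. \<alpha> + \<beta>' \<le> \<gamma>)"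
proof
  assume *: "\<forall>\<beta>'<\<beta>. \<alpha> + \<beta>' \<le> \<gamma>"
  have "0 < \<beta>"
    using assms zero_le_omega1[of \<beta>] by (metis is_limit_def order_le_less)
  then have "\<alpha> \<le> \<gamma>"
    using * omega1_add_0[of \<alpha>] by force
  moreover have "\<alpha> + \<beta>' < \<gamma>" if "\<beta>' < \<beta>" for \<beta>'
    using * is_limit_osuc_less[OF assms that] by (auto simp: omega1_add_osuc osuc_le_iff)
  ultimately show "\<alpha> + \<beta> \<le> \<gamma>"
    by (simp add: omega1_add_le_iff)
next
  assume "\<alpha> + \<beta> \<le> \<gamma>"
  then show "\<forall>\<beta>'<\<beta>. \<alpha> + \<beta>' \<le> \<gamma>"
    using omega1_add_le_iff order_less_imp_le by blast
qed

text \<open>The ordinal product \<open>\<alpha> \<cdot> n\<close> with a finite right factor.\<close>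

primrec omul :: "omega1 \<Rightarrow> nat \<Rightarrow> omega1" (infixl "\<odot>" 70) where
  "\<alpha> \<odot> 0 = 0"
| "\<alpha> \<odot> Suc n = \<alpha> \<odot> n + \<alpha>"


section \<open>Schreier classes\<close>

text \<open>
  Here and below \<open>\<nat> = {1, 2, \<dots>}\<close>. Sequences are functions on \<open>nat\<close> whose value at \<open>0\<close> is never used.
\<close>

definition set_less :: "nat set \<Rightarrow> nat set \<Rightarrow> bool" where
  "set_less F G \<longleftrightarrow> F = {} \<or> G = {} \<or> Max F < Min G"

text \<open>
  \<open>\<F>[\<G>]\<close>. Empty \<open>G\<^sub>i\<close> contribute nothing to the union and have no minimum, so they are left out;
  \<open>n = 0\<close> accounts for a union of empty sets.
\<close>

definition set_conv :: "nat set set \<Rightarrow> nat set set \<Rightarrow> nat set set" where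
  "set_conv \<F> \<G> = {\<Union>i\<in>{1..n}. G i | (n::nat) G.
     (\<forall>i\<in>{1..n}. G i \<in> \<G> \<and> G i \<noteq> {}) \<and>
     (\<forall>i\<in>{1..n}. \<forall>j\<in>{1..n}. i < j \<longrightarrow> set_less (G i) (G j)) \<and>
     (\<lambda>i. Min (G i)) ` {1..n} \<in> \<F>}"

definition schreier_0 :: "nat set set" where
  "schreier_0 = {{n} | n. n \<ge> 1} \<union> {{}}"

definition schreier_1 :: "nat set set" where
  "schreier_1 = {F. finite F \<and> F \<subseteq> {1..} \<and> F \<noteq> {} \<and> Min F \<ge> card F} \<union> {{}}"

text \<open>A choice, for every limit ordinal \<open>\<alpha> < \<omega>\<^sub>1\<close>, of a sequence \<open>\<alpha>\<^sub>n \<up> \<alpha>\<close> (\<open>n \<ge> 1\<close>).\<close>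

definition ladder_system :: "(omega1 \<Rightarrow> nat \<Rightarrow> omega1) \<Rightarrow> bool" where
  "ladder_system A \<longleftrightarrow> (\<forall>\<alpha>. is_limit \<alpha> \<longrightarrow>
     strict_mono_on {1..} (A \<alpha>) \<and> (\<forall>n\<ge>1. A \<alpha> n < \<alpha>) \<and> (\<forall>\<beta><\<alpha>. \<exists>n\<ge>1. \<beta> < A \<alpha> n))"

text \<open>
  The Schreier classes for the choice \<open>A\<close>. The guards \<open>\<beta> < \<alpha>\<close> and \<open>A \<alpha> n < \<alpha>\<close> are there for termination
  only and hold automatically; see \<open>schreier_osuc\<close> and \<open>schreier_limit\<close>. That \<open>\<S>\<^sub>1\<close> is \<open>schreier_1\<close> is
  the lemma \<open>schreier_osuc_0\<close>.
\<close>

context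
  notes conj_cong [fundef_cong]
begin

function schreier :: "(omega1 \<Rightarrow> nat \<Rightarrow> omega1) \<Rightarrow> omega1 \<Rightarrow> nat set set" where
  "schreier A \<alpha> =
     (if \<alpha> = 0 then schreier_0
      else if is_limit \<alpha> then {F. \<exists>n\<ge>1. A \<alpha> n < \<alpha> \<and> F \<in> schreier A (A \<alpha> n) \<and> F \<subseteq> {n..}}
      else {F. \<exists>\<beta>. \<beta> < \<alpha> \<and> \<alpha> = osuc \<beta> \<and> F \<in> set_conv schreier_1 (schreier A \<beta>)})"
  by auto
termination
  by (relation "inv_image {(x, y). x < y} snd") (auto intro: wf_inv_image wf)

end

declare schreier.simps [simp del]

lemma schreier_zero: "schreier A 0 = schreier_0"
  by (simp add: schreier.simps)

lemma osuc_neq_0: "osuc \<alpha> \<noteq> 0"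
  by (metis less_osuc linorder_not_le zero_le_omega1)

lemma schreier_osuc: "schreier A (osuc \<alpha>) = set_conv schreier_1 (schreier A \<alpha>)"
  by (subst schreier.simps) (auto simp: is_limit_def osuc_neq_0 less_osuc osuc_inject)

lemma schreier_limit:
  "ladder_system A \<Longrightarrow> is_limit \<alpha> \<Longrightarrow>
     schreier A \<alpha> = {F. \<exists>n\<ge>1. F \<in> schreier A (A \<alpha> n) \<and> F \<subseteq> {n..}}"
  by (subst schreier.simps) (auto simp: is_limit_def ladder_system_def)

lemma schreier_osuc_0: "schreier A (osuc 0) = schreier_1"
proof (intro set_eqI iffI)
  fix F assume "F \<in> schreier A (osuc 0)"
  then obtain n :: nat and G where F: "F = (\<Union>i\<in>{1..n}. G i)"
    and G: "\<forall>i\<in>{1..n}. G i \<in> schreier_0 \<and> G i \<noteq> {}"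
    and S: "(\<lambda>i. Min (G i)) ` {1..n} \<in> schreier_1"
    unfolding schreier_osuc schreier_zero set_conv_def by blast
  have "G i = {Min (G i)}" if "i \<in> {1..n}" for i
    using G that by (fastforce simp: schreier_0_def)
  then have "F = (\<Union>i\<in>{1..n}. {Min (G i)})"
    unfolding F by (intro SUP_cong) auto
  then have "F = (\<lambda>i. Min (G i)) ` {1..n}"
    by blast
  with S show "F \<in> schreier_1"
    by simp
next
  fix F assume F: "F \<in> schreier_1"
  then have fin: "finite F" and pos: "F \<subseteq> {1..}"
    by (auto simp: schreier_1_def)
  obtain g where g: "bij_betw g {..<card F} F" "strict_mono_on {..<card F} g"
    using ex_bij_betw_strict_mono_card[OF fin] .
  define h where "h = (\<lambda>i. g (i - 1))"
  have "h ` {1..card F} = g ` (\<lambda>i. i - 1) ` {1..card F}"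
    by (simp add: h_def image_image)
  also have "(\<lambda>i. i - 1) ` {1..card F} = {..<card F}"
  proof
    show "{..<card F} \<subseteq> (\<lambda>i. i - 1) ` {1..card F}"
    proof
      fix i assume "i \<in> {..<card F}"
      then show "i \<in> (\<lambda>i. i - 1) ` {1..card F}"
        by (intro image_eqI[of _ _ "Suc i"]) auto
    qed
  qed auto
  finally have im: "h ` {1..card F} = F"
    using g(1) by (simp add: bij_betw_def)
  have mono: "h i < h j" if "i \<in> {1..card F}" "j \<in> {1..card F}" "i < j" for i j
    unfolding h_def by (rule strict_mono_onD[OF g(2)]) (use that in auto)
  have "F = (\<Union>i\<in>{1..card F}. {h i})"
    using im by blast
  moreover have "{h i} \<in> schreier_0 \<and> {h i} \<noteq> {}" if "i \<in> {1..card F}" for i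
  proof -
    have "h i \<in> F"
      using im that by blast
    then show ?thesis
      using pos by (auto simp: schreier_0_def)
  qed
  moreover have "set_less {h i} {h j}" if "i \<in> {1..card F}" "j \<in> {1..card F}" "i < j" for i j
    using mono[OF that] by (simp add: set_less_def)
  moreover have "(\<lambda>i. Min {h i}) ` {1..card F} \<in> schreier_1"
    using F im by simp
  ultimately show "F \<in> schreier A (osuc 0)"
    unfolding schreier_osuc schreier_zero set_conv_def mem_Collect_eq
    by (intro exI[of _ "card F"] exI[of _ "\<lambda>i. {h i}"]) blast
qed


section \<open>Bases and block bases\<close>

definition closed_span :: "(nat \<Rightarrow> 'a::real_normed_vector) \<Rightarrow> 'a set" where
  "closed_span x = closure (span (x ` {1..}))"

definition basic_sequence :: "(nat \<Rightarrow> 'a::real_normed_vector) \<Rightarrow> bool" where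
  "basic_sequence x \<longleftrightarrow> (\<forall>v\<in>closed_span x. \<exists>!a. (\<lambda>i. a i *\<^sub>R x (Suc i)) sums v)"

definition schauder_basis :: "(nat \<Rightarrow> 'a::real_normed_vector) \<Rightarrow> bool" where
  "schauder_basis x \<longleftrightarrow> basic_sequence x \<and> closed_span x = UNIV"

text \<open>
  Support of a finitely supported vector, i.e. of an element of the algebraic span. A basic sequence
  is injective on \<open>{1..}\<close> with linearly independent range, so \<open>representation\<close> yields the coefficient
  of \<open>x i\<close>.
\<close>

definition supp :: "(nat \<Rightarrow> 'a::real_vector) \<Rightarrow> 'a \<Rightarrow> nat set" where
  "supp x v = {i. i \<ge> 1 \<and> representation (x ` {1..}) v (x i) \<noteq> 0}"

text \<open>
  \<open>(y\<^sub>i)\<^sub>i\<^sub>\<in>\<^sub>I \<prec> (x\<^sub>i)\<close>: used with \<open>I = {1..}\<close> for infinite and with \<open>I = {1..k}\<close> for finite block bases.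
\<close>

definition block_seq :: "(nat \<Rightarrow> 'a::real_vector) \<Rightarrow> nat set \<Rightarrow> (nat \<Rightarrow> 'a) \<Rightarrow> bool" where
  "block_seq x I y \<longleftrightarrow>
     (\<forall>i\<in>I. y i \<in> span (x ` {1..}) \<and> y i \<noteq> 0) \<and>
     (\<forall>i\<in>I. \<forall>j\<in>I. i < j \<longrightarrow> set_less (supp x (y i)) (supp x (y j)))"

text \<open>\<open>(x\<^sub>i)\<^sub>n\<^sup>\<infinity>\<close> for \<open>n \<ge> 1\<close>, renumbered from \<open>1\<close>.\<close>

definition tail_seq :: "nat \<Rightarrow> (nat \<Rightarrow> 'a) \<Rightarrow> nat \<Rightarrow> 'a" where
  "tail_seq n x i = x (i + n - 1)"

definition asymptotic_l1 :: "(nat \<Rightarrow> 'a::real_normed_vector) \<Rightarrow> bool" where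
  "asymptotic_l1 e \<longleftrightarrow> schauder_basis e \<and>
     (\<exists>C>0. \<forall>n\<ge>1. \<forall>x. block_seq e {1..n} x \<and> n \<le> Min (supp e (x 1)) \<longrightarrow>
        norm (\<Sum>i=1..n. x i) \<ge> (1 / C) * (\<Sum>i=1..n. norm (x i)))"


section \<open>The spectrum \<open>\<Delta>(X)\<close>\<close>

definition admissible ::
    "(omega1 \<Rightarrow> nat \<Rightarrow> omega1) \<Rightarrow> omega1 \<Rightarrow> (nat \<Rightarrow> 'a::real_vector) \<Rightarrow> nat \<Rightarrow> (nat \<Rightarrow> 'a) \<Rightarrow> bool" where
  "admissible A \<alpha> x k y \<longleftrightarrow>
     block_seq x {1..k} y \<and> (\<lambda>i. Min (supp x (y i))) ` {1..k} \<in> schreier A \<alpha>"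

definition delta ::
    "(omega1 \<Rightarrow> nat \<Rightarrow> omega1) \<Rightarrow> omega1 \<Rightarrow> (nat \<Rightarrow> 'a::real_normed_vector) \<Rightarrow> real" where
  "delta A \<alpha> x = Sup {\<delta>. \<delta> \<ge> 0 \<and> (\<forall>k y. admissible A \<alpha> x k y \<longrightarrow>
     norm (\<Sum>i=1..k. y i) \<ge> \<delta> * (\<Sum>i=1..k. norm (y i)))}"

definition Delta_stabilizes ::
    "(omega1 \<Rightarrow> nat \<Rightarrow> omega1) \<Rightarrow> (nat \<Rightarrow> 'a::real_normed_vector) \<Rightarrow> (omega1 \<Rightarrow> real) \<Rightarrow> bool" where
  "Delta_stabilizes A x \<gamma> \<longleftrightarrow> basic_sequence x \<and>
     (\<exists>\<epsilon>::nat \<Rightarrow> real. decseq \<epsilon> \<and> \<epsilon> \<longlonglongrightarrow> 0 \<and>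
       (\<forall>\<alpha>. \<exists>m\<ge>1. \<forall>n\<ge>m. \<forall>y. block_seq (tail_seq n x) {1..} y \<longrightarrow> \<bar>delta A \<alpha> y - \<gamma> \<alpha>\<bar> < \<epsilon> n))"

definition Delta_set ::
    "(omega1 \<Rightarrow> nat \<Rightarrow> omega1) \<Rightarrow> (nat \<Rightarrow> 'a::real_normed_vector) \<Rightarrow> (omega1 \<Rightarrow> real) set" where
  "Delta_set A e = {\<gamma>. \<exists>x. block_seq e {1..} x \<and> Delta_stabilizes A x \<gamma>}"

definition gamma_hat :: "(omega1 \<Rightarrow> real) \<Rightarrow> omega1 \<Rightarrow> real" where
  "gamma_hat \<gamma> \<alpha> = lim (\<lambda>k. root k (\<gamma> (\<alpha> \<odot> k)))"


section \<open>Distortion\<close>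

definition inf_dim_closed_subspace :: "'a::real_normed_vector set \<Rightarrow> bool" where
  "inf_dim_closed_subspace W \<longleftrightarrow> subspace W \<and> closed W \<and> \<not> (\<exists>B. finite B \<and> W \<subseteq> span B)"

text \<open>Only the values of \<open>p\<close> on \<open>Z\<close> matter.\<close>

definition equivalent_norm_on :: "'a::real_normed_vector set \<Rightarrow> ('a \<Rightarrow> real) \<Rightarrow> bool" where
  "equivalent_norm_on Z p \<longleftrightarrow>
     (\<forall>v\<in>Z. p v = 0 \<longleftrightarrow> v = 0) \<and>
     (\<forall>c. \<forall>v\<in>Z. p (c *\<^sub>R v) = \<bar>c\<bar> * p v) \<and>
     (\<forall>v\<in>Z. \<forall>w\<in>Z. p (v + w) \<le> p v + p w) \<and>
     (\<exists>a>0. \<exists>b>0. \<forall>v\<in>Z. a * norm v \<le> p v \<and> p v \<le> b * norm v)"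

definition distortion :: "'a::real_normed_vector set \<Rightarrow> ('a \<Rightarrow> real) \<Rightarrow> real" where
  "distortion Z p =
     (INF W\<in>{W. inf_dim_closed_subspace W \<and> W \<subseteq> Z}.
        Sup {p v / p w | v w. v \<in> W \<and> w \<in> W \<and> norm v = 1 \<and> norm w = 1})"

definition distortable :: "real \<Rightarrow> 'a::real_normed_vector set \<Rightarrow> bool" where
  "distortable l Z \<longleftrightarrow> (\<exists>p. equivalent_norm_on Z p \<and> distortion Z p \<ge> l)"

definition arbitrarily_distortable :: "'a::real_normed_vector set \<Rightarrow> bool" where
  "arbitrarily_distortable Z \<longleftrightarrow> (\<forall>l>1. distortable l Z)"

end

theory Submission
  imports Defs
begin

text \<open>
  Put \<open>\<beta> = \<alpha> \<cdot> n\<close> and \<open>\<theta> = \<gamma>\<close>-hat\<open>\<^sub>\<alpha>(Y)\<close>, and let \<open>\<parallel>v\<parallel>\<^sub>k\<close> be the supremum of the sums of the norms of the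
  restrictions of \<open>v\<close> to \<open>\<beta> \<cdot> k\<close>-admissible intervals. For sufficiently sparse \<open>\<beta>\<close>-admissible \<open>(v\<^sub>i)\<close> one
  has \<open>\<Sum>\<parallel>v\<^sub>i\<parallel>\<^sub>k \<le> \<parallel>\<Sum>v\<^sub>i\<parallel>\<^sub>k\<^sub>+\<^sub>1\<close>, while \<open>\<parallel>\<cdot>\<parallel>\<^sub>k\<close> is at most of order \<open>1 / \<gamma>\<^bsub>\<beta>\<cdot>k\<^esub>\<close> times the norm. Hence for
  \<open>t < \<theta>\<^sup>n\<close> and large \<open>K\<close> the equivalent norm \<open>\<Sum>\<^bsub>k\<le>K\<^esub> t\<^sup>k \<parallel>\<cdot>\<parallel>\<^sub>k\<close> has a lower \<open>\<ell>\<^sub>1\<close> estimate with constant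
  \<open>t / 2\<close> on such \<open>(v\<^sub>i)\<close>. If on some subspace it were proportional to the given norm up to a factor
  \<open>R\<close>, a block sequence near that subspace would have \<open>\<delta>\<^sub>\<beta>\<close> at least of order \<open>\<theta>\<^sup>n / R\<close>; but \<open>\<delta>\<^sub>\<beta>\<close> is close to
  \<open>\<gamma>\<^bsub>\<alpha>\<cdot>n\<^esub>\<close>, so \<open>R\<close> is at least of order \<open>\<theta>\<^sup>n / \<gamma>\<^bsub>\<alpha>\<cdot>n\<^esub>\<close>, which is unbounded. So \<open>Y\<close> itself is arbitrarily
  distortable.
\<close>

section \<open>Ordinal arithmetic\<close>

text \<open>Iterating \<open>\<beta>\<close>-admissible sums k times is governed by \<gamma> at
  \<alpha> \<cdot> (n k), so one iteration costs about \<theta> to the power n on average, whereas a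
  single \<open>\<beta>\<close>-admissible sum of blocks costs \<gamma> at \<alpha> \<cdot> n. The
  hypothesis says that these two costs drift apart, and the distortion is their quotient up to a
  constant. Only finitely many auxiliary norms are added because the lower estimate that controls
  the k-th one holds on a tail of the sequence that depends on k, and one tail has to serve them
  all. Cutting the sum off at K leaves the last norm without a successor, which costs one half of
  the constant t. Two obstacles shape the rest. The Schreier class of a sum of ordinals is a
  convolution only for sparse sets; this is harmless, since blocks near a subspace can be chosen as
  far out as needed. Restrictions to intervals must be bounded uniformly; on tails this follows from
  the asymptotic \<ell>1 estimate for two vectors.\<close>

lemma omega1_induct [case_names zero osuc limit]:
  assumes "P 0" and "\<And>\<beta>. P \<beta> \<Longrightarrow> P (osuc \<beta>)"
    and "\<And>\<alpha>. is_limit \<alpha> \<Longrightarrow> (\<And>\<beta>. \<beta> < \<alpha> \<Longrightarrow> P \<beta>) \<Longrightarrow> P \<alpha>"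
  shows "P (\<alpha>::omega1)"
proof (induction \<alpha> rule: less_induct)
  case (less \<alpha>)
  then show ?case
    using assms unfolding is_limit_def by (metis less_osuc)
qed

lemma omega1_add_ge: "\<alpha> \<le> \<alpha> + (\<beta>::omega1)"
  using omega1_add_le_iff by blast

text \<open>Ordinal subtraction: if \<mu> is not below \<beta>, the least \<alpha>' with \<mu> \<le>
  \<beta> + \<alpha>' gives equality, since all smaller summands stay below \<mu>.\<close>

lemma omega1_add_less_cases:
  assumes "\<mu> < \<beta> + (\<alpha>::omega1)"
  shows "\<mu> < \<beta> \<or> (\<exists>\<alpha>'<\<alpha>. \<mu> = \<beta> + \<alpha>')"
proof (cases "\<mu> < \<beta>")
  case False
  define \<alpha>' where "\<alpha>' = (LEAST \<alpha>'. \<mu> \<le> \<beta> + \<alpha>')"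
  have "\<mu> \<le> \<beta> + \<alpha>"
    using assms by simp
  then have ge: "\<mu> \<le> \<beta> + \<alpha>'"
    unfolding \<alpha>'_def by (rule LeastI)
  have "\<beta> + \<alpha>' \<le> \<mu>"
    unfolding omega1_add_le_iff
    using False not_less_Least[of _ "\<lambda>\<alpha>'. \<mu> \<le> \<beta> + \<alpha>'"] by (auto simp: \<alpha>'_def not_le not_less)
  with ge have eq: "\<mu> = \<beta> + \<alpha>'"
    by simp
  then have "\<alpha>' < \<alpha>"
    using assms omega1_add_less by (metis less_imp_neq not_less_iff_gr_or_eq order_less_trans)
  with eq show ?thesis
    by blast
qed auto

lemma omega1_add_zero_left: "0 + \<alpha> = (\<alpha>::omega1)"
proof (induction \<alpha> rule: less_induct)
  case (less \<alpha>)
  have "0 + \<alpha> \<le> \<delta> \<longleftrightarrow> \<alpha> \<le> \<delta>" for \<delta>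
    unfolding omega1_add_le_iff using less by (auto simp: not_less_iff_gr_or_eq leI) (meson leI less_irrefl)
  then show ?case
    by (blast intro: antisym)
qed

text \<open>An ordinal is determined by its upper bounds, and \<open>omega1_add_le_iff\<close>
  describes those of a sum. The ordinals below \<beta> + \<gamma> are split into those below \<beta>
  and those of the form \<beta> + \<gamma>'.\<close>

lemma omega1_add_assoc: "(\<alpha> + \<beta>) + \<gamma> = \<alpha> + (\<beta> + (\<gamma>::omega1))"
proof (induction \<gamma> rule: less_induct)
  case (less \<gamma>)
  have "(\<alpha> + \<beta>) + \<gamma> \<le> \<delta> \<longleftrightarrow> \<alpha> + (\<beta> + \<gamma>) \<le> \<delta>" for \<delta>
  proof
    assume L: "(\<alpha> + \<beta>) + \<gamma> \<le> \<delta>"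
    have "\<alpha> + \<mu> < \<delta>" if "\<mu> < \<beta> + \<gamma>" for \<mu>
      using omega1_add_less_cases[OF that]
    proof
      assume "\<mu> < \<beta>"
      then show ?thesis
        using order_less_le_trans[OF omega1_add_less order_trans[OF omega1_add_ge L]] by blast
    next
      assume "\<exists>\<gamma>'<\<gamma>. \<mu> = \<beta> + \<gamma>'"
      then show ?thesis
        using L less omega1_add_less[of _ \<gamma> "\<alpha> + \<beta>"] by force
    qed
    then show "\<alpha> + (\<beta> + \<gamma>) \<le> \<delta>"
      using L omega1_add_ge[of "\<alpha> + \<beta>" \<gamma>] omega1_add_ge[of \<alpha> \<beta>]
      by (subst omega1_add_le_iff) (auto intro: order_trans)
  next
    assume R: "\<alpha> + (\<beta> + \<gamma>) \<le> \<delta>"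
    have "\<alpha> + \<beta> \<le> \<alpha> + (\<beta> + \<gamma>)"
      using omega1_add_ge[of \<beta> \<gamma>] omega1_add_less[of \<beta> "\<beta> + \<gamma>" \<alpha>] by (auto simp: order_le_less)
    moreover have "\<alpha> + \<beta> + \<gamma>' < \<delta>" if "\<gamma>' < \<gamma>" for \<gamma>'
      using less[OF that] R omega1_add_less[OF omega1_add_less[OF that]] by (metis order_less_le_trans)
    ultimately show "(\<alpha> + \<beta>) + \<gamma> \<le> \<delta>"
      using R by (subst omega1_add_le_iff) auto
  qed
  then show ?case
    by (blast intro: antisym)
qed

text \<open>A predecessor of \<beta> + \<alpha> would lie below \<beta> or have the form \<beta> +
  \<alpha>', and either case leaves room for its successor below \<beta> + \<alpha>. This gives
  access to the class of \<beta> + \<alpha> through its own ladder.\<close>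

lemma is_limit_add:
  assumes "is_limit \<alpha>"
  shows "is_limit (\<beta> + \<alpha>)"
proof -
  have pos: "0 < \<alpha>"
    using assms zero_le_omega1[of \<alpha>] by (metis is_limit_def order_le_less)
  then have gt: "\<beta> < \<beta> + \<alpha>"
    using omega1_add_less[of 0 \<alpha> \<beta>] by (simp add: omega1_add_0)
  have False if "\<beta> + \<alpha> = osuc \<nu>" for \<nu>
  proof -
    have "\<nu> < \<beta> + \<alpha>"
      by (simp add: that less_osuc)
    then consider "\<nu> < \<beta>" | \<alpha>' where "\<alpha>' < \<alpha>" "\<nu> = \<beta> + \<alpha>'"
      using omega1_add_less_cases by blast
    then show False
    proof cases
      case 1
      then show False
        using gt that by (simp add: less_osuc_iff)
    next
      case 2
      then show False
        using omega1_add_less[OF is_limit_osuc_less[OF assms 2(1)], of \<beta>] that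
        by (simp add: omega1_add_osuc)
    qed
  qed
  then show ?thesis
    using gt by (metis is_limit_def leD zero_le_omega1)
qed

lemma omul_add: "\<alpha> \<odot> (j + k) = \<alpha> \<odot> j + \<alpha> \<odot> k"
  by (induction k) (simp_all add: omega1_add_0 omega1_add_assoc)

lemma omul_mult: "(\<alpha> \<odot> n) \<odot> k = \<alpha> \<odot> (n * k)"
proof (induction k)
  case (Suc k)
  have "\<alpha> \<odot> (n * Suc k) = \<alpha> \<odot> (n * k + n)"
    by (simp add: add.commute)
  then show ?case
    by (simp add: Suc omul_add del: mult_Suc_right)
qed simp

section \<open>Sums of Schreier classes\<close>

text \<open>Hereditary and spreading; \<open>h = id\<close> gives closure under subsets.\<close>

definition hspread :: "nat set set \<Rightarrow> bool" where
  "hspread \<F> \<longleftrightarrow> (\<forall>F\<in>\<F>. finite F \<and> F \<subseteq> {1..} \<and>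
     (\<forall>G h. strict_mono_on G h \<and> h ` G \<subseteq> F \<and> (\<forall>g\<in>G. h g \<le> g) \<longrightarrow> G \<in> \<F>))"

section \<open>Spreading families and their convolution\<close>

lemma hspreadD:
  assumes "hspread \<F>" "F \<in> \<F>"
  shows "finite F" "F \<subseteq> {1..}"
    "strict_mono_on G h \<Longrightarrow> h ` G \<subseteq> F \<Longrightarrow> (\<And>g. g \<in> G \<Longrightarrow> h g \<le> g) \<Longrightarrow> G \<in> \<F>"
proof -
  show "finite F" "F \<subseteq> {1..}"
    using assms by (simp_all add: hspread_def)
  show "G \<in> \<F>" if "strict_mono_on G h" "h ` G \<subseteq> F" "\<And>g. g \<in> G \<Longrightarrow> h g \<le> g"
    using assms(1)[unfolded hspread_def, rule_format, OF assms(2)] that by blast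
qed

lemma hspread_subset: "hspread \<F> \<Longrightarrow> F \<in> \<F> \<Longrightarrow> G \<subseteq> F \<Longrightarrow> G \<in> \<F>"
  by (rule hspreadD(3)[of \<F> F G "\<lambda>g. g"]) (auto simp: strict_mono_on_def)

text \<open>Stated elementwise instead of by \<open>Max\<close> and \<open>Min\<close>, so that
  empty and infinite members are allowed and the property passes to subfamilies and subsets.\<close>

definition succ_sets :: "nat set \<Rightarrow> (nat \<Rightarrow> nat set) \<Rightarrow> bool" where
  "succ_sets D G \<longleftrightarrow> (\<forall>d\<in>D. \<forall>d'\<in>D. d < d' \<longrightarrow> (\<forall>i\<in>G d. \<forall>j\<in>G d'. i < j))"

lemma succ_setsD: "succ_sets D G \<Longrightarrow> d \<in> D \<Longrightarrow> d' \<in> D \<Longrightarrow> d < d' \<Longrightarrow> i \<in> G d \<Longrightarrow> j \<in> G d' \<Longrightarrow> i < j"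
  unfolding succ_sets_def by blast

lemma succ_setsI:
  "(\<And>d d' i j. d \<in> D \<Longrightarrow> d' \<in> D \<Longrightarrow> d < d' \<Longrightarrow> i \<in> G d \<Longrightarrow> j \<in> G d' \<Longrightarrow> i < j) \<Longrightarrow> succ_sets D G"
  unfolding succ_sets_def by blast

lemma succ_sets_subset: "succ_sets D G \<Longrightarrow> E \<subseteq> D \<Longrightarrow> (\<And>d. d \<in> E \<Longrightarrow> H d \<subseteq> G d) \<Longrightarrow> succ_sets E H"
  unfolding succ_sets_def by blast

lemma succ_sets_vimage:
  fixes h :: "nat \<Rightarrow> nat"
  assumes "succ_sets B H" "strict_mono_on X h"
  shows "succ_sets B (\<lambda>c. {x\<in>X. h x \<in> H c})"
proof (rule succ_setsI)
  fix c c' i j assume "c \<in> B" "c' \<in> B" "c < c'" "i \<in> {x\<in>X. h x \<in> H c}" "j \<in> {x\<in>X. h x \<in> H c'}"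
  then show "i < j"
    using succ_setsD[OF assms(1), of c c' "h i" "h j"] strict_mono_on_less[OF assms(2), of i j] by simp
qed

lemma succ_sets_mono:
  "succ_sets D G \<Longrightarrow> i \<in> G d \<Longrightarrow> j \<in> G d' \<Longrightarrow> d \<in> D \<Longrightarrow> d' \<in> D \<Longrightarrow> i \<le> j \<Longrightarrow> d \<le> d'"
  by (meson leD linorder_le_less_linear succ_setsD)

lemma ex_enumeration:
  fixes F :: "nat set"
  assumes "finite F"
  obtains h where "bij_betw h {1..card F} F" "strict_mono_on {1..card F} h"
proof -
  obtain g where g: "bij_betw g {..<card F} F" "strict_mono_on {..<card F} g"
    using ex_bij_betw_strict_mono_card[OF assms] .
  have "bij_betw (\<lambda>i. i - 1) {1..card F} {..<card F}"
    by (rule bij_betwI[where g = Suc]) auto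
  from bij_betw_trans[OF this g(1)] have "bij_betw (\<lambda>i. g (i - 1)) {1..card F} F"
    by (simp add: comp_def)
  moreover have "strict_mono_on {1..card F} (\<lambda>i. g (i - 1))"
    by (intro strict_mono_onI strict_mono_onD[OF g(2)]) auto
  ultimately show ?thesis
    using that by blast
qed

lemma strict_mono_on_the_inv_into:
  fixes m :: "nat \<Rightarrow> nat"
  assumes m: "strict_mono_on E m"
  shows "strict_mono_on (m ` E) (the_inv_into E m)"
proof (rule strict_mono_onI)
  have inj: "inj_on m E"
    by (rule strict_mono_on_imp_inj_on[OF m])
  fix a b assume "a \<in> m ` E" "b \<in> m ` E" "a < b"
  then obtain i j where "i \<in> E" "j \<in> E" "a = m i" "b = m j" "m i < m j"
    by blast
  then show "the_inv_into E m a < the_inv_into E m b"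
    by (simp add: the_inv_into_f_f[OF inj] strict_mono_on_less[OF m])
qed

text \<open>Renumbering the pieces by their minima turns the index set itself into the member of
  \<open>\<F>\<close>, so that no enumeration has to be carried along.\<close>

lemma set_conv_elim:
  assumes X: "X \<in> set_conv \<F> \<G>" and hs: "hspread \<G>"
  obtains D G where "D \<in> \<F>" "succ_sets D G" "X = (\<Union>d\<in>D. G d)"
    "\<And>d. d \<in> D \<Longrightarrow> G d \<in> \<G>" "\<And>d. d \<in> D \<Longrightarrow> d \<in> G d" "\<And>d i. d \<in> D \<Longrightarrow> i \<in> G d \<Longrightarrow> d \<le> i"
proof -
  note fin = hspreadD(1)[OF hs]
  from X obtain n :: nat and G where X: "X = (\<Union>i\<in>{1..n}. G i)"
    and G: "\<And>i. i \<in> {1..n} \<Longrightarrow> G i \<in> \<G>" "\<And>i. i \<in> {1..n} \<Longrightarrow> G i \<noteq> {}"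
    and less: "\<forall>i\<in>{1..n}. \<forall>j\<in>{1..n}. i < j \<longrightarrow> set_less (G i) (G j)"
    and D: "(\<lambda>i. Min (G i)) ` {1..n} \<in> \<F>"
    unfolding set_conv_def by blast
  let ?m = "\<lambda>i. Min (G i)"
  have lt: "a < b" if "i \<in> {1..n}" "j \<in> {1..n}" "i < j" "a \<in> G i" "b \<in> G j" for i j a b
  proof -
    have "Max (G i) < Min (G j)"
      using less that G unfolding set_less_def by blast
    then show ?thesis
      using Max_ge[OF fin[OF G(1)[OF that(1)]] that(4)] Min_le[OF fin[OF G(1)[OF that(2)]] that(5)] by linarith
  qed
  have Min_in: "Min (G i) \<in> G i" if "i \<in> {1..n}" for i
    using that G fin by simp
  have mono: "?m i < ?m j" if "i \<in> {1..n}" "j \<in> {1..n}" "i < j" for i j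
    using lt Min_in that by blast
  have smono: "strict_mono_on {1..n} ?m"
    by (intro strict_mono_onI mono)
  note inj = strict_mono_on_imp_inj_on[OF smono]
  define k where "k = the_inv_into {1..n} ?m"
  have k: "k (?m i) = i" if "i \<in> {1..n}" for i
    unfolding k_def by (rule the_inv_into_f_f[OF inj that])
  show thesis
  proof (rule that[of "?m ` {1..n}" "\<lambda>d. G (k d)"])
    show "?m ` {1..n} \<in> \<F>" by fact
    show "succ_sets (?m ` {1..n}) (\<lambda>d. G (k d))"
      unfolding succ_sets_def
    proof (intro ballI impI)
      fix d d' a b assume "d \<in> ?m ` {1..n}" "d' \<in> ?m ` {1..n}" and ab: "d < d'" "a \<in> G (k d)" "b \<in> G (k d')"
      then obtain i j where ij: "i \<in> {1..n}" "j \<in> {1..n}" "d = ?m i" "d' = ?m j"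
        by blast
      then have "i < j"
        using ab(1) strict_mono_on_less[OF smono] by blast
      then show "a < b"
        using lt[OF ij(1,2)] ab k ij by simp
    qed
    show "X = (\<Union>d\<in>?m ` {1..n}. G (k d))"
      unfolding X using k by auto
    show "\<And>d. d \<in> ?m ` {1..n} \<Longrightarrow> G (k d) \<in> \<G>" "\<And>d. d \<in> ?m ` {1..n} \<Longrightarrow> d \<in> G (k d)"
      using k G Min_in by auto
    show "\<And>d i. d \<in> ?m ` {1..n} \<Longrightarrow> i \<in> G (k d) \<Longrightarrow> d \<le> i"
      using k G fin by (auto simp del: atLeastAtMost_iff)
  qed
qed

text \<open>The minima of the nonempty pieces lie at or to the right of their indices, so the
  spreading property of \<open>\<F>\<close> absorbs the difference between indices and minima. Hence
  pieces may be empty and an index may be a mere lower bound of its piece.\<close>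

lemma set_conv_intro:
  assumes hs: "hspread \<F>" and hs': "hspread \<G>" and D: "D \<in> \<F>"
    and G: "\<And>d. d \<in> D \<Longrightarrow> G d \<in> \<G>" "\<And>d i. d \<in> D \<Longrightarrow> i \<in> G d \<Longrightarrow> d \<le> i"
    and succ: "succ_sets D G"
  shows "(\<Union>d\<in>D. G d) \<in> set_conv \<F> \<G>"
proof -
  note fin = hspreadD(1)[OF hs']
  define E where "E = {d\<in>D. G d \<noteq> {}}"
  have finE: "finite E"
    unfolding E_def using hspreadD(1)[OF hs D] by simp
  obtain h where h: "bij_betw h {1..card E} E" "strict_mono_on {1..card E} h"
    using ex_enumeration[OF finE] .
  have hE: "h i \<in> E" if "i \<in> {1..card E}" for i
    using bij_betwE[OF h(1)] that by blast
  have fG: "finite (G d)" if "d \<in> E" for d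
    using that fin G(1) by (auto simp: E_def)
  let ?m = "\<lambda>d. Min (G d)"
  have min: "?m d \<in> G d" if "d \<in> E" for d
    using that fG by (auto simp: E_def intro: Min_in)
  have mono: "?m d < ?m d'" if "d \<in> E" "d' \<in> E" "d < d'" for d d'
    using succ_setsD[OF succ _ _ that(3) min[OF that(1)] min[OF that(2)]] that by (auto simp: E_def)
  have smono: "strict_mono_on E ?m"
    by (intro strict_mono_onI mono)
  note inj = strict_mono_on_imp_inj_on[OF smono]
  define k where "k = the_inv_into E ?m"
  have k: "k (?m d) = d" if "d \<in> E" for d
    unfolding k_def by (rule the_inv_into_f_f[OF inj that])
  have ED: "E \<subseteq> D"
    by (auto simp: E_def)
  have M: "?m ` E \<in> \<F>"
  proof (rule hspreadD(3)[OF hs D, of _ k])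
    show "strict_mono_on (?m ` E) k"
      unfolding k_def by (rule strict_mono_on_the_inv_into[OF smono])
    show "k ` ?m ` E \<subseteq> D"
      using k ED by auto
    show "\<And>g. g \<in> ?m ` E \<Longrightarrow> k g \<le> g"
      using k min G(2) ED by auto
  qed
  have him: "h ` {1..card E} = E"
    using h(1) by (simp add: bij_betw_def)
  have "(\<Union>d\<in>D. G d) = (\<Union>d\<in>E. G d)"
    by (auto simp: E_def)
  also have "\<dots> = (\<Union>d\<in>h ` {1..card E}. G d)"
    by (simp only: him)
  also have "\<dots> = (\<Union>i\<in>{1..card E}. G (h i))"
    by (simp only: image_image)
  moreover have "\<forall>i\<in>{1..card E}. G (h i) \<in> \<G> \<and> G (h i) \<noteq> {}"
    using hE G(1) by (auto simp: E_def)
  moreover have "set_less (G (h i)) (G (h j))" if "i \<in> {1..card E}" "j \<in> {1..card E}" "i < j" for i j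
  proof -
    have "h i < h j"
      using h(2) that by (auto simp: strict_mono_on_def)
    then show ?thesis
      unfolding set_less_def using succ_setsD[OF succ, of "h i" "h j"] hE[OF that(1)] hE[OF that(2)] fG
      by (auto simp: E_def)
  qed
  moreover have "(\<lambda>i. Min (G (h i))) ` {1..card E} \<in> \<F>"
    using M him by (metis (mono_tags, lifting) image_cong image_image)
  ultimately show ?thesis
    unfolding set_conv_def mem_Collect_eq
    by (intro exI[of _ "card E"] exI[of _ "\<lambda>i. G (h i)"]) auto
qed

lemma hspread_schreier_0: "hspread schreier_0"
proof -
  have "G \<in> schreier_0" if F: "F \<in> schreier_0" and h: "strict_mono_on G h" "h ` G \<subseteq> F" "\<forall>g\<in>G. h g \<le> g" for F G h
  proof (cases "G = {}")
    case False
    then obtain g where g: "g \<in> G" by blast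
    from F h(2) g obtain n where n: "F = {n}" "n \<ge> 1"
      by (auto simp: schreier_0_def)
    have "g' = g" if "g' \<in> G" for g'
    proof -
      have "h g' = n" "h g = n"
        using h(2) n(1) g that by auto
      then show ?thesis
        using inj_onD[OF strict_mono_on_imp_inj_on[OF h(1)]] g that by metis
    qed
    then have "G = {g}"
      using g by blast
    moreover have "g \<ge> 1"
      using h n g by force
    ultimately show ?thesis
      by (auto simp: schreier_0_def)
  qed (auto simp: schreier_0_def)
  then show ?thesis
    unfolding hspread_def by (auto simp: schreier_0_def)
qed

lemma hspread_schreier_1: "hspread schreier_1"
proof -
  have "G \<in> schreier_1" if F: "F \<in> schreier_1" and h: "strict_mono_on G h" "h ` G \<subseteq> F" "\<forall>g\<in>G. h g \<le> g" for F G h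
  proof (cases "G = {}")
    case False
    have inj: "inj_on h G"
      using h(1) by (rule strict_mono_on_imp_inj_on)
    have fF: "finite F" "F \<noteq> {}" "card F \<le> Min F" "F \<subseteq> {1..}"
      using F h(2) False by (auto simp: schreier_1_def)
    have fG: "finite G"
      using finite_imageD[OF finite_subset[OF h(2) fF(1)] inj] .
    have "card G \<le> card F"
      using card_inj_on_le[OF inj h(2) fF(1)] .
    moreover have G0: "Min G \<in> G"
      using fG False by simp
    then have "Min F \<le> h (Min G)"
      using h(2) fF by (intro Min_le) auto
    moreover have "h (Min G) \<le> Min G"
      using h(3) G0 by blast
    moreover have "g \<ge> 1" if "g \<in> G" for g
    proof -
      have "h g \<ge> 1"
        using h(2) fF(4) that by fastforce
      moreover have "h g \<le> g"
        using h(3) that by blast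
      ultimately show ?thesis by simp
    qed
    ultimately show ?thesis
      using fG False fF(3) by (auto simp: schreier_1_def)
  qed (auto simp: schreier_1_def)
  then show ?thesis
    unfolding hspread_def by (auto simp: schreier_1_def)
qed

text \<open>A set that h moves to the left into X is cut into the preimages of the pieces of X. The
  old indices still serve, because d \<le> h y \<le> y for y in the preimage of the piece of
  d.\<close>

lemma hspread_set_conv:
  assumes F: "hspread \<F>" and G: "hspread \<G>"
  shows "hspread (set_conv \<F> \<G>)"
proof -
  have fin: "\<And>G. G \<in> \<G> \<Longrightarrow> finite G"
    using hspreadD(1)[OF G] .
  show ?thesis
    unfolding hspread_def
  proof (intro ballI conjI allI impI)
    fix X assume X: "X \<in> set_conv \<F> \<G>"
    obtain D H where D: "D \<in> \<F>" "succ_sets D H" "X = (\<Union>d\<in>D. H d)"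
      "\<And>d. d \<in> D \<Longrightarrow> H d \<in> \<G>" "\<And>d. d \<in> D \<Longrightarrow> d \<in> H d" "\<And>d i. d \<in> D \<Longrightarrow> i \<in> H d \<Longrightarrow> d \<le> i"
      using set_conv_elim[OF X G] by blast
    show "finite X"
      unfolding D(3) using hspreadD(1)[OF F D(1)] fin D(4) by blast
    show "X \<subseteq> {1..}"
      unfolding D(3) using hspreadD(2)[OF G] D(4) by blast
    fix Y h assume "strict_mono_on Y h \<and> h ` Y \<subseteq> X \<and> (\<forall>g\<in>Y. h g \<le> g)"
    then have h: "strict_mono_on Y h" "h ` Y \<subseteq> X" "\<And>g. g \<in> Y \<Longrightarrow> h g \<le> g"
      by auto
    have "(\<Union>d\<in>D. {y\<in>Y. h y \<in> H d}) \<in> set_conv \<F> \<G>"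
    proof (rule set_conv_intro[OF F G D(1)])
      show "{y\<in>Y. h y \<in> H d} \<in> \<G>" if "d \<in> D" for d
        by (rule hspreadD(3)[OF G D(4)[OF that], of _ h]) (use h in \<open>auto simp: strict_mono_on_def\<close>)
      show "d \<le> i" if "d \<in> D" "i \<in> {y\<in>Y. h y \<in> H d}" for d i
        using that h(3)[of i] D(6)[of d "h i"] by auto
      show "succ_sets D (\<lambda>d. {y\<in>Y. h y \<in> H d})"
        by (rule succ_sets_vimage[OF D(2) h(1)])
    qed
    moreover have "(\<Union>d\<in>D. {y\<in>Y. h y \<in> H d}) = Y"
      using h(2) D(3) by auto
    ultimately show "Y \<in> set_conv \<F> \<G>"
      by simp
  qed
qed

lemma ladder_less: "ladder_system A \<Longrightarrow> is_limit \<alpha> \<Longrightarrow> n \<ge> 1 \<Longrightarrow> A \<alpha> n < \<alpha>"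
  unfolding ladder_system_def by meson

lemma ladder_cofinal: "ladder_system A \<Longrightarrow> is_limit \<alpha> \<Longrightarrow> \<beta> < \<alpha> \<Longrightarrow> \<exists>n\<ge>1. \<beta> < A \<alpha> n"
  unfolding ladder_system_def by meson

lemma hspread_schreier:
  assumes "ladder_system A"
  shows "hspread (schreier A \<alpha>)"
proof (induction \<alpha> rule: omega1_induct)
  case zero
  then show ?case by (simp add: schreier_zero hspread_schreier_0)
next
  case (osuc \<beta>)
  then show ?case by (simp add: schreier_osuc hspread_set_conv hspread_schreier_1)
next
  case (limit \<alpha>)
  have hs: "hspread (schreier A (A \<alpha> n))" if "n \<ge> 1" for n
    by (rule limit(2)[OF ladder_less[OF assms limit(1) that]])
  have eq: "schreier A \<alpha> = {F. \<exists>n\<ge>1. F \<in> schreier A (A \<alpha> n) \<and> F \<subseteq> {n..}}"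
    by (rule schreier_limit[OF assms limit(1)])
  show ?case
    unfolding hspread_def eq
  proof (intro ballI, elim CollectE exE conjE, intro conjI allI impI)
    fix F n assume F: "n \<ge> (1::nat)" "F \<in> schreier A (A \<alpha> n)" "F \<subseteq> {n..}"
    show "finite F" "F \<subseteq> {1..}"
      using hspreadD[OF hs[OF F(1)] F(2)] by auto
    fix G h assume h: "strict_mono_on G h \<and> h ` G \<subseteq> F \<and> (\<forall>g\<in>G. h g \<le> g)"
    then have "G \<in> schreier A (A \<alpha> n)"
      using hspreadD(3)[OF hs[OF F(1)] F(2), of G h] by blast
    moreover have "G \<subseteq> {n..}"
      using h F(3) by fastforce
    ultimately show "G \<in> {F. \<exists>n\<ge>1. F \<in> schreier A (A \<alpha> n) \<and> F \<subseteq> {n..}}"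
      using F(1) by blast
  qed
qed

lemma finite_schreier: "ladder_system A \<Longrightarrow> F \<in> schreier A \<alpha> \<Longrightarrow> finite F"
  by (rule hspreadD(1)[OF hspread_schreier])

lemma empty_in_schreier: "ladder_system A \<Longrightarrow> {} \<in> schreier A \<alpha>"
  and singleton_in_schreier: "ladder_system A \<Longrightarrow> n \<ge> 1 \<Longrightarrow> {n} \<in> schreier A \<alpha>"
proof -
  assume A: "ladder_system A"
  have single: "{n} \<in> schreier A \<alpha>" if "n \<ge> 1" for n
    using that
  proof (induction \<alpha> rule: omega1_induct)
    case zero
    then show ?case by (auto simp: schreier_zero schreier_0_def)
  next
    case (osuc \<beta>)
    have "(\<Union>d\<in>{n}. {n}) \<in> set_conv schreier_1 (schreier A \<beta>)"
      by (rule set_conv_intro[OF hspread_schreier_1 hspread_schreier[OF A]])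
        (use osuc in \<open>auto simp: schreier_1_def succ_sets_def\<close>)
    then show ?case by (simp add: schreier_osuc)
  next
    case (limit \<alpha>)
    then show ?case
      using A by (auto simp: schreier_limit ladder_system_def intro!: exI[of _ 1])
  qed
  then show "{n} \<in> schreier A \<alpha>" if "n \<ge> 1" 
    using that .
  show "{} \<in> schreier A \<alpha>"
    using hspread_subset[OF hspread_schreier[OF A] single[of 1]] by simp
qed

section \<open>Comparison of Schreier classes up to thinning out\<close>

lemma set_conv_single:
  assumes "hspread \<F>" "\<And>n. n \<ge> 1 \<Longrightarrow> {n} \<in> \<F>" "hspread \<G>" "X \<in> \<G>"
  shows "X \<in> set_conv \<F> \<G>"
proof -
  \<comment> \<open>The empty set needs some legitimate index as well; 1 is as good as any.\<close>
  define n where "n = (if X = {} then 1 else Min X)"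
  have fin: "finite X" and pos: "X \<subseteq> {1..}"
    using hspreadD[OF assms(3,4)] by auto
  have n: "n \<ge> 1" "\<And>i. i \<in> X \<Longrightarrow> n \<le> i"
    unfolding n_def using fin pos by (auto simp: subset_iff dest: Min_in)
  have "(\<Union>d\<in>{n}. X) \<in> set_conv \<F> \<G>"
    by (rule set_conv_intro[OF assms(1) assms(3)])
      (use assms n in \<open>auto simp: succ_sets_def\<close>)
  then show ?thesis by simp
qed

text \<open>Successors lose nothing, whereas at a limit the class of the m-th ladder term is
  included only for sets that start at m or later; this is where the starting point comes
  from.\<close>

lemma schreier_eventually_subset:
  assumes A: "ladder_system A" and "\<alpha> < \<beta>"
  shows "\<exists>n. \<forall>F\<in>schreier A \<alpha>. F \<subseteq> {n..} \<longrightarrow> F \<in> schreier A \<beta>"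
  using assms(2)
proof (induction \<beta> rule: omega1_induct)
  case zero
  then show ?case by (simp add: leD)
next
  case (osuc \<beta>)
  have sub: "F \<in> schreier A (osuc \<beta>)" if "F \<in> schreier A \<beta>" for F
    unfolding schreier_osuc
    by (rule set_conv_single[OF hspread_schreier_1 _ hspread_schreier[OF A] that])
      (auto simp: schreier_1_def)
  show ?case
  proof (cases "\<alpha> = \<beta>")
    case True
    then show ?thesis
      using sub by blast
  next
    case False
    with osuc(2) have "\<alpha> < \<beta>"
      by (simp add: less_osuc_iff order_le_less)
    then show ?thesis
      using osuc(1) sub by blast
  qed
next
  case (limit \<beta>)
  then obtain m where m: "m \<ge> 1" "\<alpha> < A \<beta> m" "A \<beta> m < \<beta>"
    using ladder_cofinal[OF A limit(1,3)] ladder_less[OF A limit(1)] by blast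
  then obtain n where n: "\<forall>F\<in>schreier A \<alpha>. F \<subseteq> {n..} \<longrightarrow> F \<in> schreier A (A \<beta> m)"
    using limit by blast
  show ?case
    by (intro exI[of _ "max n m"]) (use n m in \<open>fastforce simp: schreier_limit[OF A limit(1)]\<close>)
qed

text \<open>
  The classes \<open>\<S>\<^bsub>\<beta>+\<alpha>\<^esub>\<close> and \<open>\<S>\<^sub>\<alpha>[\<S>\<^sub>\<beta>]\<close> agree only after thinning out by a fast growing \<open>N\<close>, as the
  ladders chosen below \<open>\<alpha>\<close> and \<open>\<beta> + \<alpha>\<close> are unrelated.
\<close>

lemma schreier_add_superset:
  assumes A: "ladder_system A"
  shows "\<exists>N. \<forall>D G. D \<in> schreier A \<alpha> \<longrightarrow> (\<forall>d\<in>D. G d \<in> schreier A \<beta> \<and> (\<forall>i\<in>G d. N d \<le> i)) \<longrightarrow>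
     succ_sets D G \<longrightarrow> (\<Union>d\<in>D. G d) \<in> schreier A (\<beta> + \<alpha>)"
proof (induction \<alpha> rule: omega1_induct)
  case zero
  show ?case
    by (intro exI[of _ id]) (auto simp: schreier_zero schreier_0_def omega1_add_0 empty_in_schreier[OF A])
next
  case (osuc \<alpha>)
  then obtain N where N: "\<And>D G. D \<in> schreier A \<alpha> \<Longrightarrow> (\<And>d. d\<in>D \<Longrightarrow> G d \<in> schreier A \<beta> \<and> (\<forall>i\<in>G d. N d \<le> i)) \<Longrightarrow>
     succ_sets D G \<Longrightarrow> (\<Union>d\<in>D. G d) \<in> schreier A (\<beta> + \<alpha>)"
    by metis
  show ?case
  \<comment> \<open>The second entry of the maximum keeps a group to the right of the index of its
    outer piece: c \<le> d \<le> i.\<close>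
  proof (intro exI[of _ "\<lambda>d. max (N d) d"] allI impI)
    fix D G assume D: "D \<in> schreier A (osuc \<alpha>)"
      and G: "\<forall>d\<in>D. G d \<in> schreier A \<beta> \<and> (\<forall>i\<in>G d. max (N d) d \<le> i)" and succ: "succ_sets D G"
    obtain B H where B: "B \<in> schreier_1" "succ_sets B H" "D = (\<Union>d\<in>B. H d)"
      "\<And>d. d \<in> B \<Longrightarrow> H d \<in> schreier A \<alpha>" "\<And>d. d \<in> B \<Longrightarrow> d \<in> H d" "\<And>d i. d \<in> B \<Longrightarrow> i \<in> H d \<Longrightarrow> d \<le> i"
      using set_conv_elim[OF D[unfolded schreier_osuc] hspread_schreier[OF A]] by blast
    have "(\<Union>c\<in>B. \<Union>d\<in>H c. G d) \<in> set_conv schreier_1 (schreier A (\<beta> + \<alpha>))"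
    proof (rule set_conv_intro[OF hspread_schreier_1 hspread_schreier[OF A] B(1)])
      show "(\<Union>d\<in>H c. G d) \<in> schreier A (\<beta> + \<alpha>)" if "c \<in> B" for c
      proof (rule N[OF B(4)[OF that]])
        have sub: "H c \<subseteq> D"
          using B(3) that by blast
        then show "G d \<in> schreier A \<beta> \<and> (\<forall>i\<in>G d. N d \<le> i)" if "d \<in> H c" for d
          using G that by fastforce
        show "succ_sets (H c) G"
          by (rule succ_sets_subset[OF succ sub]) simp
      qed
      show "c \<le> i" if "c \<in> B" "i \<in> (\<Union>d\<in>H c. G d)" for c i
        using that B(3,6) G by fastforce
      show "succ_sets B (\<lambda>c. \<Union>d\<in>H c. G d)"
      proof (rule succ_setsI)
        fix c c' i j assume c: "c \<in> B" "c' \<in> B" "c < c'" "i \<in> (\<Union>d\<in>H c. G d)" "j \<in> (\<Union>d\<in>H c'. G d)"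
        then obtain d d' where d: "d \<in> H c" "d' \<in> H c'" "i \<in> G d" "j \<in> G d'"
          by blast
        then have "d \<in> D" "d' \<in> D" "d < d'"
          using succ_setsD[OF B(2) c(1,2,3)] B(3) c by blast+
        then show "i < j"
          using succ_setsD[OF succ] d by blast
      qed
    qed
    then show "(\<Union>d\<in>D. G d) \<in> schreier A (\<beta> + osuc \<alpha>)"
      by (simp add: omega1_add_osuc schreier_osuc B(3))
  qed
next
  case (limit \<alpha>)
  have lt: "A \<alpha> n < \<alpha>" if "n \<ge> 1" for n
    by (rule ladder_less[OF A limit(1) that])
  obtain N where N: "\<And>n D G. n \<ge> 1 \<Longrightarrow> D \<in> schreier A (A \<alpha> n) \<Longrightarrow> (\<And>d. d\<in>D \<Longrightarrow> G d \<in> schreier A \<beta> \<and> (\<forall>i\<in>G d. N n d \<le> i)) \<Longrightarrow>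
     succ_sets D G \<Longrightarrow> (\<Union>d\<in>D. G d) \<in> schreier A (\<beta> + A \<alpha> n)"
    using limit(2)[OF lt] by metis
  obtain m where m: "\<And>n F. n \<ge> 1 \<Longrightarrow> F \<in> schreier A (\<beta> + A \<alpha> n) \<Longrightarrow> F \<subseteq> {m n..} \<Longrightarrow> F \<in> schreier A (\<beta> + \<alpha>)"
    using schreier_eventually_subset[OF A omega1_add_less[OF lt], of _ \<beta>] by metis
  \<comment> \<open>The ladder index n is known only once D is given, but D then starts at n or
    later. So at d it is enough to dominate the bounds for all n \<le> d, of which there are
    finitely many.\<close>
  define M where "M d = (\<Sum>n\<le>d. N n d + m n)" for d
  have M: "N n d \<le> M d" "m n \<le> M d" if "n \<le> d" for n d
    using member_le_sum[of n "{..d}" "\<lambda>n. N n d + m n"] that by (auto simp: M_def)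
  show ?case
  proof (intro exI[of _ M] allI impI)
    fix D G assume D: "D \<in> schreier A \<alpha>"
      and G: "\<forall>d\<in>D. G d \<in> schreier A \<beta> \<and> (\<forall>i\<in>G d. M d \<le> i)" and succ: "succ_sets D G"
    then obtain n where n: "n \<ge> 1" "D \<in> schreier A (A \<alpha> n)" "D \<subseteq> {n..}"
      by (auto simp: schreier_limit[OF A limit(1)])
    have "N n d \<le> i \<and> m n \<le> i" if "d \<in> D" "i \<in> G d" for d i
      using G n(3) M[of n d] that by force
    then show "(\<Union>d\<in>D. G d) \<in> schreier A (\<beta> + \<alpha>)"
      by (intro m[OF n(1) N[OF n(1,2)]]) (use G succ in auto)
  qed
qed

text \<open>The indices of an inner splitting belong to the outer piece that is split, so they are
  successive from piece to piece. Together they form a member of \<open>set_conv \<F> \<G>\<close>,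
  and this member indexes the finest pieces.\<close>

lemma set_conv_assoc:
  assumes F: "hspread \<F>" and G: "hspread \<G>" and H: "hspread \<H>"
    and X: "X \<in> set_conv \<F> (set_conv \<G> \<H>)"
  shows "X \<in> set_conv (set_conv \<F> \<G>) \<H>"
proof -
  obtain D Y where D: "D \<in> \<F>" "succ_sets D Y" "X = (\<Union>d\<in>D. Y d)"
      "\<And>d. d \<in> D \<Longrightarrow> Y d \<in> set_conv \<G> \<H>" "\<And>d. d \<in> D \<Longrightarrow> d \<in> Y d" "\<And>d i. d \<in> D \<Longrightarrow> i \<in> Y d \<Longrightarrow> d \<le> i"
    using set_conv_elim[OF X hspread_set_conv[OF G H]] by blast
  define Q where "Q d C Z \<longleftrightarrow> C \<in> \<G> \<and> succ_sets C Z \<and> Y d = (\<Union>c\<in>C. Z c) \<and>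
    (\<forall>c\<in>C. Z c \<in> \<H> \<and> c \<in> Z c \<and> (\<forall>i\<in>Z c. c \<le> i))" for d C Z
  have "\<exists>C Z. Q d C Z" if d: "d \<in> D" for d
  proof -
    obtain C Z where "C \<in> \<G>" "succ_sets C Z" "Y d = (\<Union>c\<in>C. Z c)"
      "\<And>c. c \<in> C \<Longrightarrow> Z c \<in> \<H>" "\<And>c. c \<in> C \<Longrightarrow> c \<in> Z c" "\<And>c i. c \<in> C \<Longrightarrow> i \<in> Z c \<Longrightarrow> c \<le> i"
      using set_conv_elim[OF D(4)[OF d] H] by blast
    then show ?thesis
      unfolding Q_def by blast
  qed
  then obtain C Z where "\<And>d. d \<in> D \<Longrightarrow> Q d (C d) (Z d)"
    by metis
  then have C: "\<And>d. d \<in> D \<Longrightarrow> C d \<in> \<G>" "\<And>d. d \<in> D \<Longrightarrow> succ_sets (C d) (Z d)"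
      "\<And>d. d \<in> D \<Longrightarrow> Y d = (\<Union>c\<in>C d. Z d c)" "\<And>d c. d \<in> D \<Longrightarrow> c \<in> C d \<Longrightarrow> Z d c \<in> \<H>"
      "\<And>d c. d \<in> D \<Longrightarrow> c \<in> C d \<Longrightarrow> c \<in> Z d c" "\<And>d c i. d \<in> D \<Longrightarrow> c \<in> C d \<Longrightarrow> i \<in> Z d c \<Longrightarrow> c \<le> i"
    by (auto simp: Q_def)
  have CY: "C d \<subseteq> Y d" if "d \<in> D" for d
    using C(3,5) that by blast
  have CF: "(\<Union>d\<in>D. C d) \<in> set_conv \<F> \<G>"
  proof (rule set_conv_intro[OF F G D(1) C(1)])
    show "\<And>d i. d \<in> D \<Longrightarrow> i \<in> C d \<Longrightarrow> d \<le> i"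
      using CY D(6) by blast
    show "succ_sets D C"
      using D(2) CY unfolding succ_sets_def by blast
  qed auto
  have uniq: "d = d'" if "d \<in> D" "d' \<in> D" "i \<in> Y d" "i \<in> Y d'" for d d' i
    using succ_setsD[OF D(2)] that by (metis less_irrefl linorder_neqE_nat)
  \<comment> \<open>Outer pieces are disjoint, so each inner index c occurs for one d only and the
    union picks out \<open>Z d c\<close>.\<close>
  define W where "W c = (\<Union>d\<in>{d\<in>D. c \<in> C d}. Z d c)" for c
  have W: "W c = Z d c" if "d \<in> D" "c \<in> C d" for c d
  proof -
    have "{d\<in>D. c \<in> C d} = {d}"
      using uniq CY that by blast
    then show ?thesis by (simp add: W_def)
  qed
  have "(\<Union>c\<in>(\<Union>d\<in>D. C d). W c) \<in> set_conv (set_conv \<F> \<G>) \<H>"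
  proof (rule set_conv_intro[OF hspread_set_conv[OF F G] H CF])
    show "succ_sets (\<Union>d\<in>D. C d) W"
    proof (rule succ_setsI)
      fix c c' i j assume "c \<in> (\<Union>d\<in>D. C d)" "c' \<in> (\<Union>d\<in>D. C d)" and lt: "c < c'" and ij: "i \<in> W c" "j \<in> W c'"
      then obtain d d' where d: "d \<in> D" "d' \<in> D" "c \<in> C d" "c' \<in> C d'"
        by blast
      have i: "i \<in> Z d c" "j \<in> Z d' c'"
        using ij W d by auto
      have "d \<le> d'"
        using succ_sets_mono[OF D(2), of c d c' d'] CY d lt by auto
      moreover have "i < j" if "d < d'"
        using succ_setsD[OF D(2) d(1,2) that, of i j] i d C(3) by blast
      moreover have "i < j" if "d = d'"
        using succ_setsD[OF C(2)[OF d(1)], of c c'] i d lt that by blast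
      ultimately show "i < j"
        by (metis order_le_less)
    qed
  qed (use W C in auto)
  moreover have "(\<Union>c\<in>(\<Union>d\<in>D. C d). W c) = X"
    using W C(3) D(3) by auto
  ultimately show ?thesis by simp
qed

text \<open>Sparseness is expressed by a map h that pushes X to the left into F, each x lying beyond
  a bound that depends only on its image. In this form the hypothesis is inherited by the parts of X
  that arise in the induction.\<close>

lemma schreier_add_subset:
  assumes A: "ladder_system A"
  shows "\<exists>N. \<forall>F\<in>schreier A (\<beta> + \<alpha>). \<forall>X h. strict_mono_on X h \<longrightarrow> h ` X \<subseteq> F \<longrightarrow> (\<forall>x\<in>X. N (h x) \<le> x) \<longrightarrow>
     X \<in> set_conv (schreier A \<alpha>) (schreier A \<beta>)"
proof (induction \<alpha> rule: omega1_induct)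
  note hs = hspread_schreier[OF A]
  case zero
  show ?case
    using hspreadD(3)[OF hs]
    by (intro exI[of _ id])
      (auto simp: omega1_add_0 intro!: set_conv_single[OF hs singleton_in_schreier[OF A] hs])
next
  note hs = hspread_schreier[OF A]
  case (osuc \<alpha>)
  then obtain N where N: "\<And>F X h. F \<in> schreier A (\<beta> + \<alpha>) \<Longrightarrow> strict_mono_on X h \<Longrightarrow> h ` X \<subseteq> F \<Longrightarrow>
      (\<And>x. x \<in> X \<Longrightarrow> N (h x) \<le> x) \<Longrightarrow> X \<in> set_conv (schreier A \<alpha>) (schreier A \<beta>)"
    by metis
  show ?case
  proof (intro exI[of _ "\<lambda>d. max (N d) d"] ballI allI impI)
    fix F X h assume F: "F \<in> schreier A (\<beta> + osuc \<alpha>)" and h: "strict_mono_on X h" "h ` X \<subseteq> F"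
      "\<forall>x\<in>X. max (N (h x)) (h x) \<le> x"
    obtain B H where B: "B \<in> schreier_1" "succ_sets B H" "F = (\<Union>d\<in>B. H d)"
      "\<And>d. d \<in> B \<Longrightarrow> H d \<in> schreier A (\<beta> + \<alpha>)" "\<And>d. d \<in> B \<Longrightarrow> d \<in> H d" "\<And>d i. d \<in> B \<Longrightarrow> i \<in> H d \<Longrightarrow> d \<le> i"
      using set_conv_elim[OF F[unfolded omega1_add_osuc schreier_osuc] hspread_schreier[OF A]] by blast
    have "(\<Union>c\<in>B. {x\<in>X. h x \<in> H c}) \<in> set_conv schreier_1 (set_conv (schreier A \<alpha>) (schreier A \<beta>))"
    proof (rule set_conv_intro[OF hspread_schreier_1 hspread_set_conv[OF hs hs] B(1)])
      show "{x\<in>X. h x \<in> H c} \<in> set_conv (schreier A \<alpha>) (schreier A \<beta>)" if "c \<in> B" for c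
        by (rule N[OF B(4)[OF that], of _ h]) (use h in \<open>auto simp: strict_mono_on_def\<close>)
      show "c \<le> i" if "c \<in> B" "i \<in> {x\<in>X. h x \<in> H c}" for c i
        using that B(6)[of c "h i"] h(3) by force
      show "succ_sets B (\<lambda>c. {x\<in>X. h x \<in> H c})"
        by (rule succ_sets_vimage[OF B(2) h(1)])
    qed
    moreover have "(\<Union>c\<in>B. {x\<in>X. h x \<in> H c}) = X"
      using h(2) B(3) by auto
    ultimately show "X \<in> set_conv (schreier A (osuc \<alpha>)) (schreier A \<beta>)"
      using set_conv_assoc[OF hspread_schreier_1 hs hs] by (simp add: schreier_osuc)
  qed
next
  note hs = hspread_schreier[OF A]
  case (limit \<alpha>)
  \<comment> \<open>The ladder of \<beta> + \<alpha> is unrelated to that of \<alpha> and may even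
    start below \<beta>; so every \<mu> below \<beta> + \<alpha> is treated, whether or not it has
    the form \<beta> + \<alpha>'.\<close>
  have ex: "\<exists>N. \<forall>F\<in>schreier A \<mu>. \<forall>X h. strict_mono_on X h \<longrightarrow> h ` X \<subseteq> F \<longrightarrow> (\<forall>x\<in>X. N (h x) \<le> x) \<longrightarrow>
     X \<in> set_conv (schreier A \<alpha>) (schreier A \<beta>)" if \<mu>: "\<mu> < \<beta> + \<alpha>" for \<mu>
    using omega1_add_less_cases[OF \<mu>]
  proof
    assume "\<mu> < \<beta>"
    then obtain n where n: "\<forall>F\<in>schreier A \<mu>. F \<subseteq> {n..} \<longrightarrow> F \<in> schreier A \<beta>"
      using schreier_eventually_subset[OF A] by blast
    have "X \<in> set_conv (schreier A \<alpha>) (schreier A \<beta>)"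
      if F: "F \<in> schreier A \<mu>" and h: "strict_mono_on X h" "h ` X \<subseteq> F" "\<forall>x\<in>X. max n (h x) \<le> x" for F X h
    proof -
      have "X \<in> schreier A \<mu>"
        by (rule hspreadD(3)[OF hs F h(1,2)]) (use h in auto)
      moreover have "X \<subseteq> {n..}"
        using h(3) by auto
      ultimately have "X \<in> schreier A \<beta>"
        using n by blast
      then show ?thesis
        by (intro set_conv_single[OF hs singleton_in_schreier[OF A] hs])
    qed
    then show ?thesis
      by (intro exI[of _ "\<lambda>x. max n x"]) blast
  next
    assume "\<exists>\<alpha>'<\<alpha>. \<mu> = \<beta> + \<alpha>'"
    then obtain \<alpha>' where \<alpha>': "\<alpha>' < \<alpha>" "\<mu> = \<beta> + \<alpha>'"
      by blast
    obtain n where n: "\<forall>F\<in>schreier A \<alpha>'. F \<subseteq> {n..} \<longrightarrow> F \<in> schreier A \<alpha>"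
      using schreier_eventually_subset[OF A \<alpha>'(1)] by blast
    obtain N where N: "\<And>F X h. F \<in> schreier A \<mu> \<Longrightarrow> strict_mono_on X h \<Longrightarrow> h ` X \<subseteq> F \<Longrightarrow>
      (\<And>x. x \<in> X \<Longrightarrow> N (h x) \<le> x) \<Longrightarrow> X \<in> set_conv (schreier A \<alpha>') (schreier A \<beta>)"
      using limit(2)[OF \<alpha>'(1)] \<alpha>'(2) by metis
    have "X \<in> set_conv (schreier A \<alpha>) (schreier A \<beta>)"
      if F: "F \<in> schreier A \<mu>" and h: "strict_mono_on X h" "h ` X \<subseteq> F" "\<forall>x\<in>X. max n (N (h x)) \<le> x" for F X h
    proof -
      have "X \<in> set_conv (schreier A \<alpha>') (schreier A \<beta>)"
        using N[OF F h(1,2)] h(3) by auto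
      then obtain D G where D: "D \<in> schreier A \<alpha>'" "succ_sets D G" "X = (\<Union>d\<in>D. G d)"
        "\<And>d. d \<in> D \<Longrightarrow> G d \<in> schreier A \<beta>" "\<And>d. d \<in> D \<Longrightarrow> d \<in> G d" "\<And>d i. d \<in> D \<Longrightarrow> i \<in> G d \<Longrightarrow> d \<le> i"
        by (rule set_conv_elim[OF _ hspread_schreier[OF A]]) blast
      have "D \<subseteq> X"
        using D(3,5) by auto
      \<comment> \<open>The elements of D belong to X, hence lie beyond n, where the class of
        \<alpha>' is included in that of \<alpha>.\<close>
      then have "D \<in> schreier A \<alpha>"
        using n D(1) h(3) by fastforce
      then show ?thesis
        unfolding D(3) by (rule set_conv_intro[OF hs hspread_schreier[OF A]]) (use D in auto)
    qed
    then show ?thesis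
      by (intro exI[of _ "\<lambda>x. max n (N x)"]) blast
  qed
  have lim: "is_limit (\<beta> + \<alpha>)"
    by (rule is_limit_add[OF limit(1)])
  have "\<forall>n. \<exists>N. n \<ge> 1 \<longrightarrow> (\<forall>F\<in>schreier A (A (\<beta> + \<alpha>) n). \<forall>X h. strict_mono_on X h \<longrightarrow> h ` X \<subseteq> F \<longrightarrow> (\<forall>x\<in>X. N (h x) \<le> x) \<longrightarrow>
     X \<in> set_conv (schreier A \<alpha>) (schreier A \<beta>))"
    using ex[OF ladder_less[OF A lim]] by blast
  then obtain N where N: "\<And>n F X h. n \<ge> 1 \<Longrightarrow> F \<in> schreier A (A (\<beta> + \<alpha>) n) \<Longrightarrow> strict_mono_on X h \<Longrightarrow> h ` X \<subseteq> F \<Longrightarrow>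
      (\<And>x. x \<in> X \<Longrightarrow> N n (h x) \<le> x) \<Longrightarrow> X \<in> set_conv (schreier A \<alpha>) (schreier A \<beta>)"
    by metis
  \<comment> \<open>Again the unknown ladder index n of F is at most every element of F, in
    particular at most h x.\<close>
  define M where "M d = (\<Sum>n\<le>d. N n d)" for d
  have M: "N n d \<le> M d" if "n \<le> d" for n d
    using member_le_sum[of n "{..d}" "\<lambda>n. N n d"] that by (auto simp: M_def)
  show ?case
  proof (intro exI[of _ M] ballI allI impI)
    fix F X h assume F: "F \<in> schreier A (\<beta> + \<alpha>)" and h: "strict_mono_on X h" "h ` X \<subseteq> F" "\<forall>x\<in>X. M (h x) \<le> x"
    then obtain n where n: "n \<ge> 1" "F \<in> schreier A (A (\<beta> + \<alpha>) n)" "F \<subseteq> {n..}"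
      by (auto simp: schreier_limit[OF A lim])
    have "N n (h x) \<le> x" if "x \<in> X" for x
    proof -
      have "n \<le> h x"
        using h(2) n(3) that by auto
      then show ?thesis
        using M[of n "h x"] h(3) that by force
    qed
    then show "X \<in> set_conv (schreier A \<alpha>) (schreier A \<beta>)"
      using N[OF n(1,2) h(1,2)] by blast
  qed
qed

section \<open>Coefficients, projections and block sequences\<close>

declare One_nat_def [simp del]

text \<open>The default 0 at index 0 makes the support exactly the set where \<open>coef\<close>
  does not vanish.\<close>

definition coef :: "(nat \<Rightarrow> 'a::real_vector) \<Rightarrow> 'a \<Rightarrow> nat \<Rightarrow> real" where
  "coef x v i = (if 1 \<le> i then representation (x ` {1..}) v (x i) else 0)"

lemma supp_eq_coef: "supp x v = {i. coef x v i \<noteq> 0}"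
  by (auto simp: supp_def coef_def)

lemma supp_pos: "supp x v \<subseteq> {1..}"
  by (auto simp: supp_def)

text \<open>Only indices in the support enter, so unbounded sets E are allowed, for instance for
  tails.\<close>

definition proj :: "(nat \<Rightarrow> 'a::real_vector) \<Rightarrow> nat set \<Rightarrow> 'a \<Rightarrow> 'a" where
  "proj x E v = (\<Sum>i\<in>supp x v \<inter> E. coef x v i *\<^sub>R x i)"

text \<open>A finite block sequence indexed by the minima of the supports of its members.\<close>

definition blk :: "(nat \<Rightarrow> 'a::real_vector) \<Rightarrow> nat set \<Rightarrow> (nat \<Rightarrow> 'a) \<Rightarrow> bool" where
  "blk x F v \<longleftrightarrow> finite F \<and> F \<subseteq> {1..} \<and>
     (\<forall>f\<in>F. v f \<in> span (x ` {1..}) \<and> f \<in> supp x (v f) \<and> (\<forall>i\<in>supp x (v f). f \<le> i)) \<and>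
     succ_sets F (\<lambda>f. supp x (v f))"

text \<open>The algebraic part of being a basic sequence. Block sequences inherit it by a look at
  their supports, and it suffices to speak of coefficients, supports and restrictions of finitely
  supported vectors.\<close>

locale lin_seq =
  fixes x :: "nat \<Rightarrow> 'a::real_normed_vector"
  assumes inj: "inj_on x {1..}" and indep: "independent (x ` {1..})"
begin

abbreviation V :: "'a set" where "V \<equiv> span (x ` {1..})"

lemma basis_in: "i \<ge> 1 \<Longrightarrow> x i \<in> V"
  by (simp add: span_base)

lemma coef_add: "u \<in> V \<Longrightarrow> v \<in> V \<Longrightarrow> coef x (u + v) i = coef x u i + coef x v i"
  by (simp add: coef_def representation_add[OF indep])

lemma coef_scale: "v \<in> V \<Longrightarrow> coef x (c *\<^sub>R v) i = c * coef x v i"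
  by (simp add: coef_def representation_scale[OF indep])

lemma coef_zero: "coef x 0 i = 0"
  by (simp add: coef_def representation_zero)

lemma coef_sum: "(\<And>a. a \<in> S \<Longrightarrow> f a \<in> V) \<Longrightarrow> coef x (\<Sum>a\<in>S. f a) i = (\<Sum>a\<in>S. coef x (f a) i)"
  by (simp add: coef_def representation_sum[OF indep])

lemma coef_basis: "i \<ge> 1 \<Longrightarrow> coef x (x i) j = (if j = i then 1 else 0)"
  using inj_onD[OF inj, of j i] by (auto simp: coef_def representation_basis[OF indep])

lemma finite_supp: "finite (supp x v)"
proof -
  have "finite (x ` supp x v)"
    by (rule finite_subset[OF _ finite_representation[of "x ` {1..}" v]]) (auto simp: supp_def)
  then show ?thesis
    by (rule finite_imageD) (rule inj_on_subset[OF inj supp_pos])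
qed

lemma expand:
  assumes "v \<in> V"
  shows "(\<Sum>i\<in>supp x v. coef x v i *\<^sub>R x i) = v"
proof -
  have "{b. representation (x ` {1..}) v b \<noteq> 0} = x ` supp x v"
    using representation_ne_zero[of "x ` {1..}" v] by (auto simp: supp_def)
  then have "v = (\<Sum>b\<in>x ` supp x v. representation (x ` {1..}) v b *\<^sub>R b)"
    using sum_nonzero_representation_eq[OF indep assms] by simp
  also have "\<dots> = (\<Sum>i\<in>supp x v. representation (x ` {1..}) v (x i) *\<^sub>R x i)"
    by (subst sum.reindex) (auto intro: inj_on_subset[OF inj supp_pos])
  also have "\<dots> = (\<Sum>i\<in>supp x v. coef x v i *\<^sub>R x i)"
    by (intro sum.cong) (auto simp: coef_def supp_def)
  finally show ?thesis ..
qed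

lemma coef_ext: "u \<in> V \<Longrightarrow> v \<in> V \<Longrightarrow> (\<And>i. coef x u i = coef x v i) \<Longrightarrow> u = v"
  using expand[of u] expand[of v] by (simp add: supp_eq_coef)

lemma supp_empty_iff: "v \<in> V \<Longrightarrow> supp x v = {} \<longleftrightarrow> v = 0"
  using expand[of v] by (auto simp: supp_eq_coef coef_zero)

lemma proj_in: "proj x E v \<in> V"
  unfolding proj_def using supp_pos by (intro span_sum span_scale basis_in) fastforce

lemma coef_proj: "coef x (proj x E v) i = (if i \<in> E then coef x v i else 0)"
proof -
  have pos: "j \<ge> 1" if "j \<in> supp x v" for j
    using that by (simp add: supp_def)
  have "coef x (proj x E v) i = (\<Sum>j\<in>supp x v \<inter> E. coef x v j * coef x (x j) i)"
    unfolding proj_def using pos by (subst coef_sum) (auto simp: coef_scale basis_in span_scale)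
  also have "\<dots> = (\<Sum>j\<in>supp x v \<inter> E. if j = i then coef x v j else 0)"
    using pos by (intro sum.cong) (auto simp: coef_basis)
  finally show ?thesis
    using finite_supp[of v] by (simp add: supp_eq_coef)
qed

lemma supp_proj: "supp x (proj x E v) = supp x v \<inter> E"
  by (auto simp: supp_eq_coef coef_proj)

lemma proj_add: "u \<in> V \<Longrightarrow> v \<in> V \<Longrightarrow> proj x E (u + v) = proj x E u + proj x E v"
  by (rule coef_ext) (auto simp: proj_in span_add coef_proj coef_add)

lemma proj_scale: "v \<in> V \<Longrightarrow> proj x E (c *\<^sub>R v) = c *\<^sub>R proj x E v"
  by (rule coef_ext) (auto simp: proj_in span_scale coef_proj coef_scale)

lemma proj_proj: "proj x E (proj x E' v) = proj x (E \<inter> E') v"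
  by (rule coef_ext) (auto simp: proj_in coef_proj)

lemma proj_cong: "(\<And>i. i \<in> supp x v \<Longrightarrow> i \<in> E \<longleftrightarrow> i \<in> E') \<Longrightarrow> proj x E v = proj x E' v"
  unfolding proj_def by (rule sum.cong) auto

lemma proj_all: "v \<in> V \<Longrightarrow> supp x v \<subseteq> E \<Longrightarrow> proj x E v = v"
  using expand[of v] by (simp add: proj_def Int_absorb2)

lemma proj_eq_0_iff: "proj x E v = 0 \<longleftrightarrow> supp x v \<inter> E = {}"
  using supp_empty_iff[OF proj_in, of E v] by (simp add: supp_proj)

lemma coef_sum_succ:
  assumes "finite F" "\<And>f. f \<in> F \<Longrightarrow> v f \<in> V" "succ_sets F (\<lambda>f. supp x (v f))"
    and "f \<in> F" "i \<in> supp x (v f)"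
  shows "coef x (\<Sum>g\<in>F. v g) i = coef x (v f) i"
proof -
  have "coef x (v g) i = 0" if "g \<in> F - {f}" for g
  proof (rule ccontr)
    assume "coef x (v g) i \<noteq> 0"
    then have i: "i \<in> supp x (v g)"
      by (simp add: supp_eq_coef)
    have "g < f \<or> f < g"
      using that by auto
    then show False
      using succ_setsD[OF assms(3), of g f i i] succ_setsD[OF assms(3), of f g i i] assms that i by blast
  qed
  then have "(\<Sum>g\<in>F. coef x (v g) i) = coef x (v f) i"
    by (subst sum.remove[OF assms(1,4)]) simp
  then show ?thesis
    using assms(2) by (simp add: coef_sum)
qed

lemma supp_sum_succ:
  assumes "finite F" "\<And>f. f \<in> F \<Longrightarrow> v f \<in> V" "succ_sets F (\<lambda>f. supp x (v f))"
  shows "supp x (\<Sum>f\<in>F. v f) = (\<Union>f\<in>F. supp x (v f))"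
proof
  show "supp x (\<Sum>f\<in>F. v f) \<subseteq> (\<Union>f\<in>F. supp x (v f))"
    using assms by (auto simp: supp_eq_coef coef_sum intro: ccontr dest: sum.not_neutral_contains_not_neutral)
  show "(\<Union>f\<in>F. supp x (v f)) \<subseteq> supp x (\<Sum>f\<in>F. v f)"
  proof
    fix i assume "i \<in> (\<Union>f\<in>F. supp x (v f))"
    then obtain f where "f \<in> F" "i \<in> supp x (v f)"
      by blast
    then show "i \<in> supp x (\<Sum>f\<in>F. v f)"
      using coef_sum_succ[OF assms, of f i] by (simp add: supp_eq_coef)
  qed
qed

text \<open>Serves to apply one lower estimate inside the groups and another one to their sums. The
  sum over \<open>G d\<close> has its support starting at d because \<open>u d\<close> is its first
  summand.\<close>

lemma blk_group:
  assumes b: "blk x X u" and X: "X = (\<Union>d\<in>D. G d)" and succ: "succ_sets D G"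
    and G: "\<And>d. d \<in> D \<Longrightarrow> d \<in> G d" "\<And>d i. d \<in> D \<Longrightarrow> i \<in> G d \<Longrightarrow> d \<le> i"
  shows "blk x D (\<lambda>d. \<Sum>g\<in>G d. u g)" and "d \<in> D \<Longrightarrow> blk x (G d) u"
    and "(\<Sum>g\<in>X. f g) = (\<Sum>d\<in>D. \<Sum>g\<in>G d. f g)"
proof -
  have GX: "G d \<subseteq> X" if "d \<in> D" for d
    using X that by blast
  have DX: "D \<subseteq> X"
    using X G by blast
  have fin: "finite X" "X \<subseteq> {1..}" and succX: "succ_sets X (\<lambda>f. supp x (u f))"
    and u: "\<And>f. f \<in> X \<Longrightarrow> u f \<in> V" "\<And>f. f \<in> X \<Longrightarrow> f \<in> supp x (u f)" "\<And>f i. f \<in> X \<Longrightarrow> i \<in> supp x (u f) \<Longrightarrow> f \<le> i"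
    using b by (auto simp: blk_def)
  have fG: "finite (G d)" if "d \<in> D" for d
    using finite_subset[OF GX[OF that] fin(1)] .
  have succG: "succ_sets (G d) (\<lambda>f. supp x (u f))" if "d \<in> D" for d
    by (rule succ_sets_subset[OF succX GX[OF that]]) simp
  show blkG: "blk x (G d) u" if "d \<in> D" for d
    unfolding blk_def using fG[OF that] succG[OF that] GX[OF that] fin u by blast
  have sup: "supp x (\<Sum>g\<in>G d. u g) = (\<Union>g\<in>G d. supp x (u g))" if "d \<in> D" for d
    using GX[OF that] u(1) by (intro supp_sum_succ[OF fG[OF that] _ succG[OF that]]) blast
  show "blk x D (\<lambda>d. \<Sum>g\<in>G d. u g)"
    unfolding blk_def
  proof (intro conjI ballI)
    show "finite D" "D \<subseteq> {1..}"
      using DX fin by (auto intro: finite_subset)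
    show "(\<Sum>g\<in>G d. u g) \<in> V" if "d \<in> D" for d
      using GX[OF that] u(1) by (intro span_sum) blast
    show "d \<in> supp x (\<Sum>g\<in>G d. u g)" if d: "d \<in> D" for d
      using sup[OF d] G(1)[OF d] u(2) GX[OF d] by blast
    show "d \<le> i" if d: "d \<in> D" and i: "i \<in> supp x (\<Sum>g\<in>G d. u g)" for d i
    proof -
      obtain g where g: "g \<in> G d" "i \<in> supp x (u g)"
        using sup[OF d] i by blast
      then have "g \<in> X"
        using GX[OF d] by blast
      then show ?thesis
        using u(3) g G(2)[OF d g(1)] by (meson order_trans)
    qed
    show "succ_sets D (\<lambda>f. supp x (sum u (G f)))"
    proof (rule succ_setsI)
      fix d d' i j assume d: "d \<in> D" "d' \<in> D" "d < d'" and ij: "i \<in> supp x (sum u (G d))" "j \<in> supp x (sum u (G d'))"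
      obtain g g' where g: "g \<in> G d" "i \<in> supp x (u g)" "g' \<in> G d'" "j \<in> supp x (u g')"
        using sup[OF d(1)] sup[OF d(2)] ij by blast
      then have "g < g'"
        using succ_setsD[OF succ d] by blast
      then show "i < j"
        using succ_setsD[OF succX] g GX d by blast
    qed
  qed
  have "finite D"
    using DX fin(1) by (rule finite_subset)
  moreover have "G d \<inter> G d' = {}" if "d \<in> D" "d' \<in> D" "d \<noteq> d'" for d d'
    using succ_setsD[OF succ] that by (metis disjoint_iff less_irrefl linorder_neqE_nat)
  ultimately show "(\<Sum>g\<in>X. f g) = (\<Sum>d\<in>D. \<Sum>g\<in>G d. f g)"
    unfolding X using fG by (intro sum.UNION_disjoint) auto
qed

end

section \<open>Passing from a sequence to its block sequences\<close>

lemma lin_seqI: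
  fixes x :: "nat \<Rightarrow> 'a::real_normed_vector"
  assumes *: "\<And>T c i. finite T \<Longrightarrow> T \<subseteq> {1..} \<Longrightarrow> (\<Sum>i\<in>T. c i *\<^sub>R x i) = 0 \<Longrightarrow> i \<in> T \<Longrightarrow> c i = 0"
  shows "lin_seq x"
proof
  show inj: "inj_on x {1..}"
  proof (rule inj_onI, rule ccontr)
    fix i j :: nat assume ij: "i \<in> {1..}" "j \<in> {1..}" "x i = x j" "i \<noteq> j"
    show False
      using *[of "{i, j}" "\<lambda>k. if k = i then 1 else -1" i] ij by auto
  qed
  show "independent (x ` {1..})"
    unfolding independent_explicit_finite_subsets
  proof (intro allI impI ballI)
    fix S u v assume S: "S \<subseteq> x ` {1..}" "finite S" and 0: "(\<Sum>v\<in>S. u v *\<^sub>R v) = 0" and v: "v \<in> S"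
    define T where "T = {i\<in>{1..}. x i \<in> S}"
    have xT: "x ` T = S" and injT: "inj_on x T"
      using S(1) inj by (auto simp: T_def inj_on_def)
    have "finite T"
      using S(2) xT injT finite_imageD by blast
    moreover have "(\<Sum>i\<in>T. u (x i) *\<^sub>R x i) = 0"
      using 0 unfolding xT[symmetric] sum.reindex[OF injT] by simp
    moreover obtain i where "i \<in> T" "v = x i"
      using v xT by blast
    ultimately show "u v = 0"
      using *[of T "\<lambda>i. u (x i)"] by (auto simp: T_def)
  qed
qed

text \<open>A nontrivial finite relation would be a second expansion of 0. Expansions are indexed
  from 0, so the j-th coefficient belongs to \<open>x (Suc j)\<close>.\<close>

lemma basic_sequence_lin_seq:
  assumes "basic_sequence x"
  shows "lin_seq x"
proof (rule lin_seqI)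
  fix T c i assume T: "finite T" "T \<subseteq> {1..}" and 0: "(\<Sum>i\<in>T. c i *\<^sub>R x i) = 0" and i: "i \<in> T"
  define a where "a j = (if Suc j \<in> T then c (Suc j) else 0)" for j
  define T' where "T' = {j. Suc j \<in> T}"
  have bij: "bij_betw Suc T' T"
    by (rule bij_betwI[where g = "\<lambda>i. i - 1"]) (use T(2) in \<open>auto simp: T'_def\<close>)
  have "finite T'"
    using bij_betw_finite[OF bij] T(1) by simp
  then have "(\<lambda>j. a j *\<^sub>R x (Suc j)) sums (\<Sum>j\<in>T'. a j *\<^sub>R x (Suc j))"
    by (rule sums_finite) (auto simp: a_def T'_def)
  also have "(\<Sum>j\<in>T'. a j *\<^sub>R x (Suc j)) = (\<Sum>i\<in>T. c i *\<^sub>R x i)"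
    by (subst sum.reindex_bij_betw[OF bij, symmetric]) (auto simp: a_def T'_def)
  finally have 1: "(\<lambda>j. a j *\<^sub>R x (Suc j)) sums 0"
    using 0 by simp
  have "0 \<in> closed_span x"
    using closure_subset span_zero by (auto simp: closed_span_def)
  define P where "P a \<longleftrightarrow> (\<lambda>j. a j *\<^sub>R x (Suc j)) sums 0" for a
  have "\<exists>!a. P a"
    unfolding P_def using assms \<open>0 \<in> closed_span x\<close> by (simp add: basic_sequence_def)
  moreover have "P a" "P (\<lambda>_. 0)"
    unfolding P_def using 1 by simp_all
  ultimately have "a = (\<lambda>_. 0)"
    by blast
  then have "a (i - 1) = 0"
    by simp
  then show "c i = 0"
    using i T(2) by (auto simp: a_def split: if_splits)
qed

lemma block_seq_succ_sets:
  assumes "lin_seq z" "block_seq z I w"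
  shows "succ_sets I (\<lambda>i. supp z (w i))"
proof (rule succ_setsI)
  interpret lin_seq z by fact
  fix i j a b assume ij: "i \<in> I" "j \<in> I" "i < j" and ab: "a \<in> supp z (w i)" "b \<in> supp z (w j)"
  have "set_less (supp z (w i)) (supp z (w j))"
    using assms(2) ij by (auto simp: block_seq_def)
  then have "Max (supp z (w i)) < Min (supp z (w j))"
    using ab by (auto simp: set_less_def)
  then show "a < b"
    using Max_ge[OF finite_supp ab(1)] Min_le[OF finite_supp ab(2)] by linarith
qed

lemma block_seqI:
  assumes "lin_seq z" "\<And>i. i \<in> I \<Longrightarrow> w i \<in> span (z ` {1..})" "\<And>i. i \<in> I \<Longrightarrow> w i \<noteq> 0"
    "succ_sets I (\<lambda>i. supp z (w i))"
  shows "block_seq z I w"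
proof -
  interpret lin_seq z by fact
  have "set_less (supp z (w i)) (supp z (w j))" if "i \<in> I" "j \<in> I" "i < j" for i j
    unfolding set_less_def using succ_setsD[OF assms(4) that] finite_supp
    by (metis Max_in Min_in)
  then show ?thesis
    using assms by (auto simp: block_seq_def)
qed

text \<open>The supports of the terms are disjoint, so a coordinate from the support of one term
  sees only that term of a linear relation.\<close>

lemma block_seq_lin_seq:
  assumes "lin_seq z" "block_seq z {1..} w"
  shows "lin_seq w"
proof (rule lin_seqI)
  interpret lin_seq z by fact
  fix T c i assume T: "finite T" "T \<subseteq> {1..}" and 0: "(\<Sum>i\<in>T. c i *\<^sub>R w i) = 0" and i: "i \<in> T"
  note succ = block_seq_succ_sets[OF assms]
  have w: "w j \<in> V" "w j \<noteq> 0" if "j \<in> T" for j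
    using assms(2) T(2) that by (auto simp: block_seq_def)
  obtain k where k: "k \<in> supp z (w i)"
    using supp_empty_iff[OF w(1)[OF i]] w(2)[OF i] by blast
  show "c i = 0"
  proof (rule ccontr)
    assume c: "c i \<noteq> 0"
    have "coef z (\<Sum>j\<in>T. c j *\<^sub>R w j) k = coef z (c i *\<^sub>R w i) k"
    proof (rule coef_sum_succ[OF T(1) _ _ i])
      show "succ_sets T (\<lambda>f. supp z (c f *\<^sub>R w f))"
        by (rule succ_sets_subset[OF succ T(2)]) (auto simp: supp_eq_coef coef_scale w)
      show "k \<in> supp z (c i *\<^sub>R w i)"
        using k c by (simp add: supp_eq_coef coef_scale w i)
    qed (simp add: w span_scale)
    then show False
      using 0 k c by (simp add: supp_eq_coef coef_scale w i coef_zero)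
  qed
qed

lemma block_seq_span:
  assumes "lin_seq z" "block_seq z {1..} w" "v \<in> span (w ` {1..})"
  shows "v \<in> span (z ` {1..})"
  using assms(3) span_minimal[of "w ` {1..}" "span (z ` {1..})"] assms(2)
  by (auto simp: block_seq_def)

lemma supp_block_seq:
  assumes "lin_seq z" "block_seq z {1..} w" "v \<in> span (w ` {1..})"
  shows "supp z v = (\<Union>i\<in>supp w v. supp z (w i))"
proof -
  interpret z: lin_seq z by fact
  interpret w: lin_seq w by (rule block_seq_lin_seq[OF assms(1,2)])
  have wV: "w i \<in> z.V" if "i \<in> supp w v" for i
    using assms(2) that by (auto simp: block_seq_def supp_def)
  have eq: "supp z (coef w v i *\<^sub>R w i) = supp z (w i)" if "i \<in> supp w v" for i
    using that wV[OF that] by (auto simp: supp_eq_coef z.coef_scale)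
  have "supp z v = supp z (\<Sum>i\<in>supp w v. coef w v i *\<^sub>R w i)"
    using w.expand[OF assms(3)] by simp
  also have "\<dots> = (\<Union>i\<in>supp w v. supp z (coef w v i *\<^sub>R w i))"
    by (rule z.supp_sum_succ[OF w.finite_supp])
      (auto simp: wV span_scale eq intro!: succ_sets_subset[OF block_seq_succ_sets[OF assms(1,2)] supp_pos])
  finally show ?thesis
    using eq by simp
qed

lemma supp_block_succ:
  assumes z: "lin_seq z" "block_seq z {1..} w" and b: "blk w F v"
  shows "succ_sets F (\<lambda>f. supp z (v f))"
proof (rule succ_setsI)
  fix f f' i j assume f: "f \<in> F" "f' \<in> F" "f < f'" and ij: "i \<in> supp z (v f)" "j \<in> supp z (v f')"
  have v: "v f \<in> span (w ` {1..})" "v f' \<in> span (w ` {1..})"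
    using b f by (auto simp: blk_def)
  obtain k l where kl: "k \<in> supp w (v f)" "l \<in> supp w (v f')" "i \<in> supp z (w k)" "j \<in> supp z (w l)"
    using ij unfolding supp_block_seq[OF z v(1)] supp_block_seq[OF z v(2)] by blast
  have "k < l"
    using succ_setsD[of F "\<lambda>f. supp w (v f)", OF _ f kl(1,2)] b by (simp add: blk_def)
  then show "i < j"
    using succ_setsD[OF block_seq_succ_sets[OF z] _ _ _ kl(3,4)] kl(1,2) supp_pos by blast
qed

lemma block_seq_subseq:
  assumes "lin_seq z" "strict_mono_on {1..} N" "\<And>i. i \<ge> 1 \<Longrightarrow> N i \<ge> 1"
  shows "block_seq z {1..} (\<lambda>i. z (N i))" and "\<And>i. i \<ge> 1 \<Longrightarrow> supp z (z (N i)) = {N i}"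
proof -
  interpret lin_seq z by fact
  show sup: "supp z (z (N i)) = {N i}" if "i \<ge> 1" for i
    using assms(3)[OF that] by (auto simp: supp_eq_coef coef_basis)
  show "block_seq z {1..} (\<lambda>i. z (N i))"
  proof (rule block_seqI[OF assms(1)])
    show "\<And>i. i \<in> {1..} \<Longrightarrow> z (N i) \<in> V"
      using assms(3) basis_in by simp
    show "\<And>i. i \<in> {1..} \<Longrightarrow> z (N i) \<noteq> 0"
      using sup coef_zero by (fastforce simp: supp_eq_coef)
    show "succ_sets {1..} (\<lambda>i. supp z (z (N i)))"
      using sup assms(2) by (auto intro!: succ_setsI simp: strict_mono_on_def)
  qed
qed

lemma block_seq_refl: "lin_seq z \<Longrightarrow> block_seq z {1..} z"
  using block_seq_subseq(1)[of z "\<lambda>i. i"] by (simp add: strict_mono_on_def)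

section \<open>Lower \<ell>1 estimates on admissible families\<close>

definition lower_est ::
    "(omega1 \<Rightarrow> nat \<Rightarrow> omega1) \<Rightarrow> omega1 \<Rightarrow> (nat \<Rightarrow> 'a::real_normed_vector) \<Rightarrow> real \<Rightarrow> bool" where
  "lower_est A \<alpha> x \<delta> \<longleftrightarrow> (\<forall>F v. F \<in> schreier A \<alpha> \<longrightarrow> blk x F v \<longrightarrow>
     \<delta> * (\<Sum>f\<in>F. norm (v f)) \<le> norm (\<Sum>f\<in>F. v f))"

lemma lower_estD:
  "lower_est A \<alpha> x \<delta> \<Longrightarrow> F \<in> schreier A \<alpha> \<Longrightarrow> blk x F v \<Longrightarrow> \<delta> * (\<Sum>f\<in>F. norm (v f)) \<le> norm (\<Sum>f\<in>F. v f)"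
  by (simp add: lower_est_def)

text \<open>Enumerating F in increasing order and inverting the map from a block to its minimum
  translate the two ways of indexing a block sequence into each other.\<close>

lemma lower_est_iff_admissible:
  assumes "lin_seq x"
  shows "(\<forall>k y. admissible A \<alpha> x k y \<longrightarrow> norm (\<Sum>i=1..k. y i) \<ge> \<delta> * (\<Sum>i=1..k. norm (y i))) \<longleftrightarrow>
    lower_est A \<alpha> x \<delta>"
proof -
  interpret lin_seq x by fact
  show ?thesis
  proof (intro iffI allI impI)
    assume *: "\<forall>k y. admissible A \<alpha> x k y \<longrightarrow> norm (\<Sum>i=1..k. y i) \<ge> \<delta> * (\<Sum>i=1..k. norm (y i))"
    show "lower_est A \<alpha> x \<delta>"
      unfolding lower_est_def
    proof (intro allI impI)
      fix F v assume F: "F \<in> schreier A \<alpha>" and b: "blk x F v"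
      have fin: "finite F" and succ: "succ_sets F (\<lambda>f. supp x (v f))"
        and v: "\<And>f. f \<in> F \<Longrightarrow> v f \<in> V" "\<And>f. f \<in> F \<Longrightarrow> f \<in> supp x (v f)" "\<And>f i. f \<in> F \<Longrightarrow> i \<in> supp x (v f) \<Longrightarrow> f \<le> i"
        using b by (auto simp: blk_def)
      obtain h where h: "bij_betw h {1..card F} F" "strict_mono_on {1..card F} h"
        using ex_enumeration[OF fin] .
      have hF: "h i \<in> F" if "i \<in> {1..card F}" for i
        using bij_betwE[OF h(1)] that by blast
      have "block_seq x {1..card F} (\<lambda>i. v (h i))"
      proof (rule block_seqI[OF assms])
        show "v (h i) \<in> V" "v (h i) \<noteq> 0" if "i \<in> {1..card F}" for i
          using v(1,2)[OF hF[OF that]] by (auto simp: supp_eq_coef coef_zero)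
        show "succ_sets {1..card F} (\<lambda>i. supp x (v (h i)))"
        proof (rule succ_setsI)
          fix d d' i j assume d: "d \<in> {1..card F}" "d' \<in> {1..card F}" "d < d'"
            and ij: "i \<in> supp x (v (h d))" "j \<in> supp x (v (h d'))"
          show "i < j"
            by (rule succ_setsD[OF succ hF[OF d(1)] hF[OF d(2)] strict_mono_onD[OF h(2) d] ij])
        qed
      qed
      moreover have "(\<lambda>i. Min (supp x (v (h i)))) ` {1..card F} = F"
      proof -
        have "Min (supp x (v (h i))) = h i" if "i \<in> {1..card F}" for i
          using v(2,3)[OF hF[OF that]] finite_supp by (intro Min_eqI) auto
        then have "(\<lambda>i. Min (supp x (v (h i)))) ` {1..card F} = h ` {1..card F}"
          by (intro image_cong) auto
        then show ?thesis
          using h(1) by (simp add: bij_betw_def)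
      qed
      ultimately have "admissible A \<alpha> x (card F) (\<lambda>i. v (h i))"
        using F by (simp add: admissible_def)
      then show "\<delta> * (\<Sum>f\<in>F. norm (v f)) \<le> norm (\<Sum>f\<in>F. v f)"
        using * sum.reindex_bij_betw[OF h(1), of v] sum.reindex_bij_betw[OF h(1), of "\<lambda>f. norm (v f)"]
        by metis
    qed
  next
    fix k y assume l: "lower_est A \<alpha> x \<delta>" and adm: "admissible A \<alpha> x k y"
    let ?m = "\<lambda>i. Min (supp x (y i))"
    define I where "I = {1..k}"
    have bs: "block_seq x I y" and F: "?m ` I \<in> schreier A \<alpha>"
      using adm by (auto simp: admissible_def I_def)
    note succ = block_seq_succ_sets[OF assms bs]
    have y: "y i \<in> V" "y i \<noteq> 0" if "i \<in> I" for i
      using bs that by (auto simp: block_seq_def)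
    have min: "?m i \<in> supp x (y i)" "\<And>j. j \<in> supp x (y i) \<Longrightarrow> ?m i \<le> j" if "i \<in> I" for i
      using supp_empty_iff[OF y(1)] y(2) finite_supp that by (auto intro: Min_in)
    have mono: "strict_mono_on I ?m"
    proof (rule strict_mono_onI)
      fix r s assume rs: "r \<in> I" "s \<in> I" "r < s"
      show "?m r < ?m s"
        by (rule succ_setsD[OF succ rs min(1)[OF rs(1)] min(1)[OF rs(2)]])
    qed
    note inj = strict_mono_on_imp_inj_on[OF mono]
    define h where "h = the_inv_into I ?m"
    have h: "h (?m i) = i" if "i \<in> I" for i
      unfolding h_def by (rule the_inv_into_f_f[OF inj that])
    have "blk x (?m ` I) (\<lambda>f. y (h f))"
      unfolding blk_def
    proof (intro conjI)
      show "finite (?m ` I)" by (simp add: I_def)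
      show "?m ` I \<subseteq> {1..}"
        using min(1) supp_pos by blast
      show "\<forall>f\<in>?m ` I. y (h f) \<in> V \<and> f \<in> supp x (y (h f)) \<and> (\<forall>i\<in>supp x (y (h f)). f \<le> i)"
        using h y min by auto
      show "succ_sets (?m ` I) (\<lambda>f. supp x (y (h f)))"
      proof (rule succ_setsI)
        fix d d' i j assume "d \<in> ?m ` I" "d' \<in> ?m ` I" and dd: "d < d'" "i \<in> supp x (y (h d))" "j \<in> supp x (y (h d'))"
        then obtain a b where ab: "a \<in> I" "b \<in> I" "d = ?m a" "d' = ?m b"
          by blast
        then have "a < b"
          using strict_mono_on_less[OF mono] dd(1) by blast
        then show "i < j"
          using succ_setsD[OF succ ab(1,2)] dd ab by (simp add: h)
      qed
    qed
    from lower_estD[OF l F this] have "\<delta> * (\<Sum>i\<in>I. norm (y i)) \<le> norm (\<Sum>i\<in>I. y i)"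
      using h by (simp add: sum.reindex[OF inj])
    then show "\<delta> * (\<Sum>i=1..k. norm (y i)) \<le> norm (\<Sum>i=1..k. y i)"
      by (simp add: I_def)
  qed
qed

text \<open>The family consisting of the first vector alone bounds every possible constant, so that
  the supremum in \<open>delta\<close> is taken over a bounded set.\<close>

lemma lower_est_le_1:
  assumes "ladder_system A" "lin_seq x" "lower_est A \<alpha> x \<delta>"
  shows "\<delta> \<le> 1"
proof -
  interpret lin_seq x by fact
  have "supp x (x 1) = {1}"
    by (auto simp: supp_eq_coef coef_basis)
  then have "blk x {1} x"
    by (simp add: blk_def basis_in succ_sets_def)
  from lower_estD[OF assms(3) singleton_in_schreier[OF assms(1)] this]
  have "\<delta> * norm (x 1) \<le> norm (x 1)"
    by simp
  moreover have "x 1 \<noteq> 0"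
    using coef_basis[of 1 1] coef_zero[of 1] by auto
  ultimately show ?thesis
    by simp
qed

text \<open>The supremum is attained: a family of nonzero total norm bounds all valid constants by
  one and the same quotient, hence also their supremum.\<close>

lemma
  assumes "ladder_system A" "lin_seq x"
  shows lower_est_delta: "lower_est A \<alpha> x (delta A \<alpha> x)"
    and delta_nonneg: "0 \<le> delta A \<alpha> x"
    and delta_le_1: "delta A \<alpha> x \<le> 1"
    and lower_est_le_delta: "0 \<le> \<delta> \<Longrightarrow> lower_est A \<alpha> x \<delta> \<Longrightarrow> \<delta> \<le> delta A \<alpha> x"
proof -
  define S where "S = {\<delta>. \<delta> \<ge> 0 \<and> lower_est A \<alpha> x \<delta>}"
  have d: "delta A \<alpha> x = Sup S"
    unfolding delta_def S_def lower_est_iff_admissible[OF assms(2)] ..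
  have bdd: "bdd_above S"
    using lower_est_le_1[OF assms] by (intro bdd_aboveI[of _ 1]) (auto simp: S_def)
  have 0: "0 \<in> S"
    by (simp add: S_def lower_est_def)
  show "0 \<le> delta A \<alpha> x"
    unfolding d by (rule cSup_upper[OF 0 bdd])
  show "delta A \<alpha> x \<le> 1"
    unfolding d using 0 lower_est_le_1[OF assms] by (intro cSup_least) (auto simp: S_def)
  show "\<delta> \<le> delta A \<alpha> x" if "0 \<le> \<delta>" "lower_est A \<alpha> x \<delta>"
    unfolding d using that by (intro cSup_upper[OF _ bdd]) (simp add: S_def)
  show "lower_est A \<alpha> x (delta A \<alpha> x)"
    unfolding lower_est_def
  proof (intro allI impI)
    fix F v assume F: "F \<in> schreier A \<alpha>" "blk x F v"
    let ?s = "\<Sum>f\<in>F. norm (v f)"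
    show "delta A \<alpha> x * ?s \<le> norm (\<Sum>f\<in>F. v f)"
    proof (cases "?s = 0")
      case False
      then have pos: "?s > 0"
        by (metis norm_ge_zero order_le_less sum_nonneg)
      have "delta A \<alpha> x \<le> norm (\<Sum>f\<in>F. v f) / ?s"
        unfolding d using 0 lower_estD[OF _ F] pos by (intro cSup_least) (auto simp: S_def field_simps)
      then show ?thesis
        using pos by (simp add: field_simps)
    qed simp
  qed
qed

lemma lower_est_mono: "lower_est A \<alpha> x \<delta> \<Longrightarrow> \<delta>' \<le> \<delta> \<Longrightarrow> lower_est A \<alpha> x \<delta>'"
  unfolding lower_est_def by (meson mult_right_mono norm_ge_zero order_trans sum_nonneg)

lemma lower_est_0: "lower_est A 0 x 1"
  by (auto simp: lower_est_def schreier_zero schreier_0_def)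

text \<open>On a sparse subsequence \<open>z (M i)\<close> a set from the class of \<beta> +
  \<alpha> is stretched so much that it splits as a member of
  \<open>set_conv (schreier A \<alpha>) (schreier A \<beta>)\<close>. Then \<delta>' is spent inside
  the pieces and \<delta> on their sums.\<close>

lemma lower_est_mult:
  assumes A: "ladder_system A" and z: "lin_seq z" and l: "lower_est A \<alpha> z \<delta>" "lower_est A \<beta> z \<delta>'" and nn: "0 \<le> \<delta>" "0 \<le> \<delta>'"
  shows "\<exists>w. block_seq z {1..} w \<and> lower_est A (\<beta> + \<alpha>) w (\<delta> * \<delta>')"
proof -
  interpret z: lin_seq z by fact
  note hs = hspread_schreier[OF A]
  obtain N where N: "\<And>F X h. F \<in> schreier A (\<beta> + \<alpha>) \<Longrightarrow> strict_mono_on X h \<Longrightarrow> h ` X \<subseteq> F \<Longrightarrow> (\<And>x. x \<in> X \<Longrightarrow> N (h x) \<le> x) \<Longrightarrow>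
     X \<in> set_conv (schreier A \<alpha>) (schreier A \<beta>)"
    using schreier_add_subset[OF A] by metis
  \<comment> \<open>The successors make the partial sums strictly increasing and positive, besides
    dominating N.\<close>
  define M where "M d = (\<Sum>i\<le>d. Suc (N i))" for d
  have M: "strict_mono M" "N d \<le> M d" "M d \<ge> 1" for d
    using member_le_sum[of d "{..d}" "\<lambda>i. Suc (N i)"] by (auto simp: M_def strict_mono_Suc_iff)
  have Mless: "M i < M j \<longleftrightarrow> i < j" "M i = M j \<longleftrightarrow> i = j" for i j
    using M(1) by (simp_all add: strict_mono_less strict_mono_eq)
  define w where "w = (\<lambda>i. z (M i))"
  have bs: "block_seq z {1..} w" and sw: "\<And>i. i \<ge> 1 \<Longrightarrow> supp z (w i) = {M i}"
    unfolding w_def using block_seq_subseq[OF z, of M] M by (auto simp: strict_mono_on_def strict_mono_def)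
  have "lower_est A (\<beta> + \<alpha>) w (\<delta> * \<delta>')"
    unfolding lower_est_def
  proof (intro allI impI)
    fix F v assume F: "F \<in> schreier A (\<beta> + \<alpha>)" and b: "blk w F v"
    define h where "h = the_inv_into F M"
    have injM: "inj_on M F" and mM: "strict_mono_on F M"
      using Mless by (auto simp: inj_on_def strict_mono_on_def)
    have h: "h (M f) = f" if "f \<in> F" for f
      unfolding h_def by (rule the_inv_into_f_f[OF injM that])
    have "M ` F \<in> set_conv (schreier A \<alpha>) (schreier A \<beta>)"
    proof (rule N[OF F, of _ h])
      show "strict_mono_on (M ` F) h"
        unfolding h_def by (rule strict_mono_on_the_inv_into[OF mM])
      show "h ` M ` F \<subseteq> F" "\<And>x. x \<in> M ` F \<Longrightarrow> N (h x) \<le> x"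
        using h M(2) by auto
    qed
    then obtain D G where D: "D \<in> schreier A \<alpha>" "succ_sets D G" "M ` F = (\<Union>d\<in>D. G d)"
      "\<And>d. d \<in> D \<Longrightarrow> G d \<in> schreier A \<beta>" "\<And>d. d \<in> D \<Longrightarrow> d \<in> G d" "\<And>d i. d \<in> D \<Longrightarrow> i \<in> G d \<Longrightarrow> d \<le> i"
      using set_conv_elim[OF _ hs] by blast
    have v: "v f \<in> span (w ` {1..})" "f \<in> supp w (v f)" "\<And>i. i \<in> supp w (v f) \<Longrightarrow> f \<le> i" if "f \<in> F" for f
      using b that by (auto simp: blk_def)
    have sv: "supp z (v f) = M ` supp w (v f)" if "f \<in> F" for f
      unfolding supp_block_seq[OF z bs v(1)[OF that]] using sw supp_pos[of w "v f"] by auto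
    have blkz: "blk z (M ` F) (\<lambda>g. v (h g))"
      unfolding blk_def
    proof (intro conjI)
      show "finite (M ` F)" "M ` F \<subseteq> {1..}"
        using b M(3) by (auto simp: blk_def)
      show "\<forall>f\<in>M ` F. v (h f) \<in> z.V \<and> f \<in> supp z (v (h f)) \<and> (\<forall>i\<in>supp z (v (h f)). f \<le> i)"
        using h sv v block_seq_span[OF z bs] M(1) by (auto simp: strict_mono_less_eq)
      show "succ_sets (M ` F) (\<lambda>f. supp z (v (h f)))"
      proof (rule succ_setsI)
        fix d d' i j assume "d \<in> M ` F" "d' \<in> M ` F" and dd: "d < d'" "i \<in> supp z (v (h d))" "j \<in> supp z (v (h d'))"
        then obtain f f' where f: "f \<in> F" "f' \<in> F" "d = M f" "d' = M f'"
          by blast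
        then show "i < j"
          using succ_setsD[OF supp_block_succ[OF z bs b] f(1,2)] dd by (simp add: h Mless)
      qed
    qed
    note g = z.blk_group[OF blkz D(3,2,5,6)]
    have "\<delta> * \<delta>' * (\<Sum>f\<in>F. norm (v f)) = \<delta> * (\<delta>' * (\<Sum>g\<in>M ` F. norm (v (h g))))"
      using h by (simp add: sum.reindex[OF injM])
    also have "\<dots> = \<delta> * (\<Sum>d\<in>D. \<delta>' * (\<Sum>g\<in>G d. norm (v (h g))))"
      by (simp add: g(3) sum_distrib_left)
    also have "\<dots> \<le> \<delta> * (\<Sum>d\<in>D. norm (\<Sum>g\<in>G d. v (h g)))"
      using lower_estD[OF l(2) D(4) g(2)] nn by (intro mult_left_mono sum_mono) auto
    also have "\<dots> \<le> norm (\<Sum>d\<in>D. \<Sum>g\<in>G d. v (h g))"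
      by (rule lower_estD[OF l(1) D(1) g(1)])
    also have "\<dots> = norm (\<Sum>f\<in>F. v f)"
      using h by (simp add: g(3)[symmetric] sum.reindex[OF injM])
    finally show "\<delta> * \<delta>' * (\<Sum>f\<in>F. norm (v f)) \<le> norm (\<Sum>f\<in>F. v f)" .
  qed
  with bs show ?thesis by blast
qed

section \<open>The renorming\<close>

text \<open>F consists of left ends and r gives the right ends: the intervals {f..r f} are
  successive, and some of them may be empty.\<close>

definition gaps :: "nat set \<Rightarrow> (nat \<Rightarrow> nat) \<Rightarrow> bool" where
  "gaps F r \<longleftrightarrow> (\<forall>f\<in>F. \<forall>g\<in>F. f < g \<longrightarrow> r f < g)"

lemma gapsD: "gaps F r \<Longrightarrow> f \<in> F \<Longrightarrow> g \<in> F \<Longrightarrow> f < g \<Longrightarrow> r f < g"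
  unfolding gaps_def by blast

definition isum :: "(nat \<Rightarrow> 'a::real_normed_vector) \<Rightarrow> nat set \<Rightarrow> (nat \<Rightarrow> nat) \<Rightarrow> 'a \<Rightarrow> real" where
  "isum x F r v = (\<Sum>f\<in>F. norm (proj x {f..r f} v))"

text \<open>At the ordinal \<beta> \<odot> k this is the k-th auxiliary norm. It is a supremum of
  reals, hence meaningful only together with an upper bound such as \<open>isum_le\<close>.\<close>

definition anorm ::
    "(omega1 \<Rightarrow> nat \<Rightarrow> omega1) \<Rightarrow> omega1 \<Rightarrow> (nat \<Rightarrow> 'a::real_normed_vector) \<Rightarrow> 'a \<Rightarrow> real" where
  "anorm A \<alpha> x v = Sup {isum x F r v | F r. F \<in> schreier A \<alpha> \<and> gaps F r}"

context lin_seq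
begin

text \<open>Every interval is shrunk to the hull of the part of the support that it contains, and
  intervals missing the support are dropped. Left ends move only to the right, so the spreading
  property keeps their set in \<open>\<F>\<close>.\<close>

lemma isum_normalize:
  assumes hs: "hspread \<F>" and F: "F \<in> \<F>" "gaps F r"
  shows "\<exists>F' r'. F' \<in> \<F> \<and> gaps F' r' \<and> (\<forall>g\<in>F'. g \<in> supp x v \<and> r' g \<in> supp x v \<and> g \<le> r' g) \<and>
    isum x F' r' v = isum x F r v"
proof -
  define S where "S f = supp x v \<inter> {f..r f}" for f
  define F0 where "F0 = {f\<in>F. S f \<noteq> {}}"
  define m where "m f = Min (S f)" for f
  have fin: "finite (S f)" for f
    by (simp add: S_def finite_supp)
  have m: "m f \<in> S f" "\<And>i. i \<in> S f \<Longrightarrow> m f \<le> i" and M: "Max (S f) \<in> S f" "\<And>i. i \<in> S f \<Longrightarrow> i \<le> Max (S f)" if "f \<in> F0" for f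
    unfolding m_def using that fin by (auto simp: F0_def)
  have less: "i < j" if "f \<in> F0" "g \<in> F0" "f < g" "i \<in> S f" "j \<in> S g" for f g i j
    using gapsD[OF F(2), of f g] that by (auto simp: S_def F0_def)
  have mono: "strict_mono_on F0 m"
    by (rule strict_mono_onI) (use less m in blast)
  note inj = strict_mono_on_imp_inj_on[OF mono]
  define h where "h = the_inv_into F0 m"
  have h: "h (m f) = f" if "f \<in> F0" for f
    unfolding h_def by (rule the_inv_into_f_f[OF inj that])
  have fin_F: "finite F"
    by (rule hspreadD(1)[OF hs F(1)])
  define r' where "r' g = Max (S (h g))" for g
  have "m ` F0 \<in> \<F>"
  proof (rule hspreadD(3)[OF hs F(1), of _ h])
    show "strict_mono_on (m ` F0) h"
      unfolding h_def by (rule strict_mono_on_the_inv_into[OF mono])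
    show "h ` m ` F0 \<subseteq> F"
      using h by (auto simp: image_image cong: image_cong) (simp add: F0_def)
    show "\<And>g. g \<in> m ` F0 \<Longrightarrow> h g \<le> g"
      using h m(1) by (auto simp: S_def)
  qed
  moreover have "gaps (m ` F0) r'"
    unfolding gaps_def
  proof (intro ballI impI)
    fix a b assume "a \<in> m ` F0" "b \<in> m ` F0" and ab: "a < b"
    then obtain f g where fg: "f \<in> F0" "g \<in> F0" "a = m f" "b = m g"
      by blast
    then have "f < g"
      using strict_mono_on_less[OF mono] ab by blast
    then show "r' a < b"
      using less[OF fg(1,2) _ M(1)[OF fg(1)] m(1)[OF fg(2)]] fg by (simp add: r'_def h)
  qed
  moreover have "\<forall>g\<in>m ` F0. g \<in> supp x v \<and> r' g \<in> supp x v \<and> g \<le> r' g"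
    using m M h unfolding r'_def S_def by auto
  moreover have "isum x (m ` F0) r' v = isum x F r v"
  proof -
    have "proj x {m f..r' (m f)} v = proj x {f..r f} v" if "f \<in> F0" for f
    proof (rule proj_cong)
      fix i assume i: "i \<in> supp x v"
      have "i \<in> {m f..r' (m f)} \<Longrightarrow> i \<in> {f..r f}"
        using m(1)[OF that] M(1)[OF that] that by (auto simp: r'_def h S_def)
      moreover have "i \<in> {f..r f} \<Longrightarrow> i \<in> {m f..r' (m f)}"
        using i m(2)[OF that, of i] M(2)[OF that, of i] that by (auto simp: r'_def h S_def)
      ultimately show "i \<in> {m f..r' (m f)} \<longleftrightarrow> i \<in> {f..r f}"
        by blast
    qed
    then have "isum x (m ` F0) r' v = isum x F0 r v"
      unfolding isum_def by (simp add: sum.reindex[OF inj])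
    also have "\<dots> = isum x F r v"
      unfolding isum_def
      by (rule sum.mono_neutral_left[OF fin_F]) (auto simp: F0_def S_def proj_eq_0_iff)
    finally show ?thesis .
  qed
  ultimately show ?thesis by blast
qed

lemma proj_UN:
  assumes "finite F" "\<And>f g. f \<in> F \<Longrightarrow> g \<in> F \<Longrightarrow> f \<noteq> g \<Longrightarrow> E f \<inter> E g = {}"
  shows "(\<Sum>f\<in>F. proj x (E f) v) = proj x (\<Union>f\<in>F. E f) v"
proof -
  have "supp x v \<inter> (\<Union>f\<in>F. E f) = (\<Union>f\<in>F. supp x v \<inter> E f)"
    by blast
  then show ?thesis
    unfolding proj_def using assms by (simp only:) (intro sum.UNION_disjoint[symmetric]; simp add: finite_supp; blast)
qed

end

text \<open>\<open>norm_split\<close> is the lower \<ell>1 estimate for a vector cut into two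
  halves. It bounds restrictions to heads and tails by C and restrictions to intervals by the square
  of C.\<close>

locale tail_bounded = lin_seq x for x :: "nat \<Rightarrow> 'a::real_normed_vector" +
  fixes C :: real
  assumes C_ge_1: "1 \<le> C"
    and norm_split: "v \<in> span (x ` {1..}) \<Longrightarrow> norm (proj x {..<n} v) + norm (proj x {n..} v) \<le> C * norm v"
begin

lemma norm_head: "v \<in> V \<Longrightarrow> norm (proj x {..<n} v) \<le> C * norm v"
  and norm_tail: "v \<in> V \<Longrightarrow> norm (proj x {n..} v) \<le> C * norm v"
  using norm_split[of v n] norm_ge_zero[of "proj x {..<n} v"] norm_ge_zero[of "proj x {n..} v"] by linarith+

lemma norm_interval: "v \<in> V \<Longrightarrow> norm (proj x {a..b} v) \<le> C\<^sup>2 * norm v"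
proof -
  assume v: "v \<in> V"
  have "{a..b} = {a..} \<inter> {..<Suc b}"
    by auto
  then have "proj x {a..b} v = proj x {a..} (proj x {..<Suc b} v)"
    by (simp add: proj_proj)
  also have "norm \<dots> \<le> C * norm (proj x {..<Suc b} v)"
    by (rule norm_tail[OF proj_in])
  also have "\<dots> \<le> C * (C * norm v)"
    using norm_head[OF v] C_ge_1 by (intro mult_left_mono) auto
  finally show ?thesis
    by (simp add: power2_eq_square mult.assoc)
qed

text \<open>The intervals are enlarged until they leave no gaps, so that the pieces add up to a tail
  of v, of norm at most C times that of v. The lower estimate then costs 1 / c, and cutting the
  enlarged intervals back to the original ones costs a second factor C.\<close>

lemma isum_le:
  assumes A: "ladder_system A" and l: "lower_est A \<alpha> x c" and c: "c > 0"
    and v: "v \<in> V" and F: "F \<in> schreier A \<alpha>" "gaps F r"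
  shows "isum x F r v \<le> C\<^sup>2 / c * norm v"
proof -
  obtain G s where G: "G \<in> schreier A \<alpha>" "gaps G s" and Gs: "\<And>g. g \<in> G \<Longrightarrow> g \<in> supp x v"
    "\<And>g. g \<in> G \<Longrightarrow> g \<le> s g" and eq: "isum x G s v = isum x F r v"
    using isum_normalize[OF hspread_schreier[OF A] F, of v] by blast
  have finG: "finite G" "G \<subseteq> {1..}"
    using hspreadD(1,2)[OF hspread_schreier[OF A] G(1)] by auto
  \<comment> \<open>\<open>E g\<close> reaches to the next point of G, and for the last point it is
    unbounded.\<close>
  define E where "E g = {i. g \<le> i \<and> (\<forall>g'\<in>G. g < g' \<longrightarrow> i < g')}" for g
  have disj: "succ_sets G E"
    by (rule succ_setsI) (auto simp: E_def)
  have E: "E f \<inter> E g = {}" if "f \<in> G" "g \<in> G" "f \<noteq> g" for f g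
    using succ_setsD[OF disj] that by (metis disjoint_iff less_irrefl linorder_neqE_nat)
  define u where "u g = proj x (E g) v" for g
  have b: "blk x G u"
    unfolding blk_def
  proof (intro conjI)
    show "finite G" "G \<subseteq> {1..}" by fact+
    show "\<forall>f\<in>G. u f \<in> V \<and> f \<in> supp x (u f) \<and> (\<forall>i\<in>supp x (u f). f \<le> i)"
      using Gs by (auto simp: u_def proj_in supp_proj E_def)
    show "succ_sets G (\<lambda>f. supp x (u f))"
      by (rule succ_sets_subset[OF disj]) (auto simp: u_def supp_proj)
  qed
  have piece: "norm (proj x {g..s g} v) \<le> C * norm (u g)" if "g \<in> G" for g
  proof -
    have "{g..s g} = {..<Suc (s g)} \<inter> E g"
      using gapsD[OF G(2) that] by (force simp: E_def)
    then have "proj x {g..s g} v = proj x {..<Suc (s g)} (u g)"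
      by (simp add: u_def proj_proj)
    then show ?thesis
      using norm_head[of "u g"] by (simp add: u_def proj_in)
  qed
  have "norm (\<Sum>g\<in>G. u g) \<le> C * norm v"
  proof (cases "G = {}")
    case True
    then show ?thesis
      using C_ge_1 by simp
  next
    case False
    have "(\<Union>g\<in>G. E g) = {Min G..}"
    proof
      show "(\<Union>g\<in>G. E g) \<subseteq> {Min G..}"
        unfolding E_def using order_trans[OF Min_le[OF finG(1)]] by blast
      show "{Min G..} \<subseteq> (\<Union>g\<in>G. E g)"
      proof
        fix i assume i: "i \<in> {Min G..}"
        define H where "H = {g\<in>G. g \<le> i}"
        have H: "finite H" "H \<noteq> {}"
          using finG i Min_in[OF finG(1) False] by (auto simp: H_def)
        have "Max H \<in> H"
          using H by (rule Max_in)
        moreover have "i < g'" if "g' \<in> G" "Max H < g'" for g'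
          using Max_ge[OF H(1), of g'] that by (auto simp: H_def not_le[symmetric])
        ultimately show "i \<in> (\<Union>g\<in>G. E g)"
          by (auto simp: E_def H_def)
      qed
    qed
    then have "(\<Sum>g\<in>G. u g) = proj x {Min G..} v"
      unfolding u_def using proj_UN[OF finG(1) E] by simp
    then show ?thesis
      using norm_tail[OF v] by simp
  qed
  have "c * isum x F r v \<le> c * (\<Sum>g\<in>G. C * norm (u g))"
    unfolding eq[symmetric] unfolding isum_def using piece c by (intro mult_left_mono sum_mono) auto
  also have "\<dots> = C * (c * (\<Sum>g\<in>G. norm (u g)))"
    by (simp add: sum_distrib_left mult.left_commute)
  also have "\<dots> \<le> C * norm (\<Sum>g\<in>G. u g)"
    using lower_estD[OF l G(1) b] C_ge_1 by (intro mult_left_mono) auto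
  also have "\<dots> \<le> C * (C * norm v)"
    using \<open>norm (\<Sum>g\<in>G. u g) \<le> C * norm v\<close> C_ge_1 by (intro mult_left_mono) auto
  finally show ?thesis
    using c by (simp add: field_simps power2_eq_square)
qed

context
  fixes A \<alpha> c
  assumes A: "ladder_system A" and l: "lower_est A \<alpha> x c" and c: "c > 0"
begin

lemma isum_le_anorm: "v \<in> V \<Longrightarrow> F \<in> schreier A \<alpha> \<Longrightarrow> gaps F r \<Longrightarrow> isum x F r v \<le> anorm A \<alpha> x v"
  unfolding anorm_def
  by (rule cSup_upper) (auto intro!: bdd_aboveI[of _ "C\<^sup>2 / c * norm v"] isum_le[OF A l c])

lemma anorm_least:
  assumes "\<And>F r. F \<in> schreier A \<alpha> \<Longrightarrow> gaps F r \<Longrightarrow> isum x F r v \<le> M"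
  shows "anorm A \<alpha> x v \<le> M"
  unfolding anorm_def
proof (rule cSup_least)
  show "{isum x F r v |F r. F \<in> schreier A \<alpha> \<and> gaps F r} \<noteq> {}"
    using empty_in_schreier[OF A, of \<alpha>] by (auto simp: gaps_def intro!: exI[of _ "{}"])
qed (use assms in auto)

lemma anorm_le: "v \<in> V \<Longrightarrow> anorm A \<alpha> x v \<le> C\<^sup>2 / c * norm v"
  by (intro anorm_least isum_le[OF A l c])

lemma anorm_nonneg: "v \<in> V \<Longrightarrow> 0 \<le> anorm A \<alpha> x v"
  using isum_le_anorm[OF _ empty_in_schreier[OF A]] by (fastforce simp: gaps_def isum_def)

lemma anorm_add:
  assumes "u \<in> V" "v \<in> V"
  shows "anorm A \<alpha> x (u + v) \<le> anorm A \<alpha> x u + anorm A \<alpha> x v"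
proof (rule anorm_least)
  fix F r assume F: "F \<in> schreier A \<alpha>" "gaps F r"
  have "isum x F r (u + v) \<le> isum x F r u + isum x F r v"
    unfolding isum_def sum.distrib[symmetric] proj_add[OF assms] by (intro sum_mono norm_triangle_ineq)
  then show "isum x F r (u + v) \<le> anorm A \<alpha> x u + anorm A \<alpha> x v"
    using isum_le_anorm[OF assms(1) F] isum_le_anorm[OF assms(2) F] by linarith
qed

text \<open>One inequality is enough here: the reverse one follows by applying it to the inverse
  scalar, which is done once for the extended norm.\<close>

lemma anorm_scale_le:
  assumes "v \<in> V"
  shows "anorm A \<alpha> x (a *\<^sub>R v) \<le> \<bar>a\<bar> * anorm A \<alpha> x v"
proof (rule anorm_least)
  fix F r assume F: "F \<in> schreier A \<alpha>" "gaps F r"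
  have "isum x F r (a *\<^sub>R v) = \<bar>a\<bar> * isum x F r v"
    unfolding isum_def proj_scale[OF assms] by (simp add: sum_distrib_left)
  then show "isum x F r (a *\<^sub>R v) \<le> \<bar>a\<bar> * anorm A \<alpha> x v"
    using isum_le_anorm[OF assms F] by (simp add: mult_left_mono)
qed

end

text \<open>The class of 0 contains the singletons, and one interval starting at 1 covers the
  support. This makes the summand k = 0 of the new norm dominate the given norm.\<close>

lemma norm_le_anorm_0:
  assumes "ladder_system A" "v \<in> V"
  shows "norm v \<le> anorm A 0 x v"
proof -
  obtain n where n: "supp x v \<subseteq> {..n}"
    using finite_supp finite_nat_iff_bounded_le by metis
  have "supp x v \<subseteq> {1..n}"
    using n supp_pos[of x v] by auto
  then have "isum x {1} (\<lambda>_. n) v = norm v"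
    using proj_all[OF assms(2)] by (simp add: isum_def)
  moreover have "isum x {1} (\<lambda>_. n) v \<le> anorm A 0 x v"
    by (rule isum_le_anorm[OF assms(1) lower_est_0 _ assms(2) singleton_in_schreier[OF assms(1)]]) (auto simp: gaps_def)
  ultimately show ?thesis
    by simp
qed

text \<open>Nearly optimal interval systems for the single vectors are put together. After
  normalization their left ends lie in the supports, hence beyond \<open>N f\<close>, so their union
  is in the class of \<kappa> + \<beta>; the right ends lie in the supports too, so no interval runs
  into the next vector.\<close>

lemma sum_anorm_le:
  assumes A: "ladder_system A" and l: "lower_est A \<kappa> x c" "lower_est A (\<kappa> + \<beta>) x c'" and c: "c > 0" "c' > 0"
    and N: "\<And>D G. D \<in> schreier A \<beta> \<Longrightarrow> (\<And>d. d\<in>D \<Longrightarrow> G d \<in> schreier A \<kappa> \<and> (\<forall>i\<in>G d. N d \<le> i)) \<Longrightarrow>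
     succ_sets D G \<Longrightarrow> (\<Union>d\<in>D. G d) \<in> schreier A (\<kappa> + \<beta>)"
    and F: "F \<in> schreier A \<beta>" and v: "\<And>f. f \<in> F \<Longrightarrow> v f \<in> V" and succ: "succ_sets F (\<lambda>f. supp x (v f))"
    and Nv: "\<And>f i. f \<in> F \<Longrightarrow> i \<in> supp x (v f) \<Longrightarrow> N f \<le> i"
  shows "(\<Sum>f\<in>F. anorm A \<kappa> x (v f)) \<le> anorm A (\<kappa> + \<beta>) x (\<Sum>f\<in>F. v f)"
proof (rule field_le_epsilon)
  note hs = hspread_schreier[OF A]
  fix e :: real assume e: "e > 0"
  have finF: "finite F"
    by (rule finite_schreier[OF A F])
  define e' where "e' = e / (card F + 1)"
  have e': "e' > 0" "card F * e' \<le> e"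
    using e by (auto simp: e'_def field_simps)
  define Q where "Q f G r \<longleftrightarrow> G \<in> schreier A \<kappa> \<and> gaps G r \<and>
      (\<forall>g\<in>G. g \<in> supp x (v f) \<and> r g \<in> supp x (v f) \<and> g \<le> r g) \<and>
      anorm A \<kappa> x (v f) - e' \<le> isum x G r (v f)" for f G r
  have "\<exists>G r. Q f G r" if f: "f \<in> F" for f
  proof -
    have "\<exists>G r. G \<in> schreier A \<kappa> \<and> gaps G r \<and> anorm A \<kappa> x (v f) - e' < isum x G r (v f)"
    proof (rule ccontr)
      assume "\<not> ?thesis"
      then have "anorm A \<kappa> x (v f) \<le> anorm A \<kappa> x (v f) - e'"
        by (intro anorm_least[OF A l(1) c(1)]) (auto simp: not_less)
      then show False
        using e'(1) by simp
    qed
    then obtain G r where "G \<in> schreier A \<kappa>" "gaps G r" "anorm A \<kappa> x (v f) - e' < isum x G r (v f)"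
      by blast
    then show ?thesis
      unfolding Q_def using isum_normalize[OF hs, of G \<kappa> r "v f"] by (metis order_less_imp_le)
  qed
  then obtain G r where "\<And>f. f \<in> F \<Longrightarrow> Q f (G f) (r f)"
    by metis
  then have G: "\<And>f. f \<in> F \<Longrightarrow> G f \<in> schreier A \<kappa>" "\<And>f. f \<in> F \<Longrightarrow> gaps (G f) (r f)"
      "\<And>f g. f \<in> F \<Longrightarrow> g \<in> G f \<Longrightarrow> g \<in> supp x (v f)" "\<And>f g. f \<in> F \<Longrightarrow> g \<in> G f \<Longrightarrow> r f g \<in> supp x (v f)"
      "\<And>f g. f \<in> F \<Longrightarrow> g \<in> G f \<Longrightarrow> g \<le> r f g"
      "\<And>f. f \<in> F \<Longrightarrow> anorm A \<kappa> x (v f) - e' \<le> isum x (G f) (r f) (v f)"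
    by (auto simp: Q_def)
  have succG: "succ_sets F G"
    by (rule succ_sets_subset[OF succ]) (use G(3) in auto)
  define U where "U = (\<Union>f\<in>F. G f)"
  have U: "U \<in> schreier A (\<kappa> + \<beta>)"
    unfolding U_def by (rule N[OF F _ succG]) (use G(1,3) Nv in blast)
  have disj: "f = f'" if "f \<in> F" "f' \<in> F" "g \<in> supp x (v f)" "g \<in> supp x (v f')" for f f' g
    using succ_setsD[OF succ] that by (metis less_irrefl linorder_neqE_nat)
  \<comment> \<open>Supports of different vectors are disjoint, so a left end determines the vector
    it comes from.\<close>
  define own where "own g = (THE f. f \<in> F \<and> g \<in> G f)" for g
  have own: "own g = f" if "f \<in> F" "g \<in> G f" for f g
    unfolding own_def using that disj G(3) by (intro the_equality) blast+
  define s where "s g = r (own g) g" for g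
  have gapsU: "gaps U s"
    unfolding gaps_def
  proof (intro ballI impI)
    fix a b assume "a \<in> U" "b \<in> U" and ab: "a < b"
    then obtain f f' where f: "f \<in> F" "f' \<in> F" "a \<in> G f" "b \<in> G f'"
      by (auto simp: U_def)
    have "f \<le> f'"
      by (rule succ_sets_mono[OF succG f(3,4,1,2)]) (use ab in simp)
    then consider "f = f'" | "f < f'"
      by linarith
    then show "s a < b"
    proof cases
      case 1
      then show ?thesis
        using gapsD[OF G(2)] f ab by (simp add: s_def own)
    next
      case 2
      then show ?thesis
        using succ_setsD[OF succ f(1,2)] G(3)[OF f(2,4)] G(4)[OF f(1,3)] f by (simp add: s_def own)
    qed
  qed
  \<comment> \<open>Both ends of the interval lie in the support of \<open>v f\<close>, so all other
    vectors vanish between them.\<close>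
  have proj_eq: "proj x {g..s g} (\<Sum>f\<in>F. v f) = proj x {g..r f g} (v f)" if f: "f \<in> F" "g \<in> G f" for f g
  proof (rule coef_ext)
    fix i
    have "coef x (\<Sum>f\<in>F. v f) i = coef x (v f) i" if i: "g \<le> i" "i \<le> r f g"
    proof -
      have "coef x (v f') i = 0" if "f' \<in> F - {f}" for f'
      proof (rule ccontr)
        assume "coef x (v f') i \<noteq> 0"
        then have i': "i \<in> supp x (v f')"
          by (simp add: supp_eq_coef)
        have "f' \<noteq> f"
          using that by blast
        then consider "f < f'" | "f' < f"
          by linarith
        then show False
        proof cases
          case 1
          then show False
            using succ_setsD[OF succ f(1) _ 1 G(4)[OF f] i'] that i by auto
        next
          case 2
          then show False
            using succ_setsD[OF succ _ f(1) 2 i' G(3)[OF f]] that i by auto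
        qed
      qed
      then have "(\<Sum>f\<in>F. coef x (v f) i) = coef x (v f) i"
        by (subst sum.remove[OF finF f(1)]) simp
      then show ?thesis
        using v by (simp add: coef_sum)
    qed
    then show "coef x (proj x {g..s g} (\<Sum>f\<in>F. v f)) i = coef x (proj x {g..r f g} (v f)) i"
      using own[OF f] by (simp add: coef_proj s_def)
  qed (rule proj_in)+
  have "isum x U s (\<Sum>f\<in>F. v f) = (\<Sum>f\<in>F. \<Sum>g\<in>G f. norm (proj x {g..s g} (\<Sum>f\<in>F. v f)))"
    unfolding isum_def U_def using finF finite_schreier[OF A G(1)] disj G(3)
    by (intro sum.UNION_disjoint) blast+
  also have "\<dots> = (\<Sum>f\<in>F. isum x (G f) (r f) (v f))"
    unfolding isum_def by (intro sum.cong refl) (simp add: proj_eq)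
  finally have eq: "isum x U s (\<Sum>f\<in>F. v f) = (\<Sum>f\<in>F. isum x (G f) (r f) (v f))" .
  have "(\<Sum>f\<in>F. anorm A \<kappa> x (v f)) - card F * e' = (\<Sum>f\<in>F. anorm A \<kappa> x (v f) - e')"
    by (simp add: sum_subtractf)
  also have "\<dots> \<le> isum x U s (\<Sum>f\<in>F. v f)"
    unfolding eq by (intro sum_mono G(6))
  also have "\<dots> \<le> anorm A (\<kappa> + \<beta>) x (\<Sum>f\<in>F. v f)"
    using v by (intro isum_le_anorm[OF A l(2) c(2) _ U gapsU] span_sum)
  finally show "(\<Sum>f\<in>F. anorm A \<kappa> x (v f)) \<le> anorm A (\<kappa> + \<beta>) x (\<Sum>f\<in>F. v f) + e"
    using e'(2) by linarith
qed

text \<open>The k-th summand of the parts is controlled by the summand k + 1 of the whole, which has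
  one more factor t. Only the summand K has no successor; by \<open>small\<close> it is at most half
  the norm, so the others make up at least half of q, and the constant becomes t / 2.\<close>

lemma ex_renorming:
  assumes A: "ladder_system A" and t: "t > 0" and l: "\<And>k. k \<le> K \<Longrightarrow> lower_est A (\<beta> \<odot> k) x (c k)"
    and c: "\<And>k. k \<le> K \<Longrightarrow> c k > 0" and small: "t ^ K * (C\<^sup>2 / c K) \<le> 1 / 2"
  shows "\<exists>q N B. B \<ge> 1 \<and> (\<forall>v\<in>V. norm v \<le> q v \<and> q v \<le> B * norm v) \<and>
    (\<forall>u\<in>V. \<forall>v\<in>V. q (u + v) \<le> q u + q v) \<and> (\<forall>a. \<forall>v\<in>V. q (a *\<^sub>R v) \<le> \<bar>a\<bar> * q v) \<and>
    (\<forall>F v. F \<in> schreier A \<beta> \<longrightarrow> (\<forall>f\<in>F. v f \<in> V \<and> (\<forall>i\<in>supp x (v f). N f \<le> i)) \<longrightarrow>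
       succ_sets F (\<lambda>f. supp x (v f)) \<longrightarrow> t / 2 * (\<Sum>f\<in>F. q (v f)) \<le> q (\<Sum>f\<in>F. v f))"
proof -
  define n where "n k = anorm A (\<beta> \<odot> k) x" for k
  define q where "q v = (\<Sum>k\<le>K. t ^ k * n k v)" for v
  define B where "B = 1 + (\<Sum>k\<le>K. t ^ k * (C\<^sup>2 / c k))"
  have n0: "0 \<le> n k v" "n k v \<le> C\<^sup>2 / c k * norm v" if "k \<le> K" "v \<in> V" for k v
    using anorm_nonneg[OF A l c] anorm_le[OF A l c] that by (auto simp: n_def)
  have tk: "t ^ k \<ge> 0" for k
    using t by simp
  have "\<exists>N. \<forall>D G. D \<in> schreier A \<beta> \<longrightarrow> (\<forall>d\<in>D. G d \<in> schreier A (\<beta> \<odot> k) \<and> (\<forall>i\<in>G d. N d \<le> i)) \<longrightarrow>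
     succ_sets D G \<longrightarrow> (\<Union>d\<in>D. G d) \<in> schreier A (\<beta> \<odot> k + \<beta>)" for k
    by (rule schreier_add_superset[OF A])
  then obtain N where N: "\<And>k D G. D \<in> schreier A \<beta> \<Longrightarrow> (\<And>d. d\<in>D \<Longrightarrow> G d \<in> schreier A (\<beta> \<odot> k) \<and> (\<forall>i\<in>G d. N k d \<le> i)) \<Longrightarrow>
     succ_sets D G \<Longrightarrow> (\<Union>d\<in>D. G d) \<in> schreier A (\<beta> \<odot> k + \<beta>)"
    by metis
  \<comment> \<open>One bound that is sparse enough for all K steps at once.\<close>
  define M where "M d = (\<Sum>k\<le>K. N k d)" for d
  have M: "N k d \<le> M d" if "k \<le> K" for k d
    using member_le_sum[of k "{..K}" "\<lambda>k. N k d"] that by (auto simp: M_def)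
  have "norm v \<le> q v" if v: "v \<in> V" for v
  proof -
    have "norm v \<le> n 0 v"
      using norm_le_anorm_0[OF A v] by (simp add: n_def)
    also have "\<dots> = t ^ 0 * n 0 v"
      by simp
    also have "\<dots> \<le> q v"
      unfolding q_def using tk n0(1)[OF _ v] by (intro member_le_sum) auto
    finally show ?thesis .
  qed
  moreover have "q v \<le> B * norm v" if v: "v \<in> V" for v
  proof -
    have "q v \<le> (\<Sum>k\<le>K. t ^ k * (C\<^sup>2 / c k * norm v))"
      unfolding q_def using tk n0[OF _ v] by (intro sum_mono mult_left_mono) auto
    also have "\<dots> = (B - 1) * norm v"
      by (simp add: B_def sum_distrib_right mult.assoc)
    also have "\<dots> \<le> B * norm v"
      by (intro mult_right_mono) auto
    finally show ?thesis .
  qed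
  moreover have "B \<ge> 1"
    unfolding B_def using tk c by (auto intro!: sum_nonneg mult_nonneg_nonneg divide_nonneg_pos simp del: times_divide_eq_right)
  moreover have "q (u + v) \<le> q u + q v" if "u \<in> V" "v \<in> V" for u v
  proof -
    have "n k (u + v) \<le> n k u + n k v" if "k \<le> K" for k
      unfolding n_def using anorm_add[OF A l[OF that] c[OF that]] \<open>u \<in> V\<close> \<open>v \<in> V\<close> by blast
    then have "q (u + v) \<le> (\<Sum>k\<le>K. t ^ k * (n k u + n k v))"
      unfolding q_def using tk by (intro sum_mono mult_left_mono) auto
    then show ?thesis
      by (simp add: q_def sum.distrib distrib_left)
  qed
  moreover have "q (a *\<^sub>R v) \<le> \<bar>a\<bar> * q v" if "v \<in> V" for a v
  proof -
    have "n k (a *\<^sub>R v) \<le> \<bar>a\<bar> * n k v" if "k \<le> K" for k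
      unfolding n_def using anorm_scale_le[OF A l[OF that] c[OF that] \<open>v \<in> V\<close>] .
    then have "q (a *\<^sub>R v) \<le> (\<Sum>k\<le>K. t ^ k * (\<bar>a\<bar> * n k v))"
      unfolding q_def using tk by (intro sum_mono mult_left_mono) auto
    then show ?thesis
      by (simp add: q_def sum_distrib_left mult.left_commute)
  qed
  moreover have "t / 2 * (\<Sum>f\<in>F. q (v f)) \<le> q (\<Sum>f\<in>F. v f)"
    if F: "F \<in> schreier A \<beta>" and v: "\<forall>f\<in>F. v f \<in> V \<and> (\<forall>i\<in>supp x (v f). M f \<le> i)"
      and succ: "succ_sets F (\<lambda>f. supp x (v f))" for F v
  proof -
    have vV: "v f \<in> V" if "f \<in> F" for f
      using v that by blast
    have sV: "(\<Sum>f\<in>F. v f) \<in> V"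
      using vV by (rule span_sum)
    have step: "(\<Sum>f\<in>F. n k (v f)) \<le> n (Suc k) (\<Sum>f\<in>F. v f)" if k: "Suc k \<le> K" for k
      unfolding n_def omul.simps
    proof (rule sum_anorm_le[OF A l[of k] l[OF k, unfolded omul.simps] c[of k] c[OF k] N F vV succ])
      show "N k f \<le> i" if "f \<in> F" "i \<in> supp x (v f)" for f i
        using v that M[of k f] k by (meson Suc_leD order_trans)
    qed (use k in auto)
    have half: "1 / 2 * q (v f) \<le> (\<Sum>k<K. t ^ k * n k (v f))" if f: "f \<in> F" for f
    proof -
      have "t ^ K * n K (v f) \<le> t ^ K * (C\<^sup>2 / c K * norm (v f))"
        using n0(2)[OF _ vV[OF f]] tk by (intro mult_left_mono) auto
      also have "\<dots> = (t ^ K * (C\<^sup>2 / c K)) * norm (v f)"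
        by simp
      also have "\<dots> \<le> 1 / 2 * norm (v f)"
        using small by (intro mult_right_mono) auto
      also have "\<dots> \<le> 1 / 2 * q (v f)"
        using \<open>\<And>v. v \<in> V \<Longrightarrow> norm v \<le> q v\<close>[OF vV[OF f]] by simp
      finally have "t ^ K * n K (v f) \<le> 1 / 2 * q (v f)" .
      moreover have "q (v f) = (\<Sum>k<K. t ^ k * n k (v f)) + t ^ K * n K (v f)"
        unfolding q_def by (simp add: lessThan_Suc_atMost[symmetric])
      ultimately show ?thesis
        by linarith
    qed
    have "t / 2 * (\<Sum>f\<in>F. q (v f)) = t * (\<Sum>f\<in>F. 1 / 2 * q (v f))"
      by (simp add: sum_distrib_left)
    also have "\<dots> \<le> t * (\<Sum>f\<in>F. \<Sum>k<K. t ^ k * n k (v f))"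
      using half t by (intro mult_left_mono sum_mono) auto
    also have "\<dots> = (\<Sum>k<K. t ^ Suc k * (\<Sum>f\<in>F. n k (v f)))"
      by (subst sum.swap) (simp add: sum_distrib_left mult.assoc)
    also have "\<dots> \<le> (\<Sum>k<K. t ^ Suc k * n (Suc k) (\<Sum>f\<in>F. v f))"
      using step tk by (intro sum_mono mult_left_mono) (auto simp del: power_Suc)
    also have "\<dots> = (\<Sum>k\<in>{1..K}. t ^ k * n k (\<Sum>f\<in>F. v f))"
      by (rule sum.reindex_bij_witness[of _ "\<lambda>k. k - 1" Suc]) auto
    also have "\<dots> \<le> q (\<Sum>f\<in>F. v f)"
      unfolding q_def using n0(1)[OF _ sV] tk by (intro sum_mono2) auto
    finally show ?thesis .
  qed
  ultimately show ?thesis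
    by blast
qed

end

text \<open>The infimal convolution of \<open>q\<close> and \<open>B\<close> times the norm extends \<open>q\<close> to the whole space.\<close>

lemma ex_norm_extension:
  fixes S :: "'a::real_normed_vector set"
  assumes S: "subspace S" and B: "B \<ge> 1"
    and q: "\<And>v. v \<in> S \<Longrightarrow> norm v \<le> q v" "\<And>v. v \<in> S \<Longrightarrow> q v \<le> B * norm v"
      "\<And>u v. u \<in> S \<Longrightarrow> v \<in> S \<Longrightarrow> q (u + v) \<le> q u + q v"
      "\<And>a v. v \<in> S \<Longrightarrow> q (a *\<^sub>R v) \<le> \<bar>a\<bar> * q v"
  shows "\<exists>p. (\<forall>v. norm v \<le> p v \<and> p v \<le> B * norm v) \<and> (\<forall>u v. p (u + v) \<le> p u + p v) \<and>
    (\<forall>a v. p (a *\<^sub>R v) = \<bar>a\<bar> * p v) \<and> (\<forall>v\<in>S. p v = q v)"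
proof -
  define g where "g v s = q s + B * norm (v - s)" for v s
  define p where "p v = (INF s\<in>S. g v s)" for v
  have S0: "0 \<in> S"
    using S by (rule subspace_0)
  have low: "norm v \<le> g v s" if "s \<in> S" for v s
  proof -
    have "norm v \<le> norm s + norm (v - s)"
      using norm_triangle_ineq[of s "v - s"] by simp
    also have "norm (v - s) \<le> B * norm (v - s)"
      using B mult_right_mono[of 1 B "norm (v - s)"] by simp
    finally show ?thesis
      using q(1)[OF that] by (simp add: g_def)
  qed
  have bdd: "bdd_below (g v ` S)" for v
    using low by (intro bdd_belowI[of _ "norm v"]) auto
  have p_le: "p v \<le> g v s" if "s \<in> S" for v s
    unfolding p_def by (rule cINF_lower[OF bdd that])
  have p_ge: "M \<le> p v" if "\<And>s. s \<in> S \<Longrightarrow> M \<le> g v s" for M v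
    unfolding p_def using S0 that by (intro cINF_greatest) auto
  have q0: "q 0 = 0"
    using q(1,2)[OF S0] by simp
  have 1: "norm v \<le> p v" for v
    by (rule p_ge[OF low])
  have 2: "p v \<le> B * norm v" for v
    using p_le[OF S0, of v] by (simp add: g_def q0)
  have 3: "p (u + v) \<le> p u + p v" for u v
  proof -
    have *: "p (u + v) \<le> g u s + g v s'" if "s \<in> S" "s' \<in> S" for s s'
    proof -
      have "p (u + v) \<le> g (u + v) (s + s')"
        using that S by (intro p_le subspace_add)
      also have "norm (u + v - (s + s')) \<le> norm (u - s) + norm (v - s')"
        using norm_triangle_ineq[of "u - s" "v - s'"] by (simp add: algebra_simps)
      then have "g (u + v) (s + s') \<le> g u s + g v s'"
        unfolding g_def using q(3)[OF that] B mult_left_mono[of "norm (u + v - (s + s'))" "norm (u - s) + norm (v - s')" B]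
        by (simp add: distrib_left)
      finally show ?thesis .
    qed
    have "p (u + v) - g v s' \<le> p u" if "s' \<in> S" for s'
      using *[OF _ that] by (intro p_ge) (simp add: algebra_simps)
    then have "p (u + v) - p u \<le> p v"
      by (intro p_ge) (simp add: algebra_simps)
    then show ?thesis
      by simp
  qed
  have 4: "p (a *\<^sub>R v) \<le> \<bar>a\<bar> * p v" for a v
  proof (cases "a = 0")
    case True
    then show ?thesis
      using 2[of 0] by simp
  next
    case False
    have "p (a *\<^sub>R v) / \<bar>a\<bar> \<le> p v"
    proof (rule p_ge)
      fix s assume s: "s \<in> S"
      have "p (a *\<^sub>R v) \<le> g (a *\<^sub>R v) (a *\<^sub>R s)"
        using s S by (intro p_le subspace_scale)
      also have "norm (a *\<^sub>R v - a *\<^sub>R s) = \<bar>a\<bar> * norm (v - s)"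
        by (simp only: scaleR_diff_right[symmetric] norm_scaleR)
      then have "g (a *\<^sub>R v) (a *\<^sub>R s) \<le> \<bar>a\<bar> * g v s"
        unfolding g_def using q(4)[OF s, of a] by (simp only: distrib_left mult.left_commute add_mono)
      finally show "p (a *\<^sub>R v) / \<bar>a\<bar> \<le> g v s"
        using False by (simp add: field_simps)
    qed
    then show ?thesis
      using False by (simp add: field_simps)
  qed
  have 5: "p (a *\<^sub>R v) = \<bar>a\<bar> * p v" for a v
  proof (cases "a = 0")
    case True
    then show ?thesis
      using 2[of 0] 1[of 0] by simp
  next
    case False
    have "p v = p ((1 / a) *\<^sub>R (a *\<^sub>R v))"
      using False by simp
    also have "\<dots> \<le> \<bar>1 / a\<bar> * p (a *\<^sub>R v)"
      by (rule 4)
    finally have "\<bar>a\<bar> * p v \<le> p (a *\<^sub>R v)"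
      using False by (simp add: field_simps)
    then show ?thesis
      using 4[of a v] by simp
  qed
  have 6: "p v = q v" if v: "v \<in> S" for v
  proof (rule antisym)
    show "p v \<le> q v"
      using p_le[OF v, of v] by (simp add: g_def)
    \<comment> \<open>The bound of q by B times the norm enters here: a splitting of v within S is
      never cheaper than q v itself.\<close>
    show "q v \<le> p v"
    proof (rule p_ge)
      fix s assume s: "s \<in> S"
      have "q v \<le> q s + q (v - s)"
        using q(3)[OF s subspace_diff[OF S v s]] by simp
      also have "q (v - s) \<le> B * norm (v - s)"
        using q(2)[OF subspace_diff[OF S v s]] .
      finally show "q v \<le> g v s"
        by (simp add: g_def)
    qed
  qed
  show ?thesis
    by (intro exI[of _ p]) (simp add: 1 2 3 5 6)
qed

section \<open>The stabilized constants\<close>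

text \<open>Fekete's argument: the limit is the supremum of the roots. If the root at k0 is nearly
  \<theta>, then writing k as a multiple of k0 plus a remainder bounds a k from below by the k-th
  power of that root times a constant c, whose k-th root tends to 1.\<close>

lemma supermultiplicative_root_convergent:
  fixes a :: "nat \<Rightarrow> real"
  assumes pos: "\<And>k. k \<ge> 1 \<Longrightarrow> 0 < a k" and le: "\<And>k. k \<ge> 1 \<Longrightarrow> a k \<le> 1"
    and sm: "\<And>j k. j \<ge> 1 \<Longrightarrow> k \<ge> 1 \<Longrightarrow> a j * a k \<le> a (j + k)"
  shows "\<exists>\<theta>>0. (\<lambda>k. root k (a k)) \<longlonglongrightarrow> \<theta>"
proof -
  define R where "R = (\<lambda>k. root k (a k)) ` {1..}"
  have bdd: "bdd_above R"
    unfolding R_def using le by (intro bdd_aboveI[of _ 1]) auto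
  have mem: "root k (a k) \<in> R" if "k \<ge> 1" for k
    using that by (auto simp: R_def)
  define \<theta> where "\<theta> = Sup R"
  have up: "root k (a k) \<le> \<theta>" if "k \<ge> 1" for k
    unfolding \<theta>_def by (rule cSup_upper[OF mem[OF that] bdd])
  have "\<theta> > 0"
    using up[of 1] pos[of 1] by (simp add: One_nat_def)
  moreover have "(\<lambda>k. root k (a k)) \<longlonglongrightarrow> \<theta>"
  proof (rule LIMSEQ_I)
    fix e :: real assume e: "e > 0"
    \<comment> \<open>The entry \<theta> / 2 keeps r positive, so that powers of \<rho> can be
      compared.\<close>
    define r where "r = max (\<theta> / 2) (\<theta> - e / 2)"
    have "r < \<theta>" "r > 0"
      using e \<open>\<theta> > 0\<close> by (auto simp: r_def max_def)
    then obtain k0 where k0: "k0 \<ge> 1" "r < root k0 (a k0)"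
      using less_cSup_iff[OF _ bdd, of r] mem[of 1] by (auto simp: \<theta>_def R_def)
    define \<rho> where "\<rho> = root k0 (a k0)"
    have \<rho>: "r < \<rho>" "\<rho> \<le> 1" "\<rho> ^ k0 = a k0"
      using k0 le[of k0] pos[of k0] by (auto simp: \<rho>_def)
    have pw: "a 1 ^ j \<le> a j" if "j \<ge> 1" for j
      using that
    proof (induction j rule: dec_induct)
      case (step j)
      have "a 1 ^ Suc j = a 1 ^ j * a 1"
        by simp
      also have "\<dots> \<le> a j * a 1"
        using step pos[of 1] by (intro mult_right_mono) auto
      also have "\<dots> \<le> a (Suc j)"
        using sm[of j 1] step by (simp add: Suc_eq_plus1)
      finally show ?case .
    qed simp
    have a1: "0 < a 1" "a 1 \<le> 1"
      using pos[of 1] le[of 1] by auto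
    define c where "c = a 1 ^ k0"
    have c: "c > 0"
      using a1 by (simp add: c_def)
    have base: "c \<le> a j" if "1 \<le> j" "j \<le> k0" for j
      unfolding c_def using pw[OF that(1)] power_decreasing[OF that(2), of "a 1"] a1 by simp
    have low: "\<rho> ^ (k0 * q) * c \<le> a (k0 * q + j)" if "1 \<le> j" "j \<le> k0" for q j
    proof (induction q)
      case 0
      then show ?case
        using base[OF that] by simp
    next
      case (Suc q)
      have "\<rho> ^ (k0 * Suc q) * c = a k0 * (\<rho> ^ (k0 * q) * c)"
        by (simp add: power_add \<rho>(3) mult.assoc)
      also have "\<dots> \<le> a k0 * a (k0 * q + j)"
        using Suc pos[OF k0(1)] by (intro mult_left_mono) auto
      also have "\<dots> \<le> a (k0 * Suc q + j)"
        using sm[of k0 "k0 * q + j"] k0(1) that(1) by (simp add: add.assoc)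
      finally show ?case .
    qed
    have low': "\<rho> ^ k * c \<le> a k" if k: "k \<ge> 1" for k
    proof -
      define q where "q = (k - 1) div k0"
      \<comment> \<open>The remainder runs from 1 to k0 instead of from 0, since nothing is assumed
        about \<open>a 0\<close>.\<close>
      define j where "j = (k - 1) mod k0 + 1"
      have kq: "k = k0 * q + j"
        using k by (simp add: q_def j_def)
      have "(k - 1) mod k0 < k0"
        using k0(1) by (intro mod_less_divisor) linarith
      then have j: "1 \<le> j" "j \<le> k0"
        unfolding j_def by linarith+
      have "\<rho> ^ k \<le> \<rho> ^ (k0 * q)"
        using \<rho> \<open>r > 0\<close> kq by (intro power_decreasing) auto
      then have "\<rho> ^ k * c \<le> \<rho> ^ (k0 * q) * c"
        using c by (intro mult_right_mono) auto
      also have "\<dots> \<le> a k"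
        using low[OF j] kq by simp
      finally show ?thesis .
    qed
    have rt: "\<rho> * root k c \<le> root k (a k)" if k: "k \<ge> 1" for k
    proof -
      have "root k (\<rho> ^ k * c) \<le> root k (a k)"
        using k low'[OF k] by simp
      moreover have "root k (\<rho> ^ k * c) = \<rho> * root k c"
        using k \<rho> \<open>r > 0\<close> by (simp add: real_root_mult real_root_power_cancel)
      ultimately show ?thesis
        by simp
    qed
    have "(\<lambda>k. \<rho> * root k c) \<longlonglongrightarrow> \<rho> * 1"
      using LIMSEQ_root_const[OF c] by (intro tendsto_intros)
    then have "eventually (\<lambda>k. \<rho> * root k c > r) sequentially"
      using \<rho>(1) by (intro order_tendstoD) auto
    then obtain K where K: "\<And>k. k \<ge> K \<Longrightarrow> \<rho> * root k c > r"
      by (auto simp: eventually_sequentially)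
    show "\<exists>n0. \<forall>n\<ge>n0. norm (root n (a n) - \<theta>) < e"
    proof (intro exI[of _ "max K 1"] allI impI)
      fix n assume "max K 1 \<le> n"
      then have "r < root n (a n)" "root n (a n) \<le> \<theta>"
        using K[of n] rt[of n] up[of n] by auto
      then show "norm (root n (a n) - \<theta>) < e"
        using e by (auto simp: r_def)
    qed
  qed
  ultimately show ?thesis
    by blast
qed

section \<open>Tails of block sequences and stabilization\<close>

lemma tail_seq_image: "m \<ge> 1 \<Longrightarrow> tail_seq m y ` {k..} = y ` {k + m - 1..}"
proof -
  assume m: "m \<ge> 1"
  have "(\<lambda>i. i + m - 1) ` {k..} = {k + m - 1..}"
  proof
    show "{k + m - 1..} \<subseteq> (\<lambda>i. i + m - 1) ` {k..}"
    proof
      fix j assume "j \<in> {k + m - 1..}"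
      then show "j \<in> (\<lambda>i. i + m - 1) ` {k..}"
        using m by (intro image_eqI[of _ _ "j + 1 - m"]) auto
    qed
  qed auto
  moreover have "tail_seq m y ` {k..} = y ` (\<lambda>i. i + m - 1) ` {k..}"
    by (simp add: tail_seq_def image_image)
  ultimately show ?thesis
    by simp
qed

lemma block_seq_tail:
  assumes "lin_seq y" "m \<ge> 1"
  shows "block_seq y {1..} (tail_seq m y)"
proof -
  have "tail_seq m y = (\<lambda>i. y (i + m - 1))"
    by (simp add: tail_seq_def fun_eq_iff)
  then show ?thesis
    using block_seq_subseq(1)[OF assms(1), of "\<lambda>i. i + m - 1"] assms(2) by (simp add: strict_mono_on_def less_diff_conv)
qed

lemma block_seq_tail_of_block:
  assumes "block_seq e {1..} y" "m \<ge> 1"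
  shows "block_seq e {1..} (tail_seq m y)"
  using assms by (auto simp: block_seq_def tail_seq_def)

text \<open>The asymptotic estimate is applied to two vectors, the head and the tail of v, so the
  supports must start at 2 or later; dropping the first term of y achieves this. The maximum with 1
  covers the case that one of the two vanishes.\<close>

lemma asymptotic_l1_tail_bounded:
  fixes e y :: "nat \<Rightarrow> 'a::real_normed_vector"
  assumes e: "asymptotic_l1 e" and y: "block_seq e {1..} y"
  shows "\<exists>C. \<forall>m\<ge>2. tail_bounded (tail_seq m y) C"
proof -
  have le: "lin_seq e"
    using e by (simp add: asymptotic_l1_def schauder_basis_def basic_sequence_lin_seq)
  interpret e: lin_seq e by fact
  obtain C where C: "C > 0" "\<And>n x. n \<ge> 1 \<Longrightarrow> block_seq e {1..n} x \<Longrightarrow> n \<le> Min (supp e (x 1)) \<Longrightarrow>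
        norm (\<Sum>i=1..n. x i) \<ge> (1 / C) * (\<Sum>i=1..n. norm (x i))"
    using e unfolding asymptotic_l1_def by metis
  have "tail_bounded (tail_seq m y) (max C 1)" if m: "m \<ge> 2" for m
  proof -
    define z where "z = tail_seq m y"
    have bz: "block_seq e {1..} z"
      unfolding z_def using block_seq_tail_of_block[OF y] m by simp
    have lz: "lin_seq z"
      by (rule block_seq_lin_seq[OF le bz])
    interpret lin_seq z by fact
    have ge2: "2 \<le> j" if "i \<ge> 1" "j \<in> supp e (z i)" for i j
    proof -
      have "y 1 \<in> e.V" "y 1 \<noteq> 0"
        using y by (auto simp: block_seq_def)
      then obtain k where k: "k \<in> supp e (y 1)"
        using e.supp_empty_iff by blast
      have "k < j"
        using succ_setsD[OF block_seq_succ_sets[OF le y], of 1 "i + m - 1" k j] k that m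
        by (auto simp: z_def tail_seq_def)
      moreover have "k \<ge> 1"
        using k by (simp add: supp_def)
      ultimately show ?thesis by simp
    qed
    have "norm (proj z {..<n} v) + norm (proj z {n..} v) \<le> max C 1 * norm v" if v: "v \<in> V" for n v
    proof -
      define a where "a = proj z {..<n} v"
      define b where "b = proj z {n..} v"
      have ab: "a \<in> V" "b \<in> V"
        by (auto simp: a_def b_def proj_in)
      have sum: "a + b = v"
        by (rule coef_ext) (auto simp: ab v span_add coef_add a_def b_def proj_in coef_proj)
      have abe: "a \<in> e.V" "b \<in> e.V"
        using ab block_seq_span[OF le bz] by auto
      show ?thesis
      proof (cases "a = 0 \<or> b = 0")
        case True
        then have "norm a + norm b = norm v"
          using sum by auto
        also have "\<dots> \<le> max C 1 * norm v"
          using mult_right_mono[of 1 "max C 1" "norm v"] by simp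
        finally show ?thesis
          by (simp add: a_def b_def)
      next
        case False
        define x where "x i = (if i = 1 then a else b)" for i :: nat
        have se: "supp e a = (\<Union>i\<in>supp z a. supp e (z i))" "supp e b = (\<Union>i\<in>supp z b. supp e (z i))"
          using supp_block_seq[OF le bz] ab by auto
        have sz: "supp z a \<subseteq> {1..<n}" "supp z b \<subseteq> {n..} \<inter> {1..}"
          using supp_pos[of z v] by (auto simp: a_def b_def supp_proj)
        have lt: "i < j" if ij: "i \<in> supp e a" "j \<in> supp e b" for i j
        proof -
          obtain k l where kl: "k \<in> supp z a" "l \<in> supp z b" "i \<in> supp e (z k)" "j \<in> supp e (z l)"
            using ij unfolding se by blast
          have "1 \<le> k" "k < n" "n \<le> l" "1 \<le> l"
            using sz kl(1,2) by auto
          then show ?thesis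
            by (intro succ_setsD[OF block_seq_succ_sets[OF le bz] _ _ _ kl(3,4)]) auto
        qed
        have 12: "{1..2::nat} = {1, 2}"
          by auto
        have "block_seq e {1..2} x"
        proof (rule block_seqI[OF le])
          show "succ_sets {1..2} (\<lambda>i. supp e (x i))"
            unfolding 12 by (rule succ_setsI) (use lt in \<open>auto simp: x_def\<close>)
        qed (use False abe in \<open>auto simp: x_def\<close>)
        moreover have "2 \<le> Min (supp e (x 1))"
        proof -
          have "Min (supp e a) \<in> supp e a"
            using e.supp_empty_iff[OF abe(1)] e.finite_supp False by (intro Min_in) auto
          then obtain k where "k \<in> supp z a" "Min (supp e a) \<in> supp e (z k)"
            unfolding se(1) by blast
          moreover from this have "1 \<le> k"
            using sz(1) by auto
          ultimately show ?thesis
            using ge2 by (simp add: x_def)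
        qed
        ultimately have "(1 / C) * (\<Sum>i=1..2. norm (x i)) \<le> norm (\<Sum>i=1..2. x i)"
          by (intro C(2)) auto
        then have "(1 / C) * (norm a + norm b) \<le> norm v"
          unfolding 12 using sum by (simp add: x_def)
        then have "norm a + norm b \<le> C * norm v"
          using C(1) by (simp add: field_simps)
        also have "\<dots> \<le> max C 1 * norm v"
          by (intro mult_right_mono) auto
        finally show ?thesis
          by (simp add: a_def b_def)
      qed
    qed
    then show ?thesis
      unfolding z_def[symmetric] by unfold_locales auto
  qed
  then show ?thesis
    by blast
qed

text \<open>The threshold from which stabilization sets in depends on the ordinal, so a common tail
  is chosen for finitely many of them. The bound m \<ge> 2 is the one under which restrictions are
  bounded on that tail.\<close>

lemma Delta_stabilizes_uniform:
  assumes "Delta_stabilizes A y \<gamma>" "finite S" "\<eta> > 0"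
  shows "\<exists>m\<ge>2. \<forall>\<alpha>\<in>S. \<forall>w. block_seq (tail_seq m y) {1..} w \<longrightarrow> \<bar>delta A \<alpha> w - \<gamma> \<alpha>\<bar> < \<eta>"
proof -
  obtain \<epsilon> :: "nat \<Rightarrow> real" where \<epsilon>: "\<epsilon> \<longlonglongrightarrow> 0"
    and st: "\<And>\<alpha>. \<exists>m\<ge>1. \<forall>n\<ge>m. \<forall>w. block_seq (tail_seq n y) {1..} w \<longrightarrow> \<bar>delta A \<alpha> w - \<gamma> \<alpha>\<bar> < \<epsilon> n"
    using assms(1) unfolding Delta_stabilizes_def by blast
  obtain M where M: "\<And>\<alpha> n w. n \<ge> M \<alpha> \<Longrightarrow> block_seq (tail_seq n y) {1..} w \<Longrightarrow> \<bar>delta A \<alpha> w - \<gamma> \<alpha>\<bar> < \<epsilon> n"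
    using st by metis
  obtain K where K: "\<And>n. n \<ge> K \<Longrightarrow> \<epsilon> n < \<eta>"
    using order_tendstoD(2)[OF \<epsilon> assms(3)] by (auto simp: eventually_sequentially)
  define m where "m = 2 + K + (\<Sum>\<alpha>\<in>S. M \<alpha>)"
  have "M \<alpha> \<le> m" if "\<alpha> \<in> S" for \<alpha>
    using member_le_sum[of \<alpha> S M] that assms(2) by (simp add: m_def)
  moreover have "K \<le> m" "2 \<le> m"
    by (auto simp: m_def)
  ultimately show ?thesis
    using M K by (intro exI[of _ m]) (meson order_less_trans)
qed

text \<open>Far out, \<open>delta\<close> on a tail is close to \<gamma>. For the product, the
  sparse subsequence of \<open>lower_est_mult\<close> is again a block sequence of that tail, so its
  \<open>delta\<close> at \<beta> + \<alpha> is close to \<gamma> as well.\<close>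

lemma
  assumes A: "ladder_system A" and y: "Delta_stabilizes A y \<gamma>"
  shows stabilized_le_1: "\<gamma> \<alpha> \<le> 1"
    and stabilized_supermult: "\<gamma> \<alpha> * \<gamma> \<beta> \<le> \<gamma> (\<beta> + \<alpha>)"
proof -
  have ly: "lin_seq y"
    using y by (simp add: Delta_stabilizes_def basic_sequence_lin_seq)
  have tail: "lin_seq (tail_seq m y)" if "m \<ge> 2" for m
    using block_seq_lin_seq[OF ly block_seq_tail[OF ly, of m]] that by simp
  have approx: "\<exists>d. 0 \<le> d \<and> d \<le> 1 \<and> \<bar>d - \<gamma> \<alpha>\<bar> < \<eta>" if \<eta>: "\<eta> > 0" for \<eta> \<alpha>
  proof -
    obtain m where m: "m \<ge> 2" "\<forall>w. block_seq (tail_seq m y) {1..} w \<longrightarrow> \<bar>delta A \<alpha> w - \<gamma> \<alpha>\<bar> < \<eta>"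
      using Delta_stabilizes_uniform[OF y, of "{\<alpha>}" \<eta>] \<eta> by auto
    then show ?thesis
      using block_seq_refl[OF tail[OF m(1)]] delta_nonneg[OF A tail[OF m(1)]] delta_le_1[OF A tail[OF m(1)]] by blast
  qed
  have nn: "0 \<le> \<gamma> \<alpha>" for \<alpha>
    by (rule field_le_epsilon) (use approx[of _ \<alpha>] in force)
  show le1: "\<gamma> \<alpha> \<le> 1" for \<alpha>
    by (rule field_le_epsilon) (use approx[of _ \<alpha>] in force)
  show "\<gamma> \<alpha> * \<gamma> \<beta> \<le> \<gamma> (\<beta> + \<alpha>)"
  proof (rule field_le_epsilon)
    fix e :: real assume e: "e > 0"
    \<comment> \<open>Replacing both factors costs at most 3 \<eta>, as all quantities are at most
      1, and the right-hand side costs one more \<eta>.\<close>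
    define \<eta> where "\<eta> = min 1 (e / 4)"
    have \<eta>: "0 < \<eta>" "\<eta> \<le> 1" "4 * \<eta> \<le> e"
      using e by (auto simp: \<eta>_def)
    obtain m where m: "m \<ge> 2" "\<And>\<nu> w. \<nu> \<in> {\<alpha>, \<beta>, \<beta> + \<alpha>} \<Longrightarrow> block_seq (tail_seq m y) {1..} w \<Longrightarrow> \<bar>delta A \<nu> w - \<gamma> \<nu>\<bar> < \<eta>"
      using Delta_stabilizes_uniform[OF y, of "{\<alpha>, \<beta>, \<beta> + \<alpha>}" \<eta>] \<eta>(1) by blast
    define z where "z = tail_seq m y"
    have lz: "lin_seq z"
      unfolding z_def by (rule tail[OF m(1)])
    define d where "d \<nu> = delta A \<nu> z" for \<nu>
    have d: "0 \<le> d \<nu>" "d \<nu> \<le> 1" for \<nu>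
      using delta_nonneg[OF A lz] delta_le_1[OF A lz] by (auto simp: d_def)
    obtain w where w: "block_seq z {1..} w" "lower_est A (\<beta> + \<alpha>) w (d \<alpha> * d \<beta>)"
      using lower_est_mult[OF A lz lower_est_delta[OF A lz] lower_est_delta[OF A lz]] d unfolding d_def by blast
    have "d \<alpha> * d \<beta> \<le> delta A (\<beta> + \<alpha>) w"
      using d by (intro lower_est_le_delta[OF A block_seq_lin_seq[OF lz w(1)] _ w(2)]) auto
    also have "\<dots> \<le> \<gamma> (\<beta> + \<alpha>) + \<eta>"
      using m(2)[of "\<beta> + \<alpha>" w] w(1) by (auto simp: z_def)
    finally have *: "d \<alpha> * d \<beta> \<le> \<gamma> (\<beta> + \<alpha>) + \<eta>" .
    have close: "\<gamma> \<nu> \<le> d \<nu> + \<eta>" if "\<nu> \<in> {\<alpha>, \<beta>}" for \<nu>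
      using m(2)[of \<nu> z] block_seq_refl[OF lz] that by (auto simp: z_def d_def)
    have "\<gamma> \<alpha> * \<gamma> \<beta> \<le> (d \<alpha> + \<eta>) * (d \<beta> + \<eta>)"
      using close nn d \<eta> by (intro mult_mono) auto
    also have "\<dots> = d \<alpha> * d \<beta> + \<eta> * (d \<alpha> + d \<beta> + \<eta>)"
      by (simp add: algebra_simps)
    also have "\<eta> * (d \<alpha> + d \<beta> + \<eta>) \<le> \<eta> * 3"
      using d(2)[of \<alpha>] d(2)[of \<beta>] \<eta> by (intro mult_left_mono) auto
    finally show "\<gamma> \<alpha> * \<gamma> \<beta> \<le> \<gamma> (\<beta> + \<alpha>) + e"
      using * \<eta> by simp
  qed
qed

section \<open>Block sequences close to a subspace\<close>

text \<open>Each functional lowers the dimension by at most one: modulo a fixed vector on which it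
  does not vanish, every vector lies in its kernel.\<close>

lemma infinite_dim_common_kernel:
  fixes f :: "nat \<Rightarrow> 'a::real_vector \<Rightarrow> real"
  assumes W: "subspace W" "\<not> (\<exists>B. finite B \<and> W \<subseteq> span B)"
    and f: "\<And>i u v. u \<in> W \<Longrightarrow> v \<in> W \<Longrightarrow> f i (u + v) = f i u + f i v" "\<And>i c v. v \<in> W \<Longrightarrow> f i (c *\<^sub>R v) = c * f i v"
  shows "\<exists>u\<in>W. u \<noteq> 0 \<and> (\<forall>i<n. f i u = 0)"
proof -
  define K where "K n = {u\<in>W. \<forall>i<n. f i u = 0}" for n
  have "\<not> (\<exists>B. finite B \<and> K n \<subseteq> span B)" for n
  proof (induction n)
    case 0
    then show ?case
      using W(2) by (simp add: K_def)
  next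
    case (Suc n)
    show ?case
    proof
      assume "\<exists>B. finite B \<and> K (Suc n) \<subseteq> span B"
      then obtain B where B: "finite B" "K (Suc n) \<subseteq> span B"
        by blast
      show False
      proof (cases "\<exists>u0\<in>K n. f n u0 \<noteq> 0")
        case False
        then have "K n \<subseteq> K (Suc n)"
          by (auto simp: K_def less_Suc_eq)
        then show False
          using B Suc by blast
      next
        case True
        then obtain u0 where u0: "u0 \<in> K n" "f n u0 \<noteq> 0"
          by blast
        have "K n \<subseteq> span (insert u0 B)"
        proof
          fix v assume v: "v \<in> K n"
          define c where "c = f n v / f n u0"
          have vW: "v \<in> W" "u0 \<in> W" "(- c) *\<^sub>R u0 \<in> W"
            using v u0 W(1) by (auto simp: K_def intro: subspace_scale simp del: scaleR_minus_left)
          have "f i (v + (- c) *\<^sub>R u0) = f i v - c * f i u0" for i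
            unfolding f(1)[OF vW(1,3)] f(2)[OF vW(2)] by simp
          then have "v + (- c) *\<^sub>R u0 \<in> K (Suc n)"
            using v u0 vW W(1) by (auto simp: K_def less_Suc_eq c_def simp del: add_uminus_conv_diff scaleR_minus_left intro: subspace_add)
          then have "v + (- c) *\<^sub>R u0 \<in> span (insert u0 B)"
            using B(2) span_mono[of B "insert u0 B"] by blast
          then have "(v + (- c) *\<^sub>R u0) + c *\<^sub>R u0 \<in> span (insert u0 B)"
            by (rule span_add) (simp add: span_base span_scale)
          moreover have "(v + (- c) *\<^sub>R u0) + c *\<^sub>R u0 = v"
            by simp
          ultimately show "v \<in> span (insert u0 B)"
            by metis
        qed
        then show False
          using Suc B(1) by blast
      qed
    qed
  qed
  then have "\<not> K n \<subseteq> span {}"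
    by blast
  then show ?thesis
    by (auto simp: K_def)
qed

text \<open>By uniqueness of expansions the coefficients are linear on W, so some nonzero u in W has
  its first M coefficients equal to 0. A long partial sum of its expansion is the required
  w.\<close>

lemma infinite_dim_subspace_near_tail:
  fixes y :: "nat \<Rightarrow> 'a::real_normed_vector"
  assumes y: "basic_sequence y" and W: "inf_dim_closed_subspace W" "W \<subseteq> closed_span y" and \<eta>: "\<eta> > 0"
  shows "\<exists>u\<in>W. \<exists>w\<in>span (y ` {M..}). w \<noteq> 0 \<and> norm (w - u) \<le> \<eta> * norm w"
proof -
  define P where "P v a \<longleftrightarrow> (\<lambda>i. a i *\<^sub>R y (Suc i)) sums v" for v a
  define a where "a v = (THE a. P v a)" for v
  have ex1: "\<exists>!a. P v a" if "v \<in> W" for v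
    using y W(2) that by (auto simp: basic_sequence_def P_def)
  have aP: "P v (a v)" if "v \<in> W" for v
    unfolding a_def by (rule theI'[OF ex1[OF that]])
  have aI: "a v = b" if "v \<in> W" "P v b" for v b
    using ex1[OF that(1)] aP[OF that(1)] that(2) by blast
  have sW: "subspace W" "\<not> (\<exists>B. finite B \<and> W \<subseteq> span B)"
    using W(1) by (auto simp: inf_dim_closed_subspace_def)
  have add: "a (u + v) = (\<lambda>i. a u i + a v i)" if "u \<in> W" "v \<in> W" for u v
  proof (rule aI)
    show "u + v \<in> W"
      using that sW(1) by (simp add: subspace_add)
    show "P (u + v) (\<lambda>i. a u i + a v i)"
      using sums_add[OF aP[OF that(1), unfolded P_def] aP[OF that(2), unfolded P_def]]
      by (simp add: P_def scaleR_add_left)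
  qed
  have scale: "a (c *\<^sub>R v) = (\<lambda>i. c * a v i)" if "v \<in> W" for c v
  proof (rule aI)
    show "c *\<^sub>R v \<in> W"
      using that sW(1) by (simp add: subspace_scale)
    show "P (c *\<^sub>R v) (\<lambda>i. c * a v i)"
      using sums_scaleR_right[OF aP[OF that, unfolded P_def], of c] by (simp add: P_def)
  qed
  obtain u where u: "u \<in> W" "u \<noteq> 0" "\<And>i. i < M \<Longrightarrow> a u i = 0"
    using infinite_dim_common_kernel[OF sW, of "\<lambda>i v. a v i" M] add scale by auto
  define T where "T j = (\<Sum>i<j. a u i *\<^sub>R y (Suc i))" for j
  have T: "T \<longlonglongrightarrow> u"
    using aP[OF u(1)] by (simp add: P_def sums_def T_def[abs_def])
  \<comment> \<open>The first entry keeps the partial sum at more than half the norm of u; this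
    turns the second one into an error relative to the partial sum.\<close>
  define e where "e = min (norm u / 2) (\<eta> * norm u / 2)"
  have "e > 0"
    using u(2) \<eta> by (simp add: e_def)
  then obtain j where j: "norm (T j - u) < e"
    using LIMSEQ_D[OF T] by blast
  have "norm u \<le> norm (T j) + norm (T j - u)"
    using norm_triangle_ineq4[of "T j" "T j - u"] by simp
  then have half: "norm u / 2 < norm (T j)"
    using j by (auto simp: e_def)
  have "norm (T j - u) \<le> \<eta> * (norm u / 2)"
    using j by (auto simp: e_def)
  also have "\<dots> \<le> \<eta> * norm (T j)"
    using half \<eta> by (intro mult_left_mono) auto
  finally have "norm (T j - u) \<le> \<eta> * norm (T j)" .
  moreover have "T j \<in> span (y ` {M..})"
    unfolding T_def
  proof (rule span_sum)
    \<comment> \<open>The coefficient with number i belongs to \<open>y (Suc i)\<close>, so the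
      surviving terms have index above M.\<close>
    show "a u i *\<^sub>R y (Suc i) \<in> span (y ` {M..})" for i
      using u(3)[of i] by (cases "i < M") (auto intro!: span_scale[OF span_base] span_zero)
  qed
  moreover have "T j \<noteq> 0"
    using half u(2) by auto
  ultimately show ?thesis
    using u(1) by blast
qed

lemma (in lin_seq) supp_span_subset:
  assumes "E \<subseteq> {1..}" "v \<in> span (x ` E)"
  shows "v \<in> V" "supp x v \<subseteq> E"
proof -
  have "subspace {v\<in>V. supp x v \<subseteq> E}"
    by (rule subspaceI) (auto simp: span_zero span_add span_scale supp_eq_coef coef_zero coef_add coef_scale subset_iff, force)
  moreover have "x ` E \<subseteq> {v\<in>V. supp x v \<subseteq> E}"
    using assms(1) by (auto simp: basis_in subset_iff supp_eq_coef coef_basis split: if_splits)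
  ultimately have "span (x ` E) \<subseteq> {v\<in>V. supp x v \<subseteq> E}"
    by (intro span_minimal)
  then show "v \<in> V" "supp x v \<subseteq> E"
    using assms(2) by auto
qed

text \<open>A gliding hump: a state consists of a block, its partner in W and a right bound L of the
  support, and the next block is found beyond L and beyond the prescribed \<open>N i\<close>. The
  errors decrease geometrically so that they can be summed.\<close>

lemma block_seq_near_subspace:
  fixes y :: "nat \<Rightarrow> 'a::real_normed_vector"
  assumes y: "basic_sequence y" and W: "inf_dim_closed_subspace W" "W \<subseteq> closed_span y" and \<eta>: "\<eta> > 0"
    and m: "m \<ge> 1"
  shows "\<exists>w u. block_seq (tail_seq m y) {1..} w \<and> (\<forall>i\<ge>1. u i \<in> W \<and> norm (w i - u i) \<le> \<eta> / 2 ^ i * norm (w i)) \<and>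
    (\<forall>i\<ge>1. \<forall>k\<in>supp (tail_seq m y) (w i). N i \<le> k)"
proof -
  define z where "z = tail_seq m y"
  have ly: "lin_seq y"
    by (rule basic_sequence_lin_seq[OF y])
  have lz: "lin_seq z"
    unfolding z_def by (rule block_seq_lin_seq[OF ly block_seq_tail[OF ly m]])
  interpret lin_seq z by fact
  define P where "P i p \<longleftrightarrow> (case p of (w, u, L) \<Rightarrow> u \<in> W \<and> w \<in> V \<and> w \<noteq> 0 \<and> supp z w \<subseteq> {N i..<L} \<and>
    norm (w - u) \<le> \<eta> / 2 ^ i * norm w)" for i and p :: "'a \<times> 'a \<times> nat"
  define Q where "Q p p' \<longleftrightarrow> (case (p, p') of ((w, u, L), (w', u', L')) \<Rightarrow> L \<le> L' \<and> supp z w' \<subseteq> {L..})"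
    for p p' :: "'a \<times> 'a \<times> nat"
  have ex: "\<exists>p. P i p \<and> Q q p" for i q
  proof -
    obtain w0 u0 L where q: "q = (w0, u0, L)"
      by (cases q)
    define L1 where "L1 = max (max (N i) L) 1"
    \<comment> \<open>\<open>L1 + m - 1\<close> is the position \<open>L1\<close> of the tail in the
      numbering of y.\<close>
    obtain u w where w: "u \<in> W" "w \<in> span (y ` {L1 + m - 1..})" "w \<noteq> 0" "norm (w - u) \<le> \<eta> / 2 ^ i * norm w"
      using infinite_dim_subspace_near_tail[OF y W, of "\<eta> / 2 ^ i" "L1 + m - 1"] \<eta> by auto
    have "w \<in> span (z ` {L1..})"
      using w(2) unfolding z_def tail_seq_image[OF m] by simp
    moreover have "{L1..} \<subseteq> {1..}"
      by (auto simp: L1_def)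
    ultimately have wV: "w \<in> V" "supp z w \<subseteq> {L1..}"
      using supp_span_subset by blast+
    obtain L' where L': "supp z w \<subseteq> {..<L'}"
      using finite_supp[of w] finite_nat_iff_bounded by blast
    have "supp z w \<subseteq> {L1..} \<inter> {..<L'}"
      using wV(2) L' by (rule Int_greatest)
    also have "\<dots> \<subseteq> {N i..<max L L'}"
      by (auto simp: L1_def)
    finally have "supp z w \<subseteq> {N i..<max L L'}" .
    moreover have "supp z w \<subseteq> {L..}"
      using order_trans[OF wV(2), of "{L..}"] by (simp add: L1_def)
    ultimately have "P i (w, u, max L L') \<and> Q q (w, u, max L L')"
      using w wV(1) by (simp add: P_def Q_def q)
    then show ?thesis by blast
  qed
  obtain p where p: "\<And>i. P i (p i)" "\<And>i. Q (p i) (p (Suc i))"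
    using dependent_nat_choice[of P "\<lambda>_. Q"] ex by metis
  define w where "w i = fst (p i)" for i
  define u where "u i = fst (snd (p i))" for i
  define L where "L i = snd (snd (p i))" for i
  have pe: "p i = (w i, u i, L i)" for i
    by (simp add: w_def u_def L_def)
  have w: "u i \<in> W" "w i \<in> V" "w i \<noteq> 0" "supp z (w i) \<subseteq> {N i..<L i}" "norm (w i - u i) \<le> \<eta> / 2 ^ i * norm (w i)" for i
    using p(1)[of i] by (simp_all add: P_def pe)
  have L: "L i \<le> L (Suc i)" "supp z (w (Suc i)) \<subseteq> {L i..}" for i
    using p(2)[of i] by (simp_all add: Q_def pe)
  have "block_seq z {1..} w"
  proof (rule block_seqI[OF lz])
    show "succ_sets {1..} (\<lambda>i. supp z (w i))"
    proof (rule succ_setsI)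
      fix i j a b assume ij: "i < (j::nat)" "a \<in> supp z (w i)" "b \<in> supp z (w j)"
      obtain k where k: "j = Suc k" "i \<le> k"
        using ij(1) by (cases j) auto
      have "a < L i"
        using w(4) ij(2) by force
      also have "L i \<le> L k"
        using lift_Suc_mono_le[of L, OF L(1) k(2)] .
      also have "L k \<le> b"
        using L(2) ij(3) k(1) by force
      finally show "a < b" .
    qed
  qed (use w in auto)
  moreover have "N i \<le> k" if "k \<in> supp z (w i)" for i k
    using w(4)[of i] that by auto
  ultimately show ?thesis
    using w(1,5) unfolding z_def by blast
qed

section \<open>Closed spans and perturbation of block sequences\<close>

lemma closure_add:
  fixes S :: "'a::real_normed_vector set"
  assumes "subspace S" "u \<in> closure S" "v \<in> closure S"
  shows "u + v \<in> closure S"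
proof -
  obtain f g where "\<And>n. f n \<in> S" "f \<longlonglongrightarrow> u" "\<And>n. g n \<in> S" "g \<longlonglongrightarrow> v"
    using assms(2,3) unfolding closure_sequential by blast
  then show ?thesis
    unfolding closure_sequential
    by (intro exI[of _ "\<lambda>n. f n + g n"]) (auto intro: tendsto_add subspace_add[OF assms(1)])
qed

lemma closure_scale:
  fixes S :: "'a::real_normed_vector set"
  assumes "subspace S" "v \<in> closure S"
  shows "c *\<^sub>R v \<in> closure S"
proof -
  obtain g where "\<And>n. g n \<in> S" "g \<longlonglongrightarrow> v"
    using assms(2) unfolding closure_sequential by blast
  then show ?thesis
    unfolding closure_sequential
    by (intro exI[of _ "\<lambda>n. c *\<^sub>R g n"]) (auto intro: tendsto_scaleR subspace_scale[OF assms(1)])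
qed

text \<open>The closed span is itself the subspace that will be distorted; it also shows that the
  infimum in \<open>distortion\<close> runs over a nonempty family.\<close>

lemma inf_dim_closed_span:
  assumes "lin_seq y"
  shows "inf_dim_closed_subspace (closed_span y)"
proof -
  interpret lin_seq y by fact
  have "subspace (closed_span y)"
    unfolding closed_span_def
  proof (rule subspaceI)
    show "0 \<in> closure V"
      using closure_subset span_zero by blast
  qed (rule closure_add closure_scale; simp)+
  moreover have "\<not> (\<exists>B. finite B \<and> closed_span y \<subseteq> span B)"
  proof
    assume "\<exists>B. finite B \<and> closed_span y \<subseteq> span B"
    then obtain B where B: "finite B" "closed_span y \<subseteq> span B"
      by (elim exE conjE)
    have "y ` {1..} \<subseteq> closed_span y"
      unfolding closed_span_def by (rule order_trans[OF span_superset closure_subset])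
    then have "finite (y ` {1..})"
      using independent_span_bound[OF B(1) indep order_trans[OF _ B(2)]] by simp
    then have "finite {1::nat..}"
      using inj by (rule finite_imageD)
    then show False
      by (simp add: infinite_Ici)
  qed
  ultimately show ?thesis
    by (simp add: inf_dim_closed_subspace_def closed_span_def)
qed

text \<open>Each component of v along w is the restriction of v to the interval hull of one block,
  so its norm is at most the square of C times that of v. Replacing every \<open>w i\<close> by
  \<open>u i\<close> then changes v by a geometric series.\<close>

lemma (in tail_bounded) near_combination:
  assumes w: "block_seq x {1..} w" and u: "\<And>i. i \<ge> 1 \<Longrightarrow> norm (w i - u i) \<le> \<eta> / 2 ^ i * norm (w i)"
    and W: "subspace W" "\<And>i. i \<ge> 1 \<Longrightarrow> u i \<in> W" and \<eta>: "\<eta> \<ge> 0" and v: "v \<in> span (w ` {1..})"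
  shows "\<exists>v'\<in>W. norm (v - v') \<le> 2 * \<eta> * C\<^sup>2 * norm v"
proof -
  interpret w: lin_seq w
    by (rule block_seq_lin_seq[OF lin_seq_axioms w])
  define S where "S = supp w v"
  have fS: "finite S" and S1: "\<And>i. i \<in> S \<Longrightarrow> i \<ge> 1"
    using w.finite_supp supp_pos[of w v] by (auto simp: S_def)
  define c where "c i = coef w v i" for i
  have ve: "(\<Sum>i\<in>S. c i *\<^sub>R w i) = v"
    using w.expand[OF v] by (simp add: S_def c_def)
  have wV: "w i \<in> V" "w i \<noteq> 0" if "i \<in> S" for i
    using w S1[OF that] by (auto simp: block_seq_def)
  have vV: "v \<in> V"
    by (rule block_seq_span[OF lin_seq_axioms w v])
  have part: "norm (c i *\<^sub>R w i) \<le> C\<^sup>2 * norm v" if i: "i \<in> S" for i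
  proof -
    define a where "a = Min (supp x (w i))"
    define b where "b = Max (supp x (w i))"
    have ne: "supp x (w i) \<noteq> {}"
      using supp_empty_iff wV[OF i] by blast
    have ab: "a \<in> supp x (w i)" "b \<in> supp x (w i)" "\<And>k. k \<in> supp x (w i) \<Longrightarrow> a \<le> k \<and> k \<le> b"
      unfolding a_def b_def using ne finite_supp by auto
    have succ: "succ_sets S (\<lambda>i. supp x (w i))"
      by (rule succ_sets_subset[OF block_seq_succ_sets[OF lin_seq_axioms w]]) (use S1 in auto)
    have zero: "coef x (w j) k = 0" if "j \<in> S" "j \<noteq> i" "a \<le> k" "k \<le> b" for j k
    proof (rule ccontr)
      assume "coef x (w j) k \<noteq> 0"
      then have k: "k \<in> supp x (w j)"
        by (simp add: supp_eq_coef)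
      consider "j < i" | "i < j"
        using \<open>j \<noteq> i\<close> by linarith
      then show False
      proof cases
        case 1
        then show ?thesis
          using succ_setsD[OF succ that(1) i 1 k ab(1)] that(3) by simp
      next
        case 2
        then show ?thesis
          using succ_setsD[OF succ i that(1) 2 ab(2) k] that(4) by simp
      qed
    qed
    have "proj x {a..b} v = c i *\<^sub>R w i"
    proof (rule coef_ext)
      fix k
      have "coef x v k = (\<Sum>j\<in>S. c j * coef x (w j) k)"
        unfolding ve[symmetric] using wV by (subst coef_sum) (auto simp: coef_scale span_scale)
      also have "\<dots> = c i * coef x (w i) k" if "a \<le> k" "k \<le> b"
        using zero that by (subst sum.remove[OF fS i]) auto
      finally have "a \<le> k \<and> k \<le> b \<Longrightarrow> coef x v k = c i * coef x (w i) k"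
        by blast
      moreover have "\<not> (a \<le> k \<and> k \<le> b) \<Longrightarrow> coef x (w i) k = 0"
        using ab(3)[of k] by (auto simp: supp_eq_coef)
      ultimately show "coef x (proj x {a..b} v) k = coef x (c i *\<^sub>R w i) k"
        using wV(1)[OF i] by (auto simp: coef_proj coef_scale)
    qed (auto simp: proj_in wV i span_scale)
    then show ?thesis
      using norm_interval[OF vV, of a b] by simp
  qed
  define v' where "v' = (\<Sum>i\<in>S. c i *\<^sub>R u i)"
  have "v' \<in> W"
    unfolding v'_def using W S1 by (intro subspace_sum subspace_scale) auto
  moreover have "norm (v - v') \<le> 2 * \<eta> * C\<^sup>2 * norm v"
  proof -
    have "v - v' = (\<Sum>i\<in>S. c i *\<^sub>R (w i - u i))"
      unfolding v'_def ve[symmetric] by (simp add: sum_subtractf scaleR_diff_right)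
    also have "norm \<dots> \<le> (\<Sum>i\<in>S. \<bar>c i\<bar> * norm (w i - u i))"
      by (rule order_trans[OF norm_sum]) simp
    also have "\<dots> \<le> (\<Sum>i\<in>S. (1 / 2) ^ i * (\<eta> * C\<^sup>2 * norm v))"
    proof (rule sum_mono)
      fix i assume i: "i \<in> S"
      have "\<bar>c i\<bar> * norm (w i - u i) \<le> \<bar>c i\<bar> * (\<eta> / 2 ^ i * norm (w i))"
        by (intro mult_left_mono u S1[OF i]) simp
      also have "\<dots> = \<eta> / 2 ^ i * norm (c i *\<^sub>R w i)"
        by simp
      also have "\<dots> \<le> \<eta> / 2 ^ i * (C\<^sup>2 * norm v)"
        by (intro mult_left_mono part[OF i]) (use \<eta> in simp)
      also have "\<dots> = (1 / 2) ^ i * (\<eta> * C\<^sup>2 * norm v)"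
        by (simp add: power_one_over divide_simps)
      finally show "\<bar>c i\<bar> * norm (w i - u i) \<le> (1 / 2) ^ i * (\<eta> * C\<^sup>2 * norm v)" .
    qed
    also have "\<dots> = (\<Sum>i\<in>S. (1 / 2) ^ i) * (\<eta> * C\<^sup>2 * norm v)"
      by (simp add: sum_distrib_right)
    also have "\<dots> \<le> 2 * (\<eta> * C\<^sup>2 * norm v)"
    proof (rule mult_right_mono)
      have "(\<Sum>i\<in>S. (1 / 2 :: real) ^ i) \<le> (\<Sum>i. (1 / 2) ^ i)"
        by (intro sum_le_suminf fS summable_geometric) auto
      also have "\<dots> = 2"
        by (subst suminf_geometric) auto
      finally show "(\<Sum>i\<in>S. (1 / 2 :: real) ^ i) \<le> 2" .
    qed (use \<eta> in simp)
    finally show ?thesis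
      by simp
  qed
  ultimately show ?thesis
    by blast
qed

text \<open>
  On a subspace where \<open>p\<close> is nearly proportional to the norm, the lower estimate of \<open>p\<close> passes to
  the norm; a block sequence close to that subspace inherits it.
\<close>

lemma ex_block_lower_est:
  fixes y :: "nat \<Rightarrow> 'a::real_normed_vector"
  assumes y: "basic_sequence y" and m: "m \<ge> 1" and tb: "tail_bounded (tail_seq m y) C"
    and t: "t > 0" and B: "B \<ge> 1"
    and p: "\<And>v. norm v \<le> p v" "\<And>v. p v \<le> B * norm v" "\<And>u v. p (u + v) \<le> p u + p v"
      "\<And>a v. p (a *\<^sub>R v) = \<bar>a\<bar> * p v"
    and est: "\<And>F v. F \<in> schreier A \<beta> \<Longrightarrow>
       (\<And>f. f \<in> F \<Longrightarrow> v f \<in> span (tail_seq m y ` {1..}) \<and> (\<forall>i\<in>supp (tail_seq m y) (v f). N f \<le> i)) \<Longrightarrow>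
       succ_sets F (\<lambda>f. supp (tail_seq m y) (v f)) \<Longrightarrow> t / 2 * (\<Sum>f\<in>F. p (v f)) \<le> p (\<Sum>f\<in>F. v f)"
    and W: "inf_dim_closed_subspace W" "W \<subseteq> closed_span y"
    and R: "R \<ge> 1" "\<And>u v. u \<in> W \<Longrightarrow> v \<in> W \<Longrightarrow> norm u = 1 \<Longrightarrow> norm v = 1 \<Longrightarrow> p u \<le> R * p v"
  shows "\<exists>w. block_seq (tail_seq m y) {1..} w \<and> lower_est A \<beta> w (t / (8 * R))"
proof -
  define z where "z = tail_seq m y"
  interpret z: tail_bounded z C
    using tb by (simp add: z_def)
  have lz: "lin_seq z" by unfold_locales
  have sW: "subspace W"
    using W(1) by (simp add: inf_dim_closed_subspace_def)
  obtain u0 where u0: "u0 \<in> W" "u0 \<noteq> 0"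
    using W(1) by (force simp: inf_dim_closed_subspace_def intro: finite.emptyI)
  define U where "U = {v\<in>W. norm v = 1}"
  \<comment> \<open>On the unit sphere of W the values of p lie between l and R l; up to the factor
    R, p is l times the norm there.\<close>
  define l where "l = (INF v\<in>U. p v)"
  have "(1 / norm u0) *\<^sub>R u0 \<in> U"
    using u0 sW by (auto simp: U_def subspace_scale)
  then have Une: "U \<noteq> {}"
    by blast
  have bdd: "bdd_below (p ` U)"
    using p(1) by (intro bdd_belowI[of _ 0]) (auto intro: order_trans[OF norm_ge_zero])
  have l1: "1 \<le> l"
    unfolding l_def
  proof (rule cINF_greatest[OF Une])
    show "1 \<le> p v" if "v \<in> U" for v
      using p(1)[of v] that by (simp add: U_def)
  qed
  have lU: "l \<le> p v" "p v \<le> R * l" if "v \<in> U" for v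
  proof -
    show "l \<le> p v"
      unfolding l_def by (rule cINF_lower[OF bdd that])
    have "p v / R \<le> l"
      unfolding l_def using Une R that by (intro cINF_greatest) (auto simp: U_def field_simps)
    then show "p v \<le> R * l"
      using R(1) by (simp add: field_simps)
  qed
  have lW: "l * norm v \<le> p v" "p v \<le> R * l * norm v" if v: "v \<in> W" for v
  proof -
    have "l * norm v \<le> p v \<and> p v \<le> R * l * norm v"
    proof (cases "v = 0")
      case True
      then show ?thesis
        using p(1)[of 0] p(2)[of 0] by simp
    next
      case False
      define v1 where "v1 = (1 / norm v) *\<^sub>R v"
      have "v1 \<in> U"
        using False v sW by (auto simp: U_def v1_def subspace_scale)
      moreover have "v = norm v *\<^sub>R v1"
        using False by (simp add: v1_def)
      then have "p v = norm v * p v1"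
        using p(4)[of "norm v" v1] by simp
      ultimately show ?thesis
        using lU[of v1] False by (simp add: mult.commute mult_left_mono)
    qed
    then show "l * norm v \<le> p v" "p v \<le> R * l * norm v"
      by auto
  qed
  \<comment> \<open>Chosen so that a combination of blocks differs from a vector of W by something
    whose p-value is at most a quarter of the norm.\<close>
  define \<eta> where "\<eta> = 1 / (8 * B * C\<^sup>2)"
  have \<eta>: "\<eta> > 0" "2 * \<eta> * C\<^sup>2 = 1 / (4 * B)"
    using B z.C_ge_1 by (auto simp: \<eta>_def field_simps)
  \<comment> \<open>Partial sums of N are used because they increase: for f \<le> k the k-th block
    then also lies beyond \<open>N f\<close>.\<close>
  obtain w u where w: "block_seq z {1..} w" and wu: "\<And>i. i \<ge> 1 \<Longrightarrow> u i \<in> W" "\<And>i. i \<ge> 1 \<Longrightarrow> norm (w i - u i) \<le> \<eta> / 2 ^ i * norm (w i)"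
    and wN: "\<And>i k. i \<ge> 1 \<Longrightarrow> k \<in> supp z (w i) \<Longrightarrow> (\<Sum>j\<le>i. N j) \<le> k"
    using block_seq_near_subspace[OF y W \<eta>(1) m, of "\<lambda>i. \<Sum>j\<le>i. N j"] unfolding z_def by metis
  \<comment> \<open>The error of a quarter of the norm is absorbed because l \<ge> 1 and R \<ge>
    1.\<close>
  have cmp: "l / 2 * norm v \<le> p v" "p v \<le> 2 * R * l * norm v" if v: "v \<in> span (w ` {1..})" for v
  proof -
    obtain v' where v': "v' \<in> W" "norm (v - v') \<le> 1 / (4 * B) * norm v"
      using z.near_combination[OF w wu(2) sW wu(1) _ v] \<eta> by auto
    have d: "norm (v - v') \<le> norm v / 4" "B * norm (v - v') \<le> norm v / 4"
    proof -
      show "B * norm (v - v') \<le> norm v / 4"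
        using v'(2) B by (simp add: field_simps)
      moreover have "1 * norm (v - v') \<le> B * norm (v - v')"
        using B by (intro mult_right_mono) auto
      ultimately show "norm (v - v') \<le> norm v / 4"
        by simp
    qed
    have pd: "p (v - v') \<le> norm v / 4" "p (v' - v) \<le> norm v / 4"
      using p(2)[of "v - v'"] p(2)[of "v' - v"] d(2) by (auto simp: norm_minus_commute)
    have nv: "3 / 4 * norm v \<le> norm v'" "norm v' \<le> 5 / 4 * norm v"
      using d(1) norm_triangle_ineq2[of v v'] norm_triangle_ineq2[of v' v] by (auto simp: norm_minus_commute)
    have "l * (3 / 4 * norm v) \<le> l * norm v'"
      using nv(1) l1 by (intro mult_left_mono) auto
    also have "\<dots> \<le> p v'"
      by (rule lW(1)[OF v'(1)])
    also have "\<dots> \<le> p v + p (v' - v)"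
      using p(3)[of v "v' - v"] by simp
    finally have "l * (3 / 4 * norm v) \<le> p v + norm v / 4"
      using pd(2) by simp
    moreover have "norm v \<le> l * norm v"
      using l1 mult_right_mono[of 1 l "norm v"] by simp
    ultimately show "l / 2 * norm v \<le> p v"
      by simp
    have "p v \<le> p v' + p (v - v')"
      using p(3)[of v' "v - v'"] by simp
    also have "\<dots> \<le> R * l * norm v' + norm v / 4"
      using lW(2)[OF v'(1)] pd(1) by simp
    also have "R * l * norm v' \<le> R * l * (5 / 4 * norm v)"
      using nv(2) R(1) l1 by (intro mult_left_mono) auto
    also have "R * l * (5 / 4 * norm v) = 5 / 4 * (R * l * norm v)"
      by simp
    finally have "p v \<le> 5 / 4 * (R * l * norm v) + norm v / 4"
      by simp
    moreover have "1 * norm v \<le> R * l * norm v"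
      using R(1) l1 mult_mono[of 1 R 1 l] by (intro mult_right_mono) auto
    moreover have "2 * R * l * norm v = 2 * (R * l * norm v)"
      by simp
    ultimately show "p v \<le> 2 * R * l * norm v"
      using norm_ge_zero[of v] by linarith
  qed
  have "lower_est A \<beta> w (t / (8 * R))"
    unfolding lower_est_def
  proof (intro allI impI)
    fix F v assume F: "F \<in> schreier A \<beta>" and b: "blk w F v"
    have v: "v f \<in> span (w ` {1..})" "\<And>i. i \<in> supp w (v f) \<Longrightarrow> f \<le> i" if "f \<in> F" for f
      using b that by (auto simp: blk_def)
    have sv: "(\<Sum>f\<in>F. v f) \<in> span (w ` {1..})"
      using v(1) by (rule span_sum)
    have "t / 2 * (\<Sum>f\<in>F. p (v f)) \<le> p (\<Sum>f\<in>F. v f)"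
    proof (rule est[OF F], unfold z_def[symmetric])
      show "succ_sets F (\<lambda>f. supp z (v f))"
        by (rule supp_block_succ[OF lz w b])
      show "v f \<in> z.V \<and> (\<forall>i\<in>supp z (v f). N f \<le> i)" if f: "f \<in> F" for f
      proof (intro conjI ballI)
        show "v f \<in> z.V"
          by (rule block_seq_span[OF lz w v(1)[OF f]])
        fix i assume "i \<in> supp z (v f)"
        then obtain k where k: "k \<in> supp w (v f)" "i \<in> supp z (w k)"
          unfolding supp_block_seq[OF lz w v(1)[OF f]] by blast
        have "N f \<le> (\<Sum>j\<le>k. N j)"
          using v(2)[OF f k(1)] by (intro member_le_sum) auto
        also have "\<dots> \<le> i"
          using wN[OF _ k(2)] k(1) supp_pos by force
        finally show "N f \<le> i" .
      qed
    qed
    also have "\<dots> \<le> 2 * R * l * norm (\<Sum>f\<in>F. v f)"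
      by (rule cmp(2)[OF sv])
    finally have 1: "t / 2 * (\<Sum>f\<in>F. p (v f)) \<le> 2 * R * l * norm (\<Sum>f\<in>F. v f)" .
    have "t / 2 * (l / 2 * (\<Sum>f\<in>F. norm (v f))) \<le> t / 2 * (\<Sum>f\<in>F. p (v f))"
      unfolding sum_distrib_left[of "l / 2"] using t cmp(1)[OF v(1)] by (intro mult_left_mono sum_mono) auto
    \<comment> \<open>The factor 8 arises from 2 in the constant t / 2 and from the two factors 2 in
      \<open>cmp\<close>; the unknown l cancels.\<close>
    with 1 have "l * (t * (\<Sum>f\<in>F. norm (v f))) \<le> l * (8 * R * norm (\<Sum>f\<in>F. v f))"
      by (simp add: mult_ac)
    then have "t * (\<Sum>f\<in>F. norm (v f)) \<le> 8 * R * norm (\<Sum>f\<in>F. v f)"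
      using l1 by simp
    then show "t / (8 * R) * (\<Sum>f\<in>F. norm (v f)) \<le> norm (\<Sum>f\<in>F. v f)"
      using R(1) by (simp add: field_simps)
  qed
  then show ?thesis
    using w by (auto simp: z_def)
qed

section \<open>Choice of the constants and conclusion\<close>

theorem corollary6p9:
  fixes e y :: "nat \<Rightarrow> 'a::banach"
    and \<gamma> :: "omega1 \<Rightarrow> real"
    and A :: "omega1 \<Rightarrow> nat \<Rightarrow> omega1"
  assumes "ladder_system A"
    and "asymptotic_l1 e"
    and "\<gamma> \<in> Delta_set A e"
    and "block_seq e {1..} y"
    and "Delta_stabilizes A y \<gamma>"
    and "\<exists>\<alpha>. \<gamma> \<alpha> > 0 \<and>
           (\<lambda>n. \<gamma> (\<alpha> \<odot> n) * gamma_hat \<gamma> \<alpha> powi (- int n)) \<longlonglongrightarrow> 0"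
  shows "\<exists>Z. inf_dim_closed_subspace Z \<and> Z \<subseteq> closed_span y \<and> arbitrarily_distortable Z"
proof -
  note A = assms(1)
  obtain \<alpha> where \<alpha>: "\<gamma> \<alpha> > 0" and lim: "(\<lambda>n. \<gamma> (\<alpha> \<odot> n) * gamma_hat \<gamma> \<alpha> powi (- int n)) \<longlonglongrightarrow> 0"
    using assms(6) by blast
  define a where "a k = \<gamma> (\<alpha> \<odot> k)" for k
  have y: "basic_sequence y"
    using assms(5) by (simp add: Delta_stabilizes_def)
  note ly = basic_sequence_lin_seq[OF y]
  obtain C where C: "\<And>m. m \<ge> 2 \<Longrightarrow> tail_bounded (tail_seq m y) C"
    using asymptotic_l1_tail_bounded[OF assms(2,4)] by blast
  have C1: "C \<ge> 1"
    using C[of 2] by (simp add: tail_bounded_def tail_bounded_axioms_def)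
  have sm: "a j * a k \<le> a (j + k)" for j k
    using stabilized_supermult[OF A assms(5), of "\<alpha> \<odot> k" "\<alpha> \<odot> j"] by (simp add: a_def omul_add mult.commute)
  have apos: "a k > 0" if "k \<ge> 1" for k
    using that
  proof (induction k rule: dec_induct)
    case base
    show ?case
      using \<alpha> by (simp add: a_def omega1_add_zero_left One_nat_def)
  next
    case (step k)
    have "0 < a k * a 1"
      using step \<alpha> by (simp add: a_def omega1_add_zero_left One_nat_def)
    also have "\<dots> \<le> a (Suc k)"
      using sm[of k 1] by (simp add: Suc_eq_plus1)
    finally show ?case .
  qed
  obtain \<theta> where \<theta>: "\<theta> > 0" "(\<lambda>k. root k (a k)) \<longlonglongrightarrow> \<theta>"
    using supermultiplicative_root_convergent[of a] apos sm stabilized_le_1[OF A assms(5)] by (auto simp: a_def)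
  have hat: "gamma_hat \<gamma> \<alpha> = \<theta>"
    unfolding gamma_hat_def using \<theta>(2) by (simp add: a_def limI)
  have lim0: "(\<lambda>n. a n / \<theta> ^ n) \<longlonglongrightarrow> 0"
    using lim by (simp add: hat a_def power_int_minus divide_inverse)
  have "distortable L (closed_span y)" if L: "L > 1" for L
  proof -
    \<comment> \<open>32 is the product of 8 from the lower estimate, 2 from t being half of the
      n-th power of \<theta>, and 2 from the bound of \<gamma> \<beta> + \<eta> by 2 \<gamma>
      \<beta>.\<close>
    obtain n where n: "n \<ge> 1" "a n / \<theta> ^ n < 1 / (32 * L)"
    proof -
      have "eventually (\<lambda>n. a n / \<theta> ^ n < 1 / (32 * L)) sequentially"
        using L by (intro order_tendstoD[OF lim0]) auto
      then have "eventually (\<lambda>n. n \<ge> 1 \<and> a n / \<theta> ^ n < 1 / (32 * L)) sequentially"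
        using eventually_ge_at_top[of 1] by eventually_elim auto
      then show thesis
        using that by (auto simp: eventually_sequentially)
    qed
    define \<beta> where "\<beta> = \<alpha> \<odot> n"
    \<comment> \<open>The n-th power of s is half that of \<theta>; this gives t below the critical
      value with a loss of only a factor 2.\<close>
    define s where "s = root n (1 / 2) * \<theta>"
    have "root n (1 / 2) < root n 1"
      using n(1) by (subst real_root_less_iff) auto
    then have s: "0 < s" "s < \<theta>"
      using n(1) \<theta>(1) by (auto simp: s_def)
    define t where "t = s ^ n"
    have t: "t > 0" "t = \<theta> ^ n / 2"
      using s n(1) by (auto simp: t_def s_def power_mult_distrib)
    \<comment> \<open>Room between s and \<theta>: eventually \<open>a k\<close> exceeds the k-th
      power of s', which outgrows that of s by any constant factor.\<close>
    define s' where "s' = (s + \<theta>) / 2"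
    have s': "s < s'" "s' < \<theta>" "s' > 0"
      using s by (auto simp: s'_def)
    have "(\<lambda>k. 4 * C\<^sup>2 * (s / s') ^ k) \<longlonglongrightarrow> 4 * C\<^sup>2 * 0"
      using s s' by (intro tendsto_intros LIMSEQ_power_zero) auto
    then have "eventually (\<lambda>k. 4 * C\<^sup>2 * (s / s') ^ k < 1) sequentially"
      by (intro order_tendstoD) auto
    moreover have "eventually (\<lambda>k. s' < root k (a k)) sequentially"
      using s' by (intro order_tendstoD[OF \<theta>(2)]) auto
    ultimately have "eventually (\<lambda>k. 4 * C\<^sup>2 * (s / s') ^ k < 1 \<and> s' < root k (a k)) sequentially"
      by eventually_elim auto
    then obtain K0 where K0: "\<And>k. k \<ge> K0 \<Longrightarrow> 4 * C\<^sup>2 * (s / s') ^ k < 1 \<and> s' < root k (a k)"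
      by (auto simp: eventually_sequentially)
    define K where "K = max K0 1"
    have nK: "n * K \<ge> K0" "n * K \<ge> 1" "K \<ge> 1"
    proof -
      have "1 * K \<le> n * K"
        using n(1) by (rule mult_right_mono) simp
      then show "n * K \<ge> K0" "n * K \<ge> 1"
        by (simp_all add: K_def)
    qed (simp add: K_def)
    \<comment> \<open>With c K equal to half of \<open>a (n * K)\<close> this is the smallness
      condition on the last summand of the new norm.\<close>
    have aK: "4 * C\<^sup>2 * s ^ (n * K) \<le> a (n * K)"
    proof -
      have "4 * C\<^sup>2 * (s / s') ^ (n * K) < 1"
        using K0[OF nK(1)] by simp
      then have "4 * C\<^sup>2 * s ^ (n * K) \<le> s' ^ (n * K)"
        using s' by (simp add: power_divide field_simps)
      also have "\<dots> \<le> root (n * K) (a (n * K)) ^ (n * K)"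
        using K0[OF nK(1)] s' by (intro power_mono) auto
      also have "\<dots> = a (n * K)"
      proof (rule real_root_pow_pos2)
        show "0 < n * K"
          using nK(2) by linarith
        show "0 \<le> a (n * K)"
          using apos[OF nK(2)] by simp
      qed
      finally show ?thesis .
    qed
    have b: "\<gamma> (\<beta> \<odot> k) = a (n * k)" for k
      by (simp add: \<beta>_def a_def omul_mult)
    have bpos: "\<gamma> (\<beta> \<odot> k) > 0" if "k \<ge> 1" for k
      unfolding b using mult_mono[of 1 n 1 k] that n(1) by (intro apos) simp
    have \<beta>1: "\<beta> \<odot> 1 = \<beta>"
      by (simp add: One_nat_def omega1_add_zero_left)
    \<comment> \<open>For k = 0 the families are single vectors and the estimate holds with constant
      1; otherwise half of the stabilized value leaves room for the error.\<close>
    define c where "c k = (if k = 0 then 1 else \<gamma> (\<beta> \<odot> k) / 2)" for k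
    have cpos: "c k > 0" for k
      using bpos[of k] by (auto simp: c_def)
    \<comment> \<open>This accuracy yields lower estimates with constants c k for all k up to K, and
      for k = 1 also the upper bound 2 \<gamma> \<beta> at the end.\<close>
    define \<eta> where "\<eta> = Min (c ` {1..K})"
    have \<eta>: "\<eta> > 0" "\<And>k. k \<in> {1..K} \<Longrightarrow> \<eta> \<le> \<gamma> (\<beta> \<odot> k) / 2"
    proof -
      show "\<eta> > 0"
        unfolding \<eta>_def using nK(3) cpos by (subst Min_gr_iff) auto
      show "\<eta> \<le> \<gamma> (\<beta> \<odot> k) / 2" if "k \<in> {1..K}" for k
      proof -
        have "\<eta> \<le> c k"
          unfolding \<eta>_def using that by (intro Min_le) auto
        then show ?thesis
          using that by (auto simp: c_def)
      qed
    qed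
    obtain m where m: "m \<ge> 2" and stab: "\<And>k w. k \<in> {1..K} \<Longrightarrow> block_seq (tail_seq m y) {1..} w \<Longrightarrow>
        \<bar>delta A (\<beta> \<odot> k) w - \<gamma> (\<beta> \<odot> k)\<bar> < \<eta>"
      using Delta_stabilizes_uniform[OF assms(5), of "(\<lambda>k. \<beta> \<odot> k) ` {1..K}" \<eta>] \<eta>(1) by blast
    define z where "z = tail_seq m y"
    interpret z: tail_bounded z C
      unfolding z_def by (rule C[OF m])
    have lz: "lin_seq z" by unfold_locales
    have low: "lower_est A (\<beta> \<odot> k) z (c k)" if "k \<le> K" for k
    proof (cases "k = 0")
      case True
      then show ?thesis
        by (simp add: c_def lower_est_0)
    next
      case False
      then have k: "k \<in> {1..K}"
        using that by auto
      have "c k \<le> delta A (\<beta> \<odot> k) z"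
        using stab[OF k block_seq_refl[OF lz, unfolded z_def]] \<eta>(2)[OF k] False by (auto simp: c_def z_def)
      then show ?thesis
        by (rule lower_est_mono[OF lower_est_delta[OF A lz]])
    qed
    have small: "t ^ K * (C\<^sup>2 / c K) \<le> 1 / 2"
    proof -
      have "c K = a (n * K) / 2"
        using nK(3) b by (simp add: c_def)
      moreover have "t ^ K = s ^ (n * K)"
        by (simp add: t_def power_mult)
      ultimately show ?thesis
        using aK apos[OF nK(2)] by (simp add: field_simps)
    qed
    obtain q N B where B: "B \<ge> 1"
      and q_le: "\<forall>v\<in>z.V. norm v \<le> q v \<and> q v \<le> B * norm v"
      and q_add: "\<forall>u\<in>z.V. \<forall>v\<in>z.V. q (u + v) \<le> q u + q v"
      and q_scale: "\<forall>a. \<forall>v\<in>z.V. q (a *\<^sub>R v) \<le> \<bar>a\<bar> * q v"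
      and qest: "\<forall>F v. F \<in> schreier A \<beta> \<longrightarrow> (\<forall>f\<in>F. v f \<in> z.V \<and> (\<forall>i\<in>supp z (v f). N f \<le> i)) \<longrightarrow>
       succ_sets F (\<lambda>f. supp z (v f)) \<longrightarrow> t / 2 * (\<Sum>f\<in>F. q (v f)) \<le> q (\<Sum>f\<in>F. v f)"
      using z.ex_renorming[of A t K \<beta> c, OF A t(1) low cpos small] by (auto elim!: exE conjE)
    have "\<exists>p. (\<forall>v. norm v \<le> p v \<and> p v \<le> B * norm v) \<and> (\<forall>u v. p (u + v) \<le> p u + p v) \<and>
        (\<forall>a v. p (a *\<^sub>R v) = \<bar>a\<bar> * p v) \<and> (\<forall>v\<in>z.V. p v = q v)"
      by (rule ex_norm_extension[OF subspace_span B]) (use q_le q_add q_scale in auto)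
    then obtain p where p_ext: "\<forall>v. norm v \<le> p v \<and> p v \<le> B * norm v" "\<forall>u v. p (u + v) \<le> p u + p v"
        "\<forall>a v. p (a *\<^sub>R v) = \<bar>a\<bar> * p v" "\<forall>v\<in>z.V. p v = q v"
      by (elim exE conjE)
    then have p: "\<And>v. norm v \<le> p v" "\<And>v. p v \<le> B * norm v" "\<And>u v. p (u + v) \<le> p u + p v"
        "\<And>a v. p (a *\<^sub>R v) = \<bar>a\<bar> * p v" "\<And>v. v \<in> z.V \<Longrightarrow> p v = q v"
      by simp_all
    have pest: "t / 2 * (\<Sum>f\<in>F. p (v f)) \<le> p (\<Sum>f\<in>F. v f)" if "F \<in> schreier A \<beta>"
      "\<And>f. f \<in> F \<Longrightarrow> v f \<in> z.V \<and> (\<forall>i\<in>supp z (v f). N f \<le> i)" "succ_sets F (\<lambda>f. supp z (v f))" for F v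
    proof -
      have "(\<Sum>f\<in>F. v f) \<in> z.V"
        using that(2) by (intro span_sum) blast
      then show ?thesis
        using qest[rule_format, OF that(1) _ that(3)] that(2) p(5) by simp
    qed
    have "equivalent_norm_on (closed_span y) p"
      unfolding equivalent_norm_on_def
    proof (intro conjI ballI allI)
      show "p v = 0 \<longleftrightarrow> v = 0" for v
        using p(1)[of v] p(2)[of v] by auto
      show "\<exists>a>0. \<exists>b>0. \<forall>v\<in>closed_span y. a * norm v \<le> p v \<and> p v \<le> b * norm v"
        using p(1,2) B by (intro exI[of _ 1] conjI exI[of _ B]) auto
    qed (use p(3,4) in auto)
    moreover have "distortion (closed_span y) p \<ge> L"
      unfolding distortion_def
    proof (rule cINF_greatest)
      show "{W. inf_dim_closed_subspace W \<and> W \<subseteq> closed_span y} \<noteq> {}"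
        using inf_dim_closed_span[OF ly] by blast
      fix W assume "W \<in> {W. inf_dim_closed_subspace W \<and> W \<subseteq> closed_span y}"
      then have W: "inf_dim_closed_subspace W" "W \<subseteq> closed_span y"
        by auto
      define T where "T = {p v / p w | v w. v \<in> W \<and> w \<in> W \<and> norm v = 1 \<and> norm w = 1}"
      \<comment> \<open>A real \<open>Sup\<close> is informative only for bounded sets; on the unit
        sphere p lies between 1 and B.\<close>
      have bdd: "bdd_above T"
      proof (rule bdd_aboveI[of _ B])
        fix r assume "r \<in> T"
        then obtain v w where vw: "r = p v / p w" "norm v = 1" "norm w = 1"
          by (auto simp: T_def)
        have "p v \<le> B" "1 \<le> p w"
          using p(2)[of v] p(1)[of w] vw by auto
        moreover have "B * 1 \<le> B * p w"
          using \<open>1 \<le> p w\<close> B by (intro mult_left_mono) auto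
        ultimately have "p v \<le> B * p w"
          by simp
        then show "r \<le> B"
          unfolding vw(1) using \<open>1 \<le> p w\<close> by (simp add: divide_le_eq)
      qed
      define R where "R = Sup T"
      have ratio: "p v \<le> R * p w" if "v \<in> W" "w \<in> W" "norm v = 1" "norm w = 1" for v w
      proof -
        have "p v / p w \<le> R"
          unfolding R_def using that by (intro cSup_upper[OF _ bdd]) (auto simp: T_def)
        moreover have "p w > 0"
          using p(1)[of w] that by simp
        ultimately show ?thesis
          by (simp add: field_simps)
      qed
      have "R \<ge> 1"
      proof -
        obtain u0 where u0: "u0 \<in> W" "u0 \<noteq> 0"
          using W(1) by (force simp: inf_dim_closed_subspace_def intro: finite.emptyI)
        define u1 where "u1 = (1 / norm u0) *\<^sub>R u0"
        have u1: "u1 \<in> W" "norm u1 = 1"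
          using u0 W(1) by (auto simp: u1_def inf_dim_closed_subspace_def subspace_scale)
        then have "p u1 > 0"
          using p(1)[of u1] by simp
        then show ?thesis
          using ratio[OF u1(1) u1(1) u1(2) u1(2)] by simp
      qed
      have "\<exists>w. block_seq z {1..} w \<and> lower_est A \<beta> w (t / (8 * R))"
        unfolding z_def
        by (rule ex_block_lower_est[OF y _ C[OF m] t(1) B p(1-4) pest[unfolded z_def] W \<open>R \<ge> 1\<close>];
          (rule ratio)?; use m in simp)
      then obtain w where w: "block_seq z {1..} w" "lower_est A \<beta> w (t / (8 * R))"
        by (elim exE conjE)
      \<comment> \<open>The two sides meet here: the new norm forces \<open>delta\<close> at w up
        unless R is large, while w is a block sequence of the stabilized tail and so has
        \<open>delta\<close> near \<gamma> \<beta>.\<close>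
      have "t / (8 * R) \<le> delta A \<beta> w"
        using t(1) \<open>R \<ge> 1\<close> by (intro lower_est_le_delta[OF A block_seq_lin_seq[OF lz w(1)] _ w(2)]) auto
      also have "\<dots> \<le> \<gamma> \<beta> + \<eta>"
        using stab[of 1 w] nK(3) w(1) unfolding \<beta>1 by (auto simp: z_def)
      also have "\<dots> \<le> 2 * a n"
        using \<eta>(2)[of 1] nK(3) apos[OF n(1)] unfolding \<beta>1 by (auto simp: \<beta>_def a_def)
      finally have "\<theta> ^ n \<le> 32 * a n * R"
        using \<open>R \<ge> 1\<close> t(2) by (simp add: field_simps)
      moreover have "32 * L * a n < \<theta> ^ n"
        using n(2) \<theta>(1) L by (simp add: field_simps)
      ultimately have "32 * a n * L < 32 * a n * R"
        by (simp add: mult_ac)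
      then show "L \<le> R"
        using apos[OF n(1)] by simp
    qed
    ultimately show ?thesis
      unfolding distortable_def by blast
  qed
  then show ?thesis
    using inf_dim_closed_span[OF ly] by (auto simp: arbitrarily_distortable_def)
qed

end
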